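(* Fix $n\ge2$ and let $K_m=\ker\left(R_m^t:\mathbb C[u]^{(n)}\to\mathbb C[u]^{(n-m)}\right)$ for $m=1,2$. Then $$K_1\cap K_2=\{0\},$$ or $$\mathrm{image}(R_1)+\mathrm{image}(R_2)=\mathbb C[u]^{(n)}.$$ Therefore, in principle, all moments $E(u^P\bar u^Q)$ can be determined by using only $\overline L_{-1}$ and $\overline L_{-2}$.
   Context: **Polynomials and operators.** $\mathbb C[u]=\mathbb C[u_1,u_2,\dots]$, and $\mathbb C[u]^{(n)}$ is the span of the monomials $u^p=\prod_{k\ge1}u_k^{p_k}$ with $\sum_kkp_k=n$; $\mathbb C[\bar u]^{(n)}$ is defined similarly. The linear maps $R_1:\mathbb C[u]^{(n-1)}\to\mathbb C[u]^{(n)}$ and $R_2:\mathbb C[u]^{(n-2)}\to\mathbb C[u]^{(n)}$ are $$R_1=\sum_{k\ge1}\left(2u_1u_k-(k+2)u_{k+1}\right)\frac{\partial}{\partial u_k}-2u_1,$$ $$R_2=2P_2-\sum_{j\ge1}\left(P_2u_j-3(j+2)u_1u_{j+1}+(j+3)u_{j+2}-p^{(-1)}_{j+2}\right)\frac{\partial}{\partial u_j},$$ where $P_2=7u_1^2-4u_2$ and $\left(1+\sum_{k\ge1}u_kz^k\right)^{-1}=\sum_{k\ge0}p^{(-1)}_kz^k$. $R_m^t$ is the adjoint of $R_m$ with respect to the Hermitian inner product on $\mathbb C[u]$ for which the monomials $\frac1{\sqrt{p!}}u^p$, $p!=p_1!p_2!\cdots$, form an orthonormal basis. **Moments.** Werner's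 measures are the nontrivial family $\{\mu_S\}$ (unique up to an overall positive constant) of positive Borel measures on the spaces of self-avoiding loops on Riemann surfaces $S$ satisfying conformal restriction: for each conformal embedding $S_1\to S_2$, $\mu_{S_2}$ restricted to loops in $S_1$ is $\mu_{S_1}$. (Nontrivial: for some $0<a<A$, the set of loops surrounding $0$ that lie in $\{0<|z|<A\}$ but not in $\{|z|<a\}$ has finite positive measure.) Let $\mu_0$ be the restriction of $\mu_{\mathbb C}$ to loops in $\mathbb C\setminus\{0\}$ surrounding $0$. For such a loop $\gamma$, let $\phi_+(z)=\rho_0z(1+\sum_{k\ge1}u_kz^k)$, $\rho_0>0$, be the normalized conformal map of the unit disk onto the bounded component of the complement of $\gamma$, fixing $0$, and let $\rho_\infty>0$ be the transfinite diameter of $\gamma$, i.e. the leading coefficient of the normalized conformal map $\phi_-(z)=\rho_\infty z(1+\sum_{k\ge1}b_kz^{-k})$ of $\{|z|>1\}\cup\{\infty\}$ onto the component containing $\infty$. Then $d\mu_0=d\nu_0(u)\times\frac{d\rho_\infty}{\rho_\infty}$, where $u(z)=z(1+\sum_{k\ge1}u_kz^k)$ and the finite measure $\nu_0$ is normalized to be a probability measure. $E(\cdot)=\int(\cdot)\,d\nu_0$, and the moments are the numbers $E(u^P\bar u^Q)$, with $u^P$, $\bar u^Q$ monomials in the $u_k$ and the $\bar u_k$. **The operators $\overline L_{-m}$.** For functions $F$ of the loop $\gamma$, $$\overline L_{-m}F=\frac12\left(\frac{d}{dt}\Big|_{t=0}F(\gamma+t\gamma^{-m+1})+i\,\frac{d}{dt}\Big|_{t=0}F(\gamma+ti\gamma^{-m+1})\right),$$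 a complex derivation. It annihilates $\rho_\infty$ for $m\ge1$. With $u_0=1$, $$\overline L_{-1}\rho_0=-\bar u_1,\quad \overline L_{-1}u_k=\rho_0^{-1}k(u_{k-1}-\bar u_1u_k),\quad \overline L_{-1}\bar u_k=\rho_0^{-1}(k+2)(\bar u_1\bar u_k-\bar u_{k+1}),$$ $$\overline L_{-2}\rho_0=\tfrac12\rho_0^{-1}\bar P_2,\qquad \overline L_{-2}u_j=\rho_0^{-2}\left(\tfrac j2u_j\bar P_2-3ju_{j-1}\bar u_1+(j-1)u_{j-2}\right)$$ (the last term being $0$ for $j=1$), and $$\overline L_{-2}\bar u_j=\rho_0^{-2}\,\overline{\left(p^{(-1)}_{j+2}-(j+3)u_{j+2}+3(j+2)u_1u_{j+1}-\tfrac12(j+2)P_2u_j\right)}.$$ On $\mathbb C[u]^{(n)}\otimes\mathbb C[\bar u]^{(n-m)}$, $m=1,2$, the component of $f\mapsto\overline L_{-m}(\rho_0^mf)$ in $\mathbb C[u]^{(n)}\otimes\mathbb C[\bar u]^{(n)}$ is $1\otimes\overline R_m$, where $\overline R_m$ is the complex conjugate of $R_m$; the remaining components lie in $\mathbb C[u]^{(n-j)}\otimes\mathbb C[\bar u]^{(n-j)}$ with $1\le j\le m$. Using $\overline L_{-m}$ to determine moments means using the identities $E\left(\overline L_{-m}(\rho_0^mf)\right)=0$ for such $f$, which follow from infinitesimal conformal invariance of $\mu_0$. *)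

theory Defs
  imports
    "HOL-Probability.Probability"
    "HOL-Complex_Analysis.Complex_Analysis"
    "HOL-Library.Poly_Mapping"
    "HOL-Computational_Algebra.Formal_Power_Series"
begin

section \<open>The polynomial ring in infinitely many variables\<close>

text \<open>
  A monomial is a finitely supported exponent vector. The variable $u_k$ ($k \ge 1$) has
  position $k - 1$, so that every element of the type \<open>upoly\<close> is a polynomial
  in $u_1, u_2, \dots$ and the convention $u_0 = 1$ costs nothing.
\<close>

type_synonym mono = "nat \<Rightarrow>\<^sub>0 nat"
type_synonym upoly = "mono \<Rightarrow>\<^sub>0 complex"

definition weight :: "mono \<Rightarrow> nat" where
  "weight p = (\<Sum>i\<in>Poly_Mapping.keys p. Suc i * Poly_Mapping.lookup p i)"

definition mono_fact :: "mono \<Rightarrow> nat" where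
  "mono_fact p = (\<Prod>i\<in>Poly_Mapping.keys p. fact (Poly_Mapping.lookup p i))"

definition U :: "nat \<Rightarrow> upoly" where
  "U k = (if k = 0 then 1 else Poly_Mapping.single (Poly_Mapping.single (k - 1) 1) 1)"

definition graded :: "nat \<Rightarrow> upoly set" where
  "graded n = {f. \<forall>p\<in>Poly_Mapping.keys f. weight p = n}"

text \<open>The partial derivative with respect to $u_k$; it is only used for $k \ge 1$.\<close>

definition pd :: "nat \<Rightarrow> upoly \<Rightarrow> upoly" where
  "pd k f = (\<Sum>p\<in>Poly_Mapping.keys f.
     Poly_Mapping.single (p - Poly_Mapping.single (k - 1) 1)
                         (of_nat (Poly_Mapping.lookup p (k - 1)) * Poly_Mapping.lookup f p))"

text \<open>
  Both functions below are applied to the sequence of variables \<open>U\<close> and to sequences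
  of complex numbers, always with value 1 at index 0. The first one lists
  the coefficients of $(1 + \sum_{k \ge 1} s_k z^k)^{-1}$.
\<close>

definition pinv :: "(nat \<Rightarrow> 'a::comm_ring_1) \<Rightarrow> nat \<Rightarrow> 'a" where
  "pinv s k = fps_nth (fps_right_inverse (Abs_fps s) 1) k"

definition P2 :: "(nat \<Rightarrow> 'a::comm_ring_1) \<Rightarrow> 'a" where
  "P2 s = 7 * (s 1)^2 - 4 * s 2"

lemma pinv_inverse:
  assumes "s 0 = 1"
  shows "Abs_fps s * Abs_fps (pinv s) = 1"
proof -
  have "Abs_fps (pinv s) = fps_right_inverse (Abs_fps s) 1"
    by (simp add: pinv_def fps_eq_iff)
  then show ?thesis
    using fps_right_inverse[of "Abs_fps s" 1] assms by simp
qed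

text \<open>
  In the two operators the sums over all $k \ge 1$ are restricted to the (finitely many)
  $k$ for which the partial derivative does not vanish.
\<close>

definition R1 :: "upoly \<Rightarrow> upoly" where
  "R1 f = (\<Sum>k | 1 \<le> k \<and> pd k f \<noteq> 0.
              (2 * U 1 * U k - of_nat (k + 2) * U (k + 1)) * pd k f)
          - 2 * U 1 * f"

definition R2 :: "upoly \<Rightarrow> upoly" where
  "R2 f = 2 * P2 U * f
          - (\<Sum>j | 1 \<le> j \<and> pd j f \<noteq> 0.
              (P2 U * U j - 3 * of_nat (j + 2) * U 1 * U (j + 1)
                + of_nat (j + 3) * U (j + 2) - pinv U (j + 2)) * pd j f)"

text \<open>The Hermitian inner product for which the $u^p / \sqrt{p!}$ are orthonormal.\<close>

definition herm :: "upoly \<Rightarrow> upoly \<Rightarrow> complex" where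
  "herm f g = (\<Sum>p\<in>Poly_Mapping.keys f \<inter> Poly_Mapping.keys g.
                 of_nat (mono_fact p) * Poly_Mapping.lookup f p * cnj (Poly_Mapping.lookup g p))"

text \<open>
  \<open>graded_adjoint R m n\<close> is the adjoint, from degree $n$ to degree $n - m$, of an operator
  \<open>R\<close> mapping degree $n - m$ to degree $n$ (these spaces are finite dimensional).
\<close>

definition graded_adjoint :: "(upoly \<Rightarrow> upoly) \<Rightarrow> nat \<Rightarrow> nat \<Rightarrow> upoly \<Rightarrow> upoly" where
  "graded_adjoint R m n g =
     (THE h. h \<in> graded (n - m) \<and> (\<forall>f\<in>graded (n - m). herm (R f) g = herm f h))"

definition adjoint_kernel :: "(upoly \<Rightarrow> upoly) \<Rightarrow> nat \<Rightarrow> nat \<Rightarrow> upoly set" where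
  "adjoint_kernel R m n = {g \<in> graded n. graded_adjoint R m n g = 0}"


section \<open>Riemann surfaces and self-avoiding loops\<close>

text \<open>
  A Riemann surface has at most continuum many points, so taking the points from the type
  \<^typ>\<open>complex\<close>, with an arbitrary topology, loses no surface up to isomorphism.
\<close>

record surface =
  surf_top :: "complex topology"
  charts :: "(complex set \<times> (complex \<Rightarrow> complex)) set"

abbreviation points :: "surface \<Rightarrow> complex set" where
  "points S \<equiv> topspace (surf_top S)"

definition riemann_surface :: "surface \<Rightarrow> bool" where
  "riemann_surface S \<longleftrightarrow>
     Hausdorff_space (surf_top S) \<and> second_countable (surf_top S) \<and>
     connected_space (surf_top S) \<and> points S \<noteq> {} \<and>
     (\<Union>(V, \<phi>)\<in>charts S. V) = points S \<and>
     (\<forall>(V, \<phi>)\<in>charts S. openin (surf_top S) V \<and> open (\<phi> ` V) \<and>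
        homeomorphic_map (subtopology (surf_top S) V) (top_of_set (\<phi> ` V)) \<phi>) \<and>
     (\<forall>(V, \<phi>)\<in>charts S. \<forall>(W, \<psi>)\<in>charts S.
        (\<lambda>z. \<psi> (inv_into V \<phi> z)) holomorphic_on \<phi> ` (V \<inter> W))"

definition conformal_embedding :: "surface \<Rightarrow> surface \<Rightarrow> (complex \<Rightarrow> complex) \<Rightarrow> bool" where
  "conformal_embedding S1 S2 f \<longleftrightarrow>
     continuous_map (surf_top S1) (surf_top S2) f \<and> inj_on f (points S1) \<and>
     (\<forall>(V, \<phi>)\<in>charts S1. \<forall>(W, \<psi>)\<in>charts S2.
        (\<lambda>z. \<psi> (f (inv_into V \<phi> z))) holomorphic_on \<phi> ` {x \<in> V. f x \<in> W})"

definition plane :: surface where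
  "plane = \<lparr>surf_top = euclidean, charts = {(UNIV, id)}\<rparr>"

definition loops :: "surface \<Rightarrow> complex set set" where
  "loops S = {\<gamma>. \<exists>g. continuous_map (top_of_set (sphere (0::complex) 1)) (surf_top S) g \<and>
                     inj_on g (sphere 0 1) \<and> \<gamma> = g ` sphere 0 1}"

text \<open>
  Loops are unparametrized, and the space of loops carries the Vietoris topology, which for a
  metrizable surface is the topology of the Hausdorff distance.
\<close>

definition loop_topology :: "surface \<Rightarrow> complex set topology" where
  "loop_topology S = topology_generated_by
     ({{\<gamma> \<in> loops S. \<gamma> \<subseteq> V} | V. openin (surf_top S) V} \<union>
      {{\<gamma> \<in> loops S. \<gamma> \<inter> V \<noteq> {}} | V. openin (surf_top S) V})"

definition loop_borel :: "surface \<Rightarrow> complex set measure" where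
  "loop_borel S = sigma (loops S) {W. openin (loop_topology S) W}"


section \<open>Werner's measures\<close>

definition conformal_restriction :: "(surface \<Rightarrow> complex set measure) \<Rightarrow> bool" where
  "conformal_restriction \<mu> \<longleftrightarrow>
     (\<forall>S1 S2 f. riemann_surface S1 \<and> riemann_surface S2 \<and> conformal_embedding S1 S2 f \<longrightarrow>
        (\<forall>A\<in>sets (loop_borel S2). (\<forall>\<gamma>\<in>A. \<gamma> \<subseteq> f ` points S1) \<longrightarrow>
           emeasure (\<mu> S2) A = emeasure (\<mu> S1) {\<gamma> \<in> loops S1. f ` \<gamma> \<in> A}))"

definition nontrivial_family :: "(surface \<Rightarrow> complex set measure) \<Rightarrow> bool" where
  "nontrivial_family \<mu> \<longleftrightarrow>
     (\<exists>a A::real. 0 < a \<and> a < A \<and>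
        (let B = {\<gamma> \<in> loops plane. 0 \<in> inside \<gamma> \<and> \<gamma> \<subseteq> {z. 0 < norm z \<and> norm z < A}
                                   \<and> \<not> \<gamma> \<subseteq> {z. norm z < a}}
         in 0 < emeasure (\<mu> plane) B \<and> emeasure (\<mu> plane) B < \<infinity>))"

definition werner_family :: "(surface \<Rightarrow> complex set measure) \<Rightarrow> bool" where
  "werner_family \<mu> \<longleftrightarrow>
     (\<forall>S. riemann_surface S \<longrightarrow> sets (\<mu> S) = sets (loop_borel S)) \<and>
     conformal_restriction \<mu> \<and> nontrivial_family \<mu>"

definition loops0 :: "complex set set" where
  "loops0 = {\<gamma> \<in> loops plane. 0 \<in> inside \<gamma>}"

definition mu0 :: "(surface \<Rightarrow> complex set measure) \<Rightarrow> complex set measure" where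
  "mu0 \<mu> = restrict_space (\<mu> plane) loops0"


section \<open>Uniformization coordinates of a loop\<close>

definition interior_map :: "complex set \<Rightarrow> (complex \<Rightarrow> complex) \<Rightarrow> bool" where
  "interior_map \<gamma> \<phi> \<longleftrightarrow>
     \<phi> holomorphic_on ball 0 1 \<and> inj_on \<phi> (ball 0 1) \<and> \<phi> ` ball 0 1 = inside \<gamma> \<and>
     \<phi> 0 = 0 \<and> (\<exists>\<rho>>0. deriv \<phi> 0 = of_real \<rho>)"

text \<open>
  The values of the chosen map outside the unit disk are arbitrary,
  but only its derivatives at 0 are used.
\<close>

definition phi_plus :: "complex set \<Rightarrow> complex \<Rightarrow> complex" where
  "phi_plus \<gamma> = (SOME \<phi>. interior_map \<gamma> \<phi>)"

definition rho0 :: "complex set \<Rightarrow> real" where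
  "rho0 \<gamma> = Re (deriv (phi_plus \<gamma>) 0)"

text \<open>
  $\phi_+(z) = \rho_0 z (1 + \sum_{k \ge 1} u_k z^k)$; the sequence of
  coefficients starts with the value 1 at index 0.
\<close>

definition ucoeff :: "complex set \<Rightarrow> nat \<Rightarrow> complex" where
  "ucoeff \<gamma> k = (deriv ^^ Suc k) (phi_plus \<gamma>) 0 / (fact (Suc k) * of_real (rho0 \<gamma>))"

text \<open>The transfinite diameter, as the leading coefficient of the exterior conformal map.\<close>

definition rho_inf :: "complex set \<Rightarrow> real" where
  "rho_inf \<gamma> = (THE \<rho>. 0 < \<rho> \<and>
     (\<exists>\<phi>. \<phi> holomorphic_on {z. 1 < norm z} \<and> inj_on \<phi> {z. 1 < norm z} \<and>
          \<phi> ` {z. 1 < norm z} = outside \<gamma> \<and>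
          ((\<lambda>z. \<phi> z / z) \<longlongrightarrow> of_real \<rho>) at_infinity))"

abbreviation seq_borel :: "(nat \<Rightarrow> complex) measure" where
  "seq_borel \<equiv> (\<Pi>\<^sub>M k\<in>UNIV. borel)"

definition dlog :: "real measure" where
  "dlog = density lborel (\<lambda>r. ennreal (indicator {0<..} r / r))"

text \<open>
  The decomposition of \<open>mu0\<close> as $d\nu_0(u) \times d\rho_\infty / \rho_\infty$, with \<open>\<nu>\<close> normalized to be a
  probability measure. Since $\{\mu_S\}$ is only unique up to a constant, the
  normalization is expressed by the factor \<open>c\<close>.
\<close>

definition loop_law ::
    "(surface \<Rightarrow> complex set measure) \<Rightarrow> (nat \<Rightarrow> complex) measure \<Rightarrow> bool" where
  "loop_law \<mu> \<nu> \<longleftrightarrow>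
     prob_space \<nu> \<and> sets \<nu> = sets seq_borel \<and>
     (\<lambda>\<gamma>. (ucoeff \<gamma>, rho_inf \<gamma>)) \<in> mu0 \<mu> \<rightarrow>\<^sub>M seq_borel \<Otimes>\<^sub>M borel \<and>
     (\<exists>c>0. distr (mu0 \<mu>) (seq_borel \<Otimes>\<^sub>M borel) (\<lambda>\<gamma>. (ucoeff \<gamma>, rho_inf \<gamma>))
              = scale_measure (ennreal c) (\<nu> \<Otimes>\<^sub>M dlog))"


section \<open>Moments\<close>

definition mono_val :: "mono \<Rightarrow> (nat \<Rightarrow> complex) \<Rightarrow> complex" where
  "mono_val p s = (\<Prod>i\<in>Poly_Mapping.keys p. s (Suc i) ^ Poly_Mapping.lookup p i)"

definition moment :: "(nat \<Rightarrow> complex) measure \<Rightarrow> mono \<Rightarrow> mono \<Rightarrow> complex" where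
  "moment \<nu> P Q = (\<integral>s. mono_val P s * cnj (mono_val Q s) \<partial>\<nu>)"

text \<open>
  An element of $\mathbb{C}[u] \otimes \mathbb{C}[\bar u]$ is given by its coefficients with
  respect to the basis $u^P \bar u^Q$.
\<close>

type_synonym bipoly = "(mono \<times> mono) \<Rightarrow>\<^sub>0 complex"

definition bigraded :: "nat \<Rightarrow> nat \<Rightarrow> bipoly set" where
  "bigraded n n' = {f. \<forall>(P, Q)\<in>Poly_Mapping.keys f. weight P = n \<and> weight Q = n'}"

definition bieval :: "bipoly \<Rightarrow> (nat \<Rightarrow> complex) \<Rightarrow> complex" where
  "bieval f s = (\<Sum>(P, Q)\<in>Poly_Mapping.keys f.
                   Poly_Mapping.lookup f (P, Q) * (mono_val P s * cnj (mono_val Q s)))"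

text \<open>
  The linear extension of $u^P \bar u^Q \mapsto M(P, Q)$. For \<open>M = moment \<nu>\<close> this is
  the expectation $E$ (all moments are finite, because the $u_k$ are bounded functions).
\<close>

definition expect :: "(mono \<Rightarrow> mono \<Rightarrow> complex) \<Rightarrow> bipoly \<Rightarrow> complex" where
  "expect M f = (\<Sum>(P, Q)\<in>Poly_Mapping.keys f. Poly_Mapping.lookup f (P, Q) * M P Q)"


section \<open>The operators $\overline L_{-m}$\<close>

definition deform :: "nat \<Rightarrow> complex \<Rightarrow> complex set \<Rightarrow> complex set" where
  "deform m w \<gamma> = (\<lambda>z. z + w * z powi (1 - int m)) ` \<gamma>"

definition Lbar :: "nat \<Rightarrow> (complex set \<Rightarrow> complex) \<Rightarrow> complex set \<Rightarrow> complex" where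
  "Lbar m F \<gamma> =
     (vector_derivative (\<lambda>t. F (deform m (of_real t) \<gamma>)) (at 0)
      + \<i> * vector_derivative (\<lambda>t. F (deform m (of_real t * \<i>) \<gamma>)) (at 0)) / 2"

definition loop_differentiable :: "nat \<Rightarrow> (complex set \<Rightarrow> complex) \<Rightarrow> complex set \<Rightarrow> bool" where
  "loop_differentiable m F \<gamma> \<longleftrightarrow>
     (\<lambda>t::real. F (deform m (of_real t) \<gamma>)) differentiable (at 0) \<and>
     (\<lambda>t::real. F (deform m (of_real t * \<i>) \<gamma>)) differentiable (at 0)"

text \<open>
  The known action of $\overline L_{-1}$ and $\overline L_{-2}$ on the coordinates, including the
  differentiability that is implicit in it. In the formula for
  $\overline L_{-2} u_j$ with \<open>j = 1\<close> the index \<open>j - 2\<close> is truncated, but its factor is 0.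
\<close>

definition variational_formulas :: bool where
  "variational_formulas \<longleftrightarrow>
    (\<forall>\<gamma>\<in>loops0.
      (let \<rho> = complex_of_real (rho0 \<gamma>); u = ucoeff \<gamma> in
        (\<forall>m\<in>{1,2}. loop_differentiable m (\<lambda>\<gamma>. of_real (rho0 \<gamma>)) \<gamma> \<and>
                     (\<forall>k\<ge>1. loop_differentiable m (\<lambda>\<gamma>. ucoeff \<gamma> k) \<gamma>)) \<and>
        Lbar 1 (\<lambda>\<gamma>. of_real (rho0 \<gamma>)) \<gamma> = - cnj (u 1) \<and>
        Lbar 2 (\<lambda>\<gamma>. of_real (rho0 \<gamma>)) \<gamma> = cnj (P2 u) / (2 * \<rho>) \<and>
        (\<forall>k\<ge>1.
          Lbar 1 (\<lambda>\<gamma>. ucoeff \<gamma> k) \<gamma> = of_nat k * (u (k - 1) - cnj (u 1) * u k) / \<rho> \<and>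
          Lbar 1 (\<lambda>\<gamma>. cnj (ucoeff \<gamma> k)) \<gamma>
            = of_nat (k + 2) * (cnj (u 1) * cnj (u k) - cnj (u (k + 1))) / \<rho> \<and>
          Lbar 2 (\<lambda>\<gamma>. ucoeff \<gamma> k) \<gamma>
            = (of_nat k / 2 * u k * cnj (P2 u) - 3 * of_nat k * u (k - 1) * cnj (u 1)
                + of_nat (k - 1) * u (k - 2)) / \<rho>^2 \<and>
          Lbar 2 (\<lambda>\<gamma>. cnj (ucoeff \<gamma> k)) \<gamma>
            = cnj (pinv u (k + 2) - of_nat (k + 3) * u (k + 2)
                + 3 * of_nat (k + 2) * u 1 * u (k + 1)
                - of_nat (k + 2) / 2 * P2 u * u k) / \<rho>^2)))"

text \<open>
  The polynomials in $u, \bar u$ which, as functions of the loop, are of the form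
  $\overline L_{-m}(\rho_0^m f)$ with $f \in \mathbb{C}[u]^{(n)} \otimes \mathbb{C}[\bar u]^{(n-m)}$
  and \<open>m = 1, 2\<close>.
\<close>

definition L_images :: "bipoly set" where
  "L_images = {g. \<exists>m\<in>{1,2}. \<exists>n\<ge>m. \<exists>f\<in>bigraded n (n - m). \<forall>\<gamma>\<in>loops0.
     Lbar m (\<lambda>\<gamma>. of_real (rho0 \<gamma>) ^ m * bieval f (ucoeff \<gamma>)) \<gamma> = bieval g (ucoeff \<gamma>)}"

text \<open>
  The identities $E(\overline L_{-m}(\rho_0^m f)) = 0$, read as a system of linear equations for
  an array \<open>M\<close> of prospective moments.
\<close>

definition satisfies_L_identities :: "(mono \<Rightarrow> mono \<Rightarrow> complex) \<Rightarrow> bool" where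
  "satisfies_L_identities M \<longleftrightarrow> (\<forall>g\<in>L_images. expect M g = 0)"

end

theory Submission
  imports Defs
begin

text \<open>
  Put \<open>raise1 = - R1\<close> and \<open>raise2 f = - R2 f - 3 R1 (u\<^sub>1 f)\<close>; these operators have the same images in sum
  as \<open>R1\<close> and \<open>R2\<close>. They are the Virasoro operators $L_{-1}, L_{-2}$ of the
  representation on polynomials in the Taylor coefficients of a univalent function, with central
  charge 26 and conformal weight 1; the lowering operators $L_1, L_2$ annihilate only constants.
  Up to the images, every polynomial of weight $n$ is a multiple of $u_1^n$ (leading terms in the
  polynomial degree are governed by a density module of the Witt algebra). To reach $u_1^n$, compare
  with the Fock space of two free bosons, which has the same central charge and weight and a positive
  definite invariant form. The commutation relations determine all vacuum coefficients of words in
  the Virasoro operators, so the orthogonal projection of the $n$-th power of an isotropic vector,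
  on which $L_1, L_2$ act as on $u_1^n$, to the span of the words applied to the vacuum gives a word
  expression of $u_1^n$. Surjectivity makes the adjoint kernels trivial and determines the moments by
  induction on the weight; moments of unequal weights vanish by rotation invariance.
\<close>

section \<open>Derivations of the polynomial ring\<close>

text \<open>Write \<open>f (x) g\<close> for f(u) g(conj u). The identity for L_{-2} at
  \<open>f (x) g\<close> plus the one for L_{-1} at \<open>f (x) 3 u_1 g\<close> gives E(lower_m f
  (x) g) = E(f (x) raise_m g) for m = 1, 2. This is the origin of the correction 3 R1 (u_1 f): the
  moment pairing would make raising adjoint to lowering. The obstacle is u_1^n. A Witt operator of
  weight k sends u_i to a multiple of u_(i+k), whose index exceeds 1, so no leading term is a power
  of u_1, and the polynomial module comes with no positive form that could decide the matter.
  Whether some combination of words equals u_1^n is a linear system whose matrix consists of vacuum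
  coefficients of lowering words on raising words. That matrix depends only on central charge and
  weight. On the Fock space it is the Gram matrix of a positive form, so the system is solvable as
  soon as its right-hand side comes from pairing with a vector. One boson with background charge
  cannot supply the vector, since L_2 does not kill the powers of its first mode; the second boson
  adds the direction that makes an isotropic combination possible.\<close>

abbreviation cst :: "complex \<Rightarrow> upoly" where "cst c \<equiv> Poly_Mapping.single 0 c"
abbreviation coef :: "upoly \<Rightarrow> mono \<Rightarrow> complex" where "coef \<equiv> Poly_Mapping.lookup"
abbreviation expo :: "mono \<Rightarrow> nat \<Rightarrow> nat" where "expo \<equiv> Poly_Mapping.lookup"
abbreviation mons :: "upoly \<Rightarrow> mono set" where "mons \<equiv> Poly_Mapping.keys"
abbreviation uexp :: "nat \<Rightarrow> mono" where "uexp i \<equiv> Poly_Mapping.single i 1"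

lemma poly_mapping_decomp:
  fixes f :: "'a \<Rightarrow>\<^sub>0 'b::comm_monoid_add"
  shows "f = (\<Sum>p\<in>Poly_Mapping.keys f. Poly_Mapping.single p (Poly_Mapping.lookup f p))"
proof (rule poly_mapping_eqI)
  fix q
  show "Poly_Mapping.lookup f q = Poly_Mapping.lookup (\<Sum>p\<in>Poly_Mapping.keys f. Poly_Mapping.single p (Poly_Mapping.lookup f p)) q"
    by (cases "q \<in> Poly_Mapping.keys f")
       (auto simp: lookup_sum lookup_single when_def in_keys_iff)
qed

lemma poly_mapping_single_induct [case_names single add]:
  fixes f :: "'a \<Rightarrow>\<^sub>0 'b::comm_monoid_add"
  assumes s: "\<And>p c. P (Poly_Mapping.single p c)" and a: "\<And>f g. P f \<Longrightarrow> P g \<Longrightarrow> P (f + g)"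
  shows "P f"
proof -
  have z: "P 0" using s[of undefined 0] by simp
  have "P (\<Sum>p\<in>A. Poly_Mapping.single p (Poly_Mapping.lookup f p))" if "finite A" for A
    using that by (induction A) (auto simp: z s a)
  then show ?thesis using poly_mapping_decomp[of f] by (metis finite_keys)
qed

section \<open>Weight and total degree of monomials\<close>

definition tdeg :: "mono \<Rightarrow> nat" where
  "tdeg p = (\<Sum>i\<in>Poly_Mapping.keys p. expo p i)"

lemma sum_keys_superset:
  assumes "finite A" "Poly_Mapping.keys p \<subseteq> A" "\<And>i. h i 0 = (0::'b::comm_monoid_add)"
  shows "(\<Sum>i\<in>Poly_Mapping.keys p. h i (Poly_Mapping.lookup p i)) = (\<Sum>i\<in>A. h i (Poly_Mapping.lookup p i))"
  using assms by (intro sum.mono_neutral_left) (auto simp: in_keys_iff)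

lemma weight_add: "weight (p + q) = weight p + weight q"
proof -
  let ?A = "Poly_Mapping.keys p \<union> Poly_Mapping.keys q"
  have "Poly_Mapping.keys (p + q) \<subseteq> ?A" by (rule keys_add)
  then show ?thesis
    unfolding weight_def
    by (subst (1 2 3) sum_keys_superset[where A = "?A" and h = "\<lambda>i n. Suc i * n"])
       (auto simp: lookup_add sum.distrib algebra_simps)
qed

lemma tdeg_add: "tdeg (p + q) = tdeg p + tdeg q"
proof -
  let ?A = "Poly_Mapping.keys p \<union> Poly_Mapping.keys q"
  have "Poly_Mapping.keys (p + q) \<subseteq> ?A" by (rule keys_add)
  then show ?thesis
    unfolding tdeg_def
    by (subst (1 2 3) sum_keys_superset[where A = "?A" and h = "\<lambda>i n. n"])
       (auto simp: lookup_add sum.distrib algebra_simps)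
qed

lemma weight_zero [simp]: "weight 0 = 0" by (simp add: weight_def)
lemma tdeg_zero [simp]: "tdeg 0 = 0" by (simp add: tdeg_def)
lemma weight_single [simp]: "weight (Poly_Mapping.single i n) = Suc i * n"
  by (simp add: weight_def)
lemma tdeg_single [simp]: "tdeg (Poly_Mapping.single i n) = n"
  by (simp add: tdeg_def)

text \<open>Bounds the polynomial degree inside \<open>graded n\<close> by n, so that the later
  descent on total degree has a starting point.\<close>

lemma tdeg_le_weight: "tdeg p \<le> weight p"
  unfolding tdeg_def weight_def by (rule sum_mono) simp

lemma mono_split:
  assumes "expo p i \<noteq> 0"
  shows "p = (p - uexp i) + uexp i"
  using assms by (intro poly_mapping_eqI) (auto simp: lookup_add lookup_minus lookup_single when_def)

lemma tdeg_eq_0_iff: "tdeg p = 0 \<longleftrightarrow> p = 0"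
  by (auto simp: tdeg_def in_keys_iff intro!: poly_mapping_eqI)

lemma weight_eq_0_iff: "weight p = 0 \<longleftrightarrow> p = 0"
  by (metis tdeg_eq_0_iff tdeg_le_weight le_zero_eq weight_zero)

lemma expo_le_weight: "expo p i \<noteq> 0 \<Longrightarrow> Suc i \<le> weight p"
  using weight_add[of "p - uexp i" "uexp i"] mono_split[of p i] by simp

lemma mono_induct [case_names zero add]:
  assumes z: "P 0" and a: "\<And>p i. P p \<Longrightarrow> P (p + uexp i)"
  shows "P (p::mono)"
proof (induction "tdeg p" arbitrary: p rule: less_induct)
  case less
  show ?case
  proof (cases "p = 0")
    case False
    then obtain i where i: "expo p i \<noteq> 0" by (metis lookup_zero poly_mapping_eqI)
    have "tdeg p = tdeg (p - uexp i) + 1" by (subst mono_split[OF i], simp only: tdeg_add) simp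
    then have "P (p - uexp i)" using less by simp
    then show ?thesis using a mono_split[OF i] by metis
  qed (simp add: z)
qed

lemma U_0 [simp]: "U 0 = 1" by (simp add: U_def)
lemma U_Suc: "U (Suc i) = Poly_Mapping.single (uexp i) 1" by (simp add: U_def)

lemma U_mult_single: "U (Suc i) * Poly_Mapping.single p c = Poly_Mapping.single (p + uexp i) c"
  by (simp add: U_Suc mult_single add.commute)

lemma upoly_induct [case_names const add var]:
  assumes c: "\<And>c. P (cst c)" and a: "\<And>f g. P f \<Longrightarrow> P g \<Longrightarrow> P (f + g)"
    and v: "\<And>i f. P f \<Longrightarrow> P (U (Suc i) * f)"
  shows "P f"
proof (induction f rule: poly_mapping_single_induct)
  case (single p c)
  show ?case
  proof (induction p rule: mono_induct)
    case (add p i)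
    then show ?case using v[of "Poly_Mapping.single p c" i] by (simp add: U_mult_single)
  qed (rule c)
qed (rule a)

text \<open>Truncated subtraction of exponents in \<open>pd\<close> does no harm: it truncates only
  where \<open>expo p i\<close> is 0, and that exponent is the factor in front.\<close>

lemma coef_pd: "coef (pd (Suc i) f) q = of_nat (Suc (expo q i)) * coef f (q + uexp i)"
proof -
  have "coef (pd (Suc i) f) q =
      (\<Sum>p\<in>mons f. (of_nat (expo p i) * coef f p when p - uexp i = q))"
    by (simp add: pd_def lookup_sum lookup_single)
  also have "\<dots> = (\<Sum>p\<in>mons f. if p = q + uexp i then of_nat (expo p i) * coef f p else 0)"
  proof (rule sum.cong[OF refl])
    fix p
    show "(of_nat (expo p i) * coef f p when p - uexp i = q)
       = (if p = q + uexp i then of_nat (expo p i) * coef f p else 0)"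
    proof (cases "expo p i = 0")
      case False
      then have "p - uexp i = q \<longleftrightarrow> p = q + uexp i" using mono_split[OF False] by auto
      then show ?thesis by (simp add: when_def)
    qed (auto simp: when_def)
  qed
  also have "\<dots> = of_nat (Suc (expo q i)) * coef f (q + uexp i)"
    by (simp add: lookup_add in_keys_iff)
  finally show ?thesis .
qed

lemma pd_single: "pd (Suc i) (Poly_Mapping.single p c) = Poly_Mapping.single (p - uexp i) (of_nat (expo p i) * c)"
  by (cases "c = 0") (simp_all add: pd_def)

definition derivation :: "(upoly \<Rightarrow> upoly) \<Rightarrow> bool" where
  "derivation D \<longleftrightarrow> (\<forall>f g. D (f + g) = D f + D g) \<and> (\<forall>f g. D (f * g) = D f * g + f * D g)
     \<and> (\<forall>c. D (cst c) = 0)"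

lemma derivation_add: "derivation D \<Longrightarrow> D (f + g) = D f + D g"
  and derivation_mult: "derivation D \<Longrightarrow> D (f * g) = D f * g + f * D g"
  and derivation_cst: "derivation D \<Longrightarrow> D (cst c) = 0"
  by (auto simp: derivation_def)

lemma derivation_0: "derivation D \<Longrightarrow> D 0 = 0"
  using derivation_cst[of D 0] by simp

lemma derivation_1: "derivation D \<Longrightarrow> D 1 = 0"
  using derivation_cst[of D 1] by simp

lemma derivation_of_nat: "derivation D \<Longrightarrow> D (of_nat n) = 0"
  using derivation_cst[of D "of_nat n"] by simp

lemma derivation_numeral: "derivation D \<Longrightarrow> D (numeral n) = 0"
  using derivation_cst[of D "numeral n"] by simp

lemma derivation_uminus: "derivation D \<Longrightarrow> D (- f) = - D f"
  using derivation_add[of D f "- f"] derivation_0[of D] by (simp add: eq_neg_iff_add_eq_0 add.commute)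

lemma derivation_diff: "derivation D \<Longrightarrow> D (f - g) = D f - D g"
  using derivation_add[of D f "- g"] derivation_uminus[of D g] by simp

lemma derivation_cst_mult: "derivation D \<Longrightarrow> D (cst c * f) = cst c * D f"
  by (simp add: derivation_mult derivation_cst)

lemma derivation_sum: "derivation D \<Longrightarrow> D (\<Sum>i\<in>A. h i) = (\<Sum>i\<in>A. D (h i))"
  by (induction A rule: infinite_finite_induct) (auto simp: derivation_0 derivation_add)

lemma derivation_square: "derivation D \<Longrightarrow> D (f ^ 2) = 2 * f * D f"
  by (simp add: power2_eq_square derivation_mult algebra_simps)

lemma derivation_power: "derivation D \<Longrightarrow> D (f ^ n) = of_nat n * f ^ (n - 1) * D f"
proof (induction n)
  case (Suc n)
  have "D (f ^ Suc n) = D f * f ^ n + f * (of_nat n * f ^ (n - 1) * D f)"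
    using Suc by (simp add: derivation_mult)
  also have "\<dots> = of_nat (Suc n) * f ^ (Suc n - 1) * D f"
    by (cases n) (simp_all add: algebra_simps)
  finally show ?case .
qed (simp add: derivation_1)

lemmas derivation_simps = derivation_add derivation_mult derivation_cst derivation_0 derivation_1
  derivation_of_nat derivation_numeral derivation_uminus derivation_diff derivation_square
  derivation_power

text \<open>The tool behind the commutation relations: a commutator of derivations is a derivation,
  so a relation between such operators has to be checked on the variables only.\<close>

lemma derivation_eqI:
  assumes "derivation D" "derivation E" "\<And>k. 1 \<le> k \<Longrightarrow> D (U k) = E (U k)"
  shows "D f = E f"
  by (induction f rule: upoly_induct) (use assms in \<open>auto simp: derivation_simps\<close>)

lemma derivation_commutator:
  assumes "derivation D" "derivation E"
  shows "derivation (\<lambda>f. D (E f) - E (D f))"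
  using assms unfolding derivation_def by (auto simp: derivation_0[OF assms(1)] derivation_0[OF assms(2)] algebra_simps)

lemma derivation_plus: "derivation D \<Longrightarrow> derivation E \<Longrightarrow> derivation (\<lambda>f. D f + E f)"
  unfolding derivation_def by (auto simp: algebra_simps)

lemma derivation_scale: "derivation D \<Longrightarrow> derivation (\<lambda>f. h * D f)"
  unfolding derivation_def by (auto simp: algebra_simps)

lemma derivation_zero: "derivation (\<lambda>f. 0)"
  by (simp add: derivation_def)

lemma derivation_setsum: "(\<And>i. i \<in> A \<Longrightarrow> derivation (D i)) \<Longrightarrow> derivation (\<lambda>f. \<Sum>i\<in>A. D i f)"
  by (induction A rule: infinite_finite_induct) (auto intro: derivation_plus derivation_zero)

lemma pd_cst: "pd (Suc i) (cst c) = 0"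
  by (simp add: pd_single)

lemma pd_add: "pd (Suc i) (f + g) = pd (Suc i) f + pd (Suc i) g"
  by (rule poly_mapping_eqI) (simp add: coef_pd lookup_add algebra_simps)

lemma pd_U_mult: "pd (Suc i) (U (Suc j) * f) = (if i = j then f else 0) + U (Suc j) * pd (Suc i) f"
proof (induction f rule: poly_mapping_single_induct)
  case (single p c)
  show ?case
  proof (cases "expo p i = 0")
    case True
    then show ?thesis by (auto simp: U_mult_single pd_single lookup_add lookup_single when_def)
  next
    case False
    have "p + uexp j - uexp i = p - uexp i + uexp j"
      using False by (intro poly_mapping_eqI) (auto simp: lookup_add lookup_minus lookup_single when_def)
    then show ?thesis using mono_split[OF False]
      by (auto simp: U_mult_single pd_single lookup_add lookup_single when_def single_add[symmetric] algebra_simps)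
  qed
qed (auto simp: pd_add algebra_simps)

lemma pd_U: "pd (Suc i) (U k) = (if k = Suc i then 1 else 0)"
proof (cases k)
  case 0
  then show ?thesis using pd_cst[of i 1] by simp
next
  case (Suc j)
  then show ?thesis using pd_U_mult[of i j 1] pd_cst[of i 1] by auto
qed

lemma pd_derivation: "derivation (pd (Suc i))"
proof -
  have c: "pd (Suc i) (cst c * g) = cst c * pd (Suc i) g" for c g
    by (induction g rule: poly_mapping_single_induct) (auto simp: pd_add pd_single mult_single algebra_simps)
  have "pd (Suc i) (f * g) = pd (Suc i) f * g + f * pd (Suc i) g" for f g
  proof (induction f rule: upoly_induct)
    case (var j f)
    show ?case
      by (simp only: mult.assoc pd_U_mult var) (simp add: algebra_simps)
  next
    case (add f h)
    then show ?case by (simp only: pd_add distrib_right) (simp add: algebra_simps)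
  qed (simp only: c pd_cst, simp)
  then show ?thesis by (auto simp: derivation_def pd_add pd_cst)
qed

lemma pd_derivation': "1 \<le> k \<Longrightarrow> derivation (pd k)"
  using pd_derivation[of "k - 1"] by simp

lemma pd_eventually_0: "\<exists>N. \<forall>k\<ge>N. 1 \<le> k \<longrightarrow> pd k f = 0"
proof (induction f rule: upoly_induct)
  case (const c)
  show ?case by (metis One_nat_def Suc_le_D pd_cst)
next
  case (add f g)
  then obtain N M where "\<forall>k\<ge>N. 1 \<le> k \<longrightarrow> pd k f = 0" "\<forall>k\<ge>M. 1 \<le> k \<longrightarrow> pd k g = 0" by blast
  then have "\<forall>k\<ge>max N M. 1 \<le> k \<longrightarrow> pd k (f + g) = 0"
    by (auto simp: derivation_add[OF pd_derivation'])
  then show ?case by blast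
next
  case (var i f)
  then obtain N where N: "\<forall>k\<ge>N. 1 \<le> k \<longrightarrow> pd k f = 0" by blast
  have "pd k (U (Suc i) * f) = 0" if "k \<ge> max N (i + 2)" "1 \<le> k" for k
    using that N pd_U_mult[of "k - 1" i f] by auto
  then show ?case by blast
qed

definition der :: "(nat \<Rightarrow> upoly) \<Rightarrow> upoly \<Rightarrow> upoly" where
  "der A f = (\<Sum>k | 1 \<le> k \<and> pd k f \<noteq> 0. A k * pd k f)"

text \<open>The index set in \<open>der\<close> depends on the polynomial, so not even additivity is
  immediate. A common range 1..M for all arguments involved turns \<open>der A\<close> into a fixed
  finite sum of derivations.\<close>

lemma der_finite: "\<exists>N. \<forall>M\<ge>N. \<forall>A. der A f = (\<Sum>k=1..M. A k * pd k f)"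
proof -
  obtain N where N: "\<forall>k\<ge>N. 1 \<le> k \<longrightarrow> pd k f = 0" using pd_eventually_0 by blast
  have "der A f = (\<Sum>k=1..M. A k * pd k f)" if "M \<ge> N" for A M
    unfolding der_def
  proof (rule sum.mono_neutral_left)
    show "{k. 1 \<le> k \<and> pd k f \<noteq> 0} \<subseteq> {1..M}"
      using N that by (auto intro: ccontr)
  qed auto
  then show ?thesis by blast
qed

lemma der_finite2: "\<exists>N. \<forall>M\<ge>N. \<forall>A. der A f = (\<Sum>k=1..M. A k * pd k f) \<and> der A g = (\<Sum>k=1..M. A k * pd k g)"
proof -
  obtain N where "\<forall>M\<ge>N. \<forall>A. der A f = (\<Sum>k=1..M. A k * pd k f)" using der_finite by blast
  moreover obtain N' where "\<forall>M\<ge>N'. \<forall>A. der A g = (\<Sum>k=1..M. A k * pd k g)" using der_finite by blast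
  ultimately show ?thesis by (intro exI[of _ "max N N'"]) auto
qed

lemma sum_pd_derivation: "derivation (\<lambda>f. \<Sum>k=1..(M::nat). A k * pd k f)"
  by (intro derivation_setsum derivation_scale pd_derivation') auto

lemma der_derivation [simp]: "derivation (der A)"
  unfolding derivation_def
proof (intro conjI allI)
  fix f g
  obtain N where N: "\<forall>M\<ge>N. \<forall>A. der A f = (\<Sum>k=1..M. A k * pd k f) \<and> der A g = (\<Sum>k=1..M. A k * pd k g)"
    using der_finite2 by blast
  obtain N1 where N1: "\<forall>M\<ge>N1. \<forall>A. der A (f + g) = (\<Sum>k=1..M. A k * pd k (f + g))" using der_finite by blast
  obtain N2 where N2: "\<forall>M\<ge>N2. \<forall>A. der A (f * g) = (\<Sum>k=1..M. A k * pd k (f * g))" using der_finite by blast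
  let ?M = "max N (max N1 N2)"
  show "der A (f + g) = der A f + der A g"
    using N[rule_format, of ?M A] N1[rule_format, of ?M A] derivation_add[OF sum_pd_derivation[of A ?M]] by simp
  show "der A (f * g) = der A f * g + f * der A g"
    using N[rule_format, of ?M A] N2[rule_format, of ?M A] derivation_mult[OF sum_pd_derivation[of A ?M]] by simp
next
  fix c
  have "1 \<le> k \<Longrightarrow> pd k (cst c) = 0" for k using pd_cst[of "k - 1" c] by simp
  then show "der A (cst c) = 0" by (simp add: der_def)
qed

lemma der_U: "der A (U k) = (if k = 0 then 0 else A k)"
proof (cases k)
  case 0
  then show ?thesis by (simp add: derivation_1)
next
  case (Suc i)
  have "pd j (U k) = (if j = k then 1 else 0)" if "1 \<le> j" for j
    using that pd_U[of "j - 1" k] by auto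
  then have "{j. 1 \<le> j \<and> pd j (U k) \<noteq> 0} = {k}" using Suc by (auto split: if_splits)
  then show ?thesis using Suc pd_U[of i k] by (simp add: der_def)
qed

lemma der_U_pos: "1 \<le> k \<Longrightarrow> der A (U k) = A k" by (simp add: der_U)

lemma der_add_coeff: "der (\<lambda>k. A k + B k) f = der A f + der B f"
  by (rule derivation_eqI) (auto simp: der_U intro: derivation_plus)

lemma der_scale_coeff: "der (\<lambda>k. h * A k) f = h * der A f"
  by (rule derivation_eqI) (auto simp: der_U intro: derivation_scale)

lemma der_diff_coeff: "der (\<lambda>k. A k - B k) f = der A f - der B f"
  using der_add_coeff[of A "\<lambda>k. (-1) * B k" f] der_scale_coeff[of "-1" B f] by simp

section \<open>The grading\<close>

lemma graded_0 [simp]: "0 \<in> graded n" by (simp add: graded_def)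
lemma graded_cst [simp]: "cst c \<in> graded 0" by (simp add: graded_def)
lemma graded_1 [simp]: "1 \<in> graded 0" using graded_cst[of 1] by simp
lemma graded_of_nat [simp]: "of_nat n \<in> graded 0" using graded_cst[of "of_nat n"] by simp
lemma graded_numeral [simp]: "numeral n \<in> graded 0" using graded_cst[of "numeral n"] by simp
lemma graded_add: "f \<in> graded n \<Longrightarrow> g \<in> graded n \<Longrightarrow> f + g \<in> graded n"
  using keys_add[of f g] by (auto simp: graded_def)
lemma graded_uminus: "f \<in> graded n \<Longrightarrow> - f \<in> graded n"
  by (auto simp: graded_def in_keys_iff)
lemma graded_diff: "f \<in> graded n \<Longrightarrow> g \<in> graded n \<Longrightarrow> f - g \<in> graded n"
  using graded_add[of f n "- g"] graded_uminus[of g n] by simp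
lemma graded_sum: "(\<And>i. i \<in> A \<Longrightarrow> h i \<in> graded n) \<Longrightarrow> sum h A \<in> graded n"
  by (induction A rule: infinite_finite_induct) (auto intro: graded_add)
lemma graded_mult: "f \<in> graded m \<Longrightarrow> g \<in> graded n \<Longrightarrow> f * g \<in> graded (m + n)"
  using keys_mult[of f g] by (fastforce simp: graded_def weight_add)
lemma graded_mult': "f \<in> graded m \<Longrightarrow> g \<in> graded n \<Longrightarrow> k = m + n \<Longrightarrow> f * g \<in> graded k"
  using graded_mult by blast
lemma graded_cst_mult: "f \<in> graded n \<Longrightarrow> cst c * f \<in> graded n"
  using graded_mult[of "cst c" 0 f n] by simp
lemma graded_U [simp]: "U k \<in> graded k"
  by (cases k) (simp_all add: U_Suc graded_def)
lemma graded_power: "f \<in> graded m \<Longrightarrow> f ^ n \<in> graded (n * m)"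
  by (induction n) (auto intro: graded_mult)
lemma graded_single: "weight p = n \<Longrightarrow> Poly_Mapping.single p c \<in> graded n"
  by (simp add: graded_def)

lemma graded_0_cst: "f \<in> graded 0 \<Longrightarrow> f = cst (coef f 0)"
  by (rule poly_mapping_eqI) (auto simp: graded_def lookup_single when_def weight_eq_0_iff in_keys_iff)

lemma graded_coef_0: "f \<in> graded n \<Longrightarrow> 0 < n \<Longrightarrow> coef f 0 = 0"
  by (force simp: graded_def in_keys_iff)

lemma graded_pd:
  assumes "f \<in> graded n" "pd k f \<noteq> 0" "1 \<le> k"
  shows "k \<le> n \<and> pd k f \<in> graded (n - k)"
proof -
  obtain i where k: "k = Suc i" using assms(3) by (cases k) auto
  have w: "k \<le> n \<and> weight q = n - k" if "q \<in> mons (pd k f)" for q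
  proof -
    from that have "q + uexp i \<in> mons f" by (auto simp: in_keys_iff k coef_pd)
    then have "weight (q + uexp i) = n" using assms(1) by (auto simp: graded_def)
    then show ?thesis by (simp add: weight_add k)
  qed
  obtain q where "q \<in> mons (pd k f)" using assms(2) by (metis keys_eq_empty ex_in_conv)
  then show ?thesis using w by (auto simp: graded_def)
qed

text \<open>The degree condition is written as a sum because subtraction truncates; the alternative
  \<open>A k = 0\<close> absorbs small k, such as k = 1 in \<open>lower2\<close>, where
  \<open>U (k - 2)\<close> has the wrong degree.\<close>

lemma graded_der:
  assumes f: "f \<in> graded n" and A: "\<And>k. 1 \<le> k \<Longrightarrow> k \<le> n \<Longrightarrow> A k = 0 \<or> (\<exists>d. A k \<in> graded d \<and> d + (n - k) = m)"
  shows "der A f \<in> graded m"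
  unfolding der_def
proof (rule graded_sum)
  fix k assume k: "k \<in> {k. 1 \<le> k \<and> pd k f \<noteq> 0}"
  then have kn: "k \<le> n" "pd k f \<in> graded (n - k)" using graded_pd[OF f] by auto
  consider "A k = 0" | d where "A k \<in> graded d" "d + (n - k) = m" using A[of k] k kn by auto
  then show "A k * pd k f \<in> graded m"
    using graded_mult[of "A k" _ "pd k f" "n - k"] kn by cases auto
qed

text \<open>Euler's identity for the grading in which u_k has weight k; it makes L_0 act by
  scalars.\<close>

lemma der_euler:
  assumes "f \<in> graded n"
  shows "der (\<lambda>k. of_nat k * U k) f = of_nat n * f"
proof -
  have "der (\<lambda>k. of_nat k * U k) (Poly_Mapping.single p c) = of_nat (weight p) * Poly_Mapping.single p c" for p c
  proof (induction p rule: mono_induct)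
    case (add p i)
    show ?case
      unfolding U_mult_single[symmetric] derivation_mult[OF der_derivation] add
      by (simp add: der_U weight_add algebra_simps)
  qed (simp add: derivation_cst)
  then have "der (\<lambda>k. of_nat k * U k) f = (\<Sum>p\<in>mons f. of_nat (weight p) * Poly_Mapping.single p (coef f p))"
    by (subst (1) poly_mapping_decomp[of f]) (simp add: derivation_sum)
  also have "\<dots> = (\<Sum>p\<in>mons f. of_nat n * Poly_Mapping.single p (coef f p))"
    using assms by (intro sum.cong) (auto simp: graded_def)
  also have "\<dots> = of_nat n * f"
    by (simp add: sum_distrib_left[symmetric] poly_mapping_decomp[symmetric])
  finally show ?thesis .
qed

section \<open>Virasoro operators on polynomials in the Taylor coefficients\<close>

lemma der_U_all: "A 0 = 0 \<Longrightarrow> der A (U k) = A k"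
  by (simp add: der_U)

lemma pinv_0_gen: "s 0 = 1 \<Longrightarrow> pinv s 0 = 1"
  using arg_cong[OF pinv_inverse[of s], of "\<lambda>f. fps_nth f 0"] by simp

lemma pinv_rec_gen:
  assumes "s 0 = 1" "0 < k"
  shows "pinv s k = - (\<Sum>i<k. s (k - i) * pinv s i)"
proof -
  have "(\<Sum>i=0..k. s i * pinv s (k - i)) = 0"
    using arg_cong[OF pinv_inverse[of s, OF assms(1)], of "\<lambda>f. fps_nth f k"] assms(2) by (simp add: fps_mult_nth)
  also have "(\<Sum>i=0..k. s i * pinv s (k - i)) = (\<Sum>i=0..k. s (k - i) * pinv s i)"
    by (rule sum.reindex_bij_witness[of _ "\<lambda>i. k - i" "\<lambda>i. k - i"]) auto
  also have "\<dots> = (\<Sum>i<k. s (k - i) * pinv s i) + pinv s k"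
    using assms(1) by (simp add: atLeast0AtMost lessThan_Suc_atMost[symmetric])
  finally show ?thesis by (simp add: eq_neg_iff_add_eq_0 add.commute)
qed

lemma pinv_U: "Abs_fps U * Abs_fps (pinv U) = (1 :: upoly fps)"
  by (rule pinv_inverse) simp

lemmas pinv_0 [simp] = pinv_0_gen[of U, OF U_0] and pinv_rec = pinv_rec_gen[of U, OF U_0]

lemma pinv_1: "pinv U (Suc 0) = - U (Suc 0)"
  by (simp add: pinv_rec)

lemma pinv_2: "pinv U 2 = U 1 ^ 2 - U 2"
  unfolding numeral_2_eq_2 using pinv_rec[of "Suc (Suc 0)"]
  by (simp add: lessThan_Suc pinv_1)

lemma graded_pinv: "pinv U k \<in> graded k"
proof (induction k rule: less_induct)
  case (less k)
  show ?case
  proof (cases "k = 0")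
    case False
    then show ?thesis
      using less by (auto simp: pinv_rec intro!: graded_uminus graded_sum graded_mult'[OF graded_U])
  qed simp
qed

definition fps_der :: "(upoly \<Rightarrow> upoly) \<Rightarrow> upoly fps \<Rightarrow> upoly fps" where
  "fps_der D s = Abs_fps (\<lambda>k. D (fps_nth s k))"

lemma fps_der_mult: "derivation D \<Longrightarrow> fps_der D (s * t) = fps_der D s * t + s * fps_der D t"
  by (rule fps_ext)
     (simp add: fps_der_def fps_mult_nth derivation_sum derivation_mult sum.distrib)

text \<open>With S(z) the sum of the u_k z^k and P = 1/S, the hypothesis says D S = z^m (z S)'. From
  D P = - P^2 D S and P' = - P^2 S' follows D P = z^m (z P' - P), and the claim is its coefficient
  at z^(k+m).\<close>

lemma derivation_pinv:
  assumes D: "derivation D" and DU: "\<And>k. D (U k) = (if k < m then 0 else of_nat (k - m + 1) * U (k - m))"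
  shows "D (pinv U (k + m)) = of_nat k * pinv U k - pinv U k"
proof -
  let ?S = "Abs_fps U" and ?P = "Abs_fps (pinv U)"
  have SP: "?S * ?P = 1" by (rule pinv_U)
  have S: "fps_der D ?S = fps_X ^ m * (?S + fps_X * fps_deriv ?S)"
  proof (rule fps_ext)
    fix k show "fps_nth (fps_der D ?S) k = fps_nth (fps_X ^ m * (?S + fps_X * fps_deriv ?S)) k"
      unfolding fps_X_power_mult_nth
      by (cases "k - m") (auto simp: fps_der_def DU algebra_simps)
  qed
  have "fps_der D (1 :: upoly fps) = 0"
    by (rule fps_ext) (simp add: fps_der_def derivation_0[OF D] derivation_1[OF D])
  then have "fps_der D ?S * ?P + ?S * fps_der D ?P = 0"
    using fps_der_mult[OF D, of ?S ?P] SP by simp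
  then have "?P * (fps_der D ?S * ?P + ?S * fps_der D ?P) = 0" by simp
  then have 1: "fps_der D ?P = - (?P * ?P * fps_der D ?S)"
    using SP by (simp add: algebra_simps add_eq_0_iff)
  have "fps_deriv (?S * ?P) = 0" using SP by simp
  then have "?P * (fps_deriv ?S * ?P + ?S * fps_deriv ?P) = 0" by (simp add: add.commute)
  then have 2: "fps_deriv ?P = - (?P * ?P * fps_deriv ?S)"
    using SP by (simp add: algebra_simps add_eq_0_iff)
  have "fps_der D ?P = - (fps_X ^ m * (?P * (?S * ?P))) - fps_X ^ m * (fps_X * (?P * ?P * fps_deriv ?S))"
    unfolding 1 S by (simp add: algebra_simps)
  also have "\<dots> = fps_X ^ m * (fps_X * fps_deriv ?P - ?P)"
    unfolding 2 SP by (simp add: algebra_simps)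
  finally have "fps_nth (fps_der D ?P) (k + m) = fps_nth (fps_X ^ m * (fps_X * fps_deriv ?P - ?P)) (k + m)"
    by simp
  then have "D (pinv U (k + m)) = fps_nth (fps_X * fps_deriv ?P - ?P) k"
    by (simp only: fps_X_power_mult_nth) (simp add: fps_der_def)
  then show ?thesis
    by (cases k) (auto simp: algebra_simps)
qed

text \<open>These are Kirillov's vector fields on univalent functions: phi(z) = z (1 + sum u_k z^k)
  varies by z^(m+1) phi'(z), so that u_k moves by (k - m + 1) u_(k-m).\<close>

definition lower1 :: "upoly \<Rightarrow> upoly" where
  "lower1 = der (\<lambda>k. of_nat k * U (k - 1))"

definition lower2 :: "upoly \<Rightarrow> upoly" where
  "lower2 = der (\<lambda>k. of_nat (k - 1) * U (k - 2))"

definition euler :: "upoly \<Rightarrow> upoly" where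
  "euler = der (\<lambda>k. of_nat k * U k)"

text \<open>The fields L_{-1} and L_{-2} of the same family. The inverse series in the second one
  comes from 1/phi; the multiples of \<open>U k\<close> make the coefficient at k = 0 vanish, so
  that u_0 = 1 is preserved.\<close>

definition raise1_der :: "upoly \<Rightarrow> upoly" where
  "raise1_der = der (\<lambda>k. of_nat (k + 2) * U (k + 1) - 2 * U 1 * U k)"

definition raise2_der :: "upoly \<Rightarrow> upoly" where
  "raise2_der = der (\<lambda>k. of_nat (k + 3) * U (k + 2) - pinv U (k + 2) - (4 * U 2 - U 1 ^ 2) * U k)"

text \<open>The added terms here and in \<open>raise2\<close> are the Neretin polynomials 2 h u_1
  and h (4 u_2 - u_1^2) + (c/2) (u_2 - u_1^2) for weight h = 1 and central charge c = 26.\<close>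

definition raise1 :: "upoly \<Rightarrow> upoly" where
  "raise1 f = raise1_der f + 2 * U 1 * f"

definition raise2 :: "upoly \<Rightarrow> upoly" where
  "raise2 f = raise2_der f + (17 * U 2 - 14 * U 1 ^ 2) * f"

lemma derivations [simp]: "derivation lower1" "derivation lower2" "derivation euler"
  "derivation raise1_der" "derivation raise2_der"
  by (simp_all add: lower1_def lower2_def euler_def raise1_der_def raise2_der_def)

lemma lower1_U: "lower1 (U k) = of_nat k * U (k - 1)"
  by (simp add: lower1_def der_U_all)
lemma lower2_U: "lower2 (U k) = of_nat (k - 1) * U (k - 2)"
  by (simp add: lower2_def der_U_all)
lemma euler_U: "euler (U k) = of_nat k * U k"
  by (simp add: euler_def der_U_all)
lemma raise1_der_U: "raise1_der (U k) = of_nat (k + 2) * U (k + 1) - 2 * U 1 * U k"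
  by (simp add: raise1_der_def der_U_all)
lemma raise2_der_U: "raise2_der (U k) = of_nat (k + 3) * U (k + 2) - pinv U (k + 2) - (4 * U 2 - U 1 ^ 2) * U k"
proof -
  \<comment> \<open>At k = 0 the coefficient is 3 u_2 - (u_1^2 - u_2) - (4 u_2 - u_1^2) = 0, so the
    formula includes \<open>U 0 = 1\<close>.\<close>
  have "pinv U (Suc (Suc 0)) = U (Suc 0) * U (Suc 0) - U (Suc (Suc 0))"
    using pinv_2 by (simp only: numeral_2_eq_2) simp
  then show ?thesis
    unfolding raise2_der_def by (subst der_U_all) (simp_all add: numeral_2_eq_2)
qed

lemma lower1_pinv: "lower1 (pinv U (k + 2)) = of_nat k * pinv U (k + 1)"
proof -
  have "lower1 (pinv U ((k + 1) + 1)) = of_nat (k + 1) * pinv U (k + 1) - pinv U (k + 1)"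
    by (rule derivation_pinv) (auto simp: lower1_U algebra_simps)
  then show ?thesis by (simp add: algebra_simps)
qed

lemma lower2_pinv: "lower2 (pinv U (k + 2)) = of_nat k * pinv U k - pinv U k"
proof (rule derivation_pinv)
  fix k show "lower2 (U k) = (if k < 2 then 0 else of_nat (k - 2 + 1) * U (k - 2))"
  proof (cases "k < 2")
    case False
    then obtain j where "k = j + 2" by (metis add.commute le_Suc_ex not_less)
    then show ?thesis by (simp add: lower2_U)
  qed (auto simp: lower2_U)
qed simp

text \<open>This and the next three are the Witt relations [L_m, L_n] = (m - n) L_(m+n) with
  \<open>euler\<close> as L_0. Weight and central charge enter only through the zeroth-order terms
  of \<open>raise1\<close> and \<open>raise2\<close>.\<close>

lemma comm_lower1_raise1_der: "lower1 (raise1_der f) - raise1_der (lower1 f) = 2 * euler f"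
proof (rule derivation_eqI[where D = "\<lambda>f. lower1 (raise1_der f) - raise1_der (lower1 f)"])
  fix k :: nat assume "1 \<le> k"
  then obtain j where "k = Suc j" by (cases k) auto
  then show "lower1 (raise1_der (U k)) - raise1_der (lower1 (U k)) = 2 * euler (U k)"
    by (simp add: lower1_U raise1_der_U euler_U derivation_simps del: One_nat_def) (simp add: algebra_simps)
qed (auto intro: derivation_commutator derivation_scale)

lemma comm_lower2_raise1_der: "lower2 (raise1_der f) - raise1_der (lower2 f) = 3 * lower1 f"
proof (rule derivation_eqI[where D = "\<lambda>f. lower2 (raise1_der f) - raise1_der (lower2 f)"])
  fix k :: nat assume "1 \<le> k"
  then consider "k = 1" | j where "k = j + 2" by (metis add.commute add_2_eq_Suc' le_Suc_ex nat_arith.rule0 not0_implies_Suc One_nat_def plus_1_eq_Suc)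
  then show "lower2 (raise1_der (U k)) - raise1_der (lower2 (U k)) = 3 * lower1 (U k)"
    by cases (simp_all add: lower1_U lower2_U raise1_der_U derivation_simps algebra_simps)
qed (auto intro: derivation_commutator derivation_scale)

lemma comm_lower1_raise2_der: "lower1 (raise2_der f) - raise2_der (lower1 f) = 3 * raise1_der f"
proof (rule derivation_eqI[where D = "\<lambda>f. lower1 (raise2_der f) - raise2_der (lower1 f)"])
  fix k :: nat assume "1 \<le> k"
  then obtain j where "k = Suc j" by (cases k) auto
  then show "lower1 (raise2_der (U k)) - raise2_der (lower1 (U k)) = 3 * raise1_der (U k)"
    using lower1_pinv[of "Suc j"]
    by (simp add: lower1_U raise1_der_U raise2_der_U derivation_simps) (simp add: algebra_simps power2_eq_square)
qed (auto intro: derivation_commutator derivation_scale)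

lemma comm_lower2_raise2_der: "lower2 (raise2_der f) - raise2_der (lower2 f) = 4 * euler f"
proof (rule derivation_eqI[where D = "\<lambda>f. lower2 (raise2_der f) - raise2_der (lower2 f)"])
  fix k :: nat assume "1 \<le> k"
  then consider "k = 1" | j where "k = j + 2" by (metis add.commute add_2_eq_Suc' le_Suc_ex nat_arith.rule0 not0_implies_Suc One_nat_def plus_1_eq_Suc)
  then show "lower2 (raise2_der (U k)) - raise2_der (lower2 (U k)) = 4 * euler (U k)"
    using lower2_pinv[of k]
    by cases (simp_all add: lower2_U raise2_der_U euler_U derivation_simps algebra_simps power2_eq_square)
qed (auto intro: derivation_commutator derivation_scale)

lemma graded_lower1: "f \<in> graded n \<Longrightarrow> lower1 f \<in> graded (n - 1)"
  unfolding lower1_def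
proof (rule graded_der)
  fix k :: nat assume "1 \<le> k" "k \<le> n"
  then show "of_nat k * U (k - 1) = 0 \<or> (\<exists>d. of_nat k * U (k - 1) \<in> graded d \<and> d + (n - k) = n - 1)"
    using graded_mult[OF graded_of_nat graded_U, of k "k - 1"] by (intro disjI2 exI[of _ "k - 1"]) auto
qed

lemma graded_lower2: "f \<in> graded n \<Longrightarrow> lower2 f \<in> graded (n - 2)"
  unfolding lower2_def
proof (rule graded_der)
  fix k :: nat assume k: "1 \<le> k" "k \<le> n"
  show "of_nat (k - 1) * U (k - 2) = 0 \<or> (\<exists>d. of_nat (k - 1) * U (k - 2) \<in> graded d \<and> d + (n - k) = n - 2)"
  proof (cases "k = 1")
    case False
    then show ?thesis using k graded_mult[OF graded_of_nat graded_U, of "k - 1" "k - 2"]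
      by (intro disjI2 exI[of _ "k - 2"]) auto
  qed simp
qed

lemma graded_raise1_der: "f \<in> graded n \<Longrightarrow> raise1_der f \<in> graded (n + 1)"
  unfolding raise1_der_def
proof (rule graded_der)
  fix k :: nat assume "1 \<le> k" "k \<le> n"
  then show "of_nat (k + 2) * U (k + 1) - 2 * U 1 * U k = 0 \<or> (\<exists>d. of_nat (k + 2) * U (k + 1) - 2 * U 1 * U k \<in> graded d \<and> d + (n - k) = n + 1)"
    by (intro disjI2 exI[of _ "k + 1"] conjI graded_diff)
       (auto intro!: graded_mult'[of "of_nat _" 0] graded_mult'[of _ 0] graded_mult'[of "2 * U 1" 1]
          simp del: of_nat_add of_nat_Suc One_nat_def)
qed

lemma graded_quadratic: "cst a * U 2 + cst b * U 1 ^ 2 \<in> graded 2"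
proof -
  have "U 1 ^ 2 \<in> graded 2" using graded_power[OF graded_U[of 1], of 2] by simp
  then show ?thesis by (intro graded_add graded_cst_mult) auto
qed

lemma graded_raise2_der: "f \<in> graded n \<Longrightarrow> raise2_der f \<in> graded (n + 2)"
  unfolding raise2_der_def
proof (rule graded_der)
  fix k :: nat assume "1 \<le> k" "k \<le> n"
  have q: "4 * U 2 - U 1 ^ 2 \<in> graded 2"
    using graded_quadratic[of 4 "-1"] by (simp add: single_uminus)
  have "of_nat (k + 3) * U (k + 2) \<in> graded (k + 2)"
    using graded_mult[OF graded_of_nat graded_U, of "k + 3" "k + 2"] by simp
  moreover have "(4 * U 2 - U 1 ^ 2) * U k \<in> graded (k + 2)"
    using graded_mult[OF q graded_U, of k] by (simp add: add.commute)
  ultimately show "of_nat (k + 3) * U (k + 2) - pinv U (k + 2) - (4 * U 2 - U 1 ^ 2) * U k = 0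
      \<or> (\<exists>d. of_nat (k + 3) * U (k + 2) - pinv U (k + 2) - (4 * U 2 - U 1 ^ 2) * U k \<in> graded d
      \<and> d + (n - k) = n + 2)"
    using \<open>k \<le> n\<close> by (intro disjI2 exI[of _ "k + 2"] conjI graded_diff graded_pinv) auto
qed

lemma graded_raise1: "f \<in> graded n \<Longrightarrow> raise1 f \<in> graded (n + 1)"
  unfolding raise1_def using graded_mult[OF graded_mult[OF graded_numeral graded_U], of f n _ 1]
  by (auto intro!: graded_add graded_raise1_der[simplified])

lemma graded_raise2: "f \<in> graded n \<Longrightarrow> raise2 f \<in> graded (n + 2)"
  unfolding raise2_def using graded_mult[OF graded_quadratic[of 17 "-14"], of f n] graded_raise2_der
  by (auto intro!: graded_add simp: single_uminus)

lemma R1_raise1: "R1 f = - raise1 f"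
proof -
  have "R1 f = der (\<lambda>k. 2 * U 1 * U k - of_nat (k + 2) * U (k + 1)) f - 2 * U 1 * f"
    by (simp only: R1_def der_def)
  then show ?thesis by (simp only: raise1_def raise1_der_def der_diff_coeff) simp
qed

text \<open>Adding \<open>3 * U 1 * raise1_der\<close> cancels the mixed terms
  \<open>U 1 * U (k + 1)\<close> of \<open>R2\<close> and leaves the field
  \<open>raise2_der\<close>. Differentiating the factor \<open>U 1\<close> contributes 3 (3 u_2 - 2
  u_1^2), which together with 6 u_1^2 and - 2 P_2 gives 17 u_2 - 14 u_1^2.\<close>

lemma raise2_R2: "raise2 f = - R2 f - 3 * R1 (U 1 * f)"
proof -
  let ?B = "\<lambda>j. P2 U * U j - 3 * of_nat (j + 2) * U 1 * U (j + 1) + of_nat (j + 3) * U (j + 2) - pinv U (j + 2)"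
  have R2: "R2 f = 2 * P2 U * f - der ?B f"
    by (simp only: R2_def der_def)
  have "der ?B f + 3 * U 1 * raise1_der f = raise2_der f"
  proof (rule derivation_eqI[where D = "\<lambda>f. der ?B f + 3 * U 1 * raise1_der f"])
    fix k :: nat assume "1 \<le> k"
    then show "der ?B (U k) + 3 * U 1 * raise1_der (U k) = raise2_der (U k)"
      by (simp only: raise1_der_U raise2_der_U der_U_pos) (simp add: P2_def algebra_simps power2_eq_square)
  qed (intro derivation_plus derivation_scale der_derivation derivations)+
  then have raise2_der: "raise2_der f = der ?B f + 3 * U 1 * raise1_der f" ..
  show ?thesis
    unfolding R1_raise1 raise2_def raise1_def R2 raise2_der derivation_mult[OF derivations(4)] raise1_der_U
    by (simp add: P2_def algebra_simps power2_eq_square numeral_2_eq_2)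
qed

section \<open>Reduction to powers of the first variable\<close>

definition deg_ge :: "nat \<Rightarrow> upoly set" where
  "deg_ge d = {f. \<forall>p\<in>mons f. d \<le> tdeg p}"

lemma deg_ge_0 [simp]: "0 \<in> deg_ge d" by (simp add: deg_ge_def)
lemma deg_ge_zero [simp]: "f \<in> deg_ge 0" by (simp add: deg_ge_def)
lemma deg_ge_add: "f \<in> deg_ge d \<Longrightarrow> g \<in> deg_ge d \<Longrightarrow> f + g \<in> deg_ge d"
  using keys_add[of f g] by (auto simp: deg_ge_def)
lemma deg_ge_uminus: "f \<in> deg_ge d \<Longrightarrow> - f \<in> deg_ge d"
  by (auto simp: deg_ge_def in_keys_iff)
lemma deg_ge_diff: "f \<in> deg_ge d \<Longrightarrow> g \<in> deg_ge d \<Longrightarrow> f - g \<in> deg_ge d"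
  using deg_ge_add[of f d "- g"] deg_ge_uminus[of g d] by simp
lemma deg_ge_sum: "(\<And>i. i \<in> A \<Longrightarrow> h i \<in> deg_ge d) \<Longrightarrow> sum h A \<in> deg_ge d"
  by (induction A rule: infinite_finite_induct) (auto intro: deg_ge_add)
lemma deg_ge_mult: "f \<in> deg_ge m \<Longrightarrow> g \<in> deg_ge n \<Longrightarrow> f * g \<in> deg_ge (m + n)"
  using keys_mult[of f g] by (fastforce simp: deg_ge_def tdeg_add add_mono)
lemma deg_ge_mult': "f \<in> deg_ge m \<Longrightarrow> g \<in> deg_ge n \<Longrightarrow> d \<le> m + n \<Longrightarrow> f * g \<in> deg_ge d"
  using deg_ge_mult[of f m g n] by (fastforce simp: deg_ge_def)
lemma deg_ge_mult_left: "g \<in> deg_ge d \<Longrightarrow> f * g \<in> deg_ge d"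
  using deg_ge_mult[of f 0 g d] by simp
lemma deg_ge_U: "1 \<le> k \<Longrightarrow> U k \<in> deg_ge 1"
  by (cases k) (simp_all add: U_Suc deg_ge_def)
lemma deg_ge_mono: "f \<in> deg_ge d \<Longrightarrow> e \<le> d \<Longrightarrow> f \<in> deg_ge e"
  by (auto simp: deg_ge_def)

lemma deg_ge_UU: "1 \<le> i \<Longrightarrow> 1 \<le> j \<Longrightarrow> h * U i * U j \<in> deg_ge 2"
  using deg_ge_mult[OF deg_ge_mult_left[OF deg_ge_U[of i], of h] deg_ge_U[of j]] by (simp add: numeral_2_eq_2)

lemma deg_ge_pd:
  assumes "f \<in> deg_ge (Suc d)" "1 \<le> k"
  shows "pd k f \<in> deg_ge d"
proof -
  obtain i where k: "k = Suc i" using assms(2) by (cases k) auto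
  have "d \<le> tdeg q" if "q \<in> mons (pd k f)" for q
  proof -
    from that have "q + uexp i \<in> mons f" by (auto simp: in_keys_iff k coef_pd)
    then have "Suc d \<le> tdeg (q + uexp i)" using assms(1) by (auto simp: deg_ge_def)
    then show ?thesis by (simp add: tdeg_add)
  qed
  then show ?thesis by (simp add: deg_ge_def)
qed

lemma deg_ge_der:
  assumes "f \<in> deg_ge (Suc d)" "\<And>k. 1 \<le> k \<Longrightarrow> A k \<in> deg_ge e"
  shows "der A f \<in> deg_ge (e + d)"
  unfolding der_def using assms by (intro deg_ge_sum deg_ge_mult deg_ge_pd) auto

text \<open>In the recursion for the inverse series every summand with 0 < i < k is a product of two
  factors of positive degree, so the linear part of \<open>pinv U k\<close> is - u_k.\<close>

lemma deg_ge_pinv: "1 \<le> k \<Longrightarrow> pinv U k \<in> deg_ge 1 \<and> pinv U k + U k \<in> deg_ge 2"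
proof (induction k rule: less_induct)
  case (less k)
  have "(\<Sum>i<k. U (k - i) * pinv U i) = U k + (\<Sum>i\<in>{1..<k}. U (k - i) * pinv U i)"
    using less.prems by (simp add: lessThan_atLeast0 sum.atLeast_Suc_lessThan)
  moreover have "(\<Sum>i\<in>{1..<k}. U (k - i) * pinv U i) \<in> deg_ge 2"
    using less.IH by (intro deg_ge_sum deg_ge_mult'[of _ 1 _ 1] deg_ge_U) auto
  ultimately have "pinv U k + U k \<in> deg_ge 2"
    using less.prems by (simp add: pinv_rec deg_ge_uminus)
  moreover from deg_ge_diff[OF deg_ge_mono[OF this, of 1] deg_ge_U[OF less.prems]]
  have "pinv U k \<in> deg_ge 1" by simp
  ultimately show ?case by simp
qed

text \<open>For n < 2 the subtractions truncate and the set is not contained in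
  \<open>graded n\<close>; hence the assumption that n is at least 2 in the lemmas on
  weights.\<close>

definition images :: "nat \<Rightarrow> upoly set" where
  "images n = {raise1 a + raise2 b | a b. a \<in> graded (n - 1) \<and> b \<in> graded (n - 2)}"

lemma raise_add: "raise1 (f + g) = raise1 f + raise1 g" "raise2 (f + g) = raise2 f + raise2 g"
  by (simp_all add: raise1_def raise2_def derivation_add algebra_simps)
lemma raise_cst: "raise1 (cst c * f) = cst c * raise1 f" "raise2 (cst c * f) = cst c * raise2 f"
  unfolding raise1_def raise2_def derivation_cst_mult[OF derivations(4)] derivation_cst_mult[OF derivations(5)]
  by (simp_all add: algebra_simps)
lemma raise_0 [simp]: "raise1 0 = 0" "raise2 0 = 0"
  by (simp_all add: raise1_def raise2_def derivation_0)

lemma images_raise1: "a \<in> graded (n - 1) \<Longrightarrow> raise1 a \<in> images n"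
  unfolding images_def by (force intro: exI[of _ 0])
lemma images_raise2: "b \<in> graded (n - 2) \<Longrightarrow> raise2 b \<in> images n"
  unfolding images_def by (force intro: exI[of _ 0])
lemma images_add: "x \<in> images n \<Longrightarrow> y \<in> images n \<Longrightarrow> x + y \<in> images n"
  unfolding images_def
proof clarsimp
  fix a b a' b'
  assume *: "a \<in> graded (n - Suc 0)" "b \<in> graded (n - 2)" "a' \<in> graded (n - Suc 0)" "b' \<in> graded (n - 2)"
  have "raise1 a + raise2 b + (raise1 a' + raise2 b') = raise1 (a + a') + raise2 (b + b')"
    by (simp add: raise_add)
  with * show "\<exists>a'' b''. raise1 a + raise2 b + (raise1 a' + raise2 b') = raise1 a'' + raise2 b''
      \<and> a'' \<in> graded (n - Suc 0) \<and> b'' \<in> graded (n - 2)"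
    using graded_add by blast
qed
lemma images_cst: "x \<in> images n \<Longrightarrow> cst c * x \<in> images n"
  unfolding images_def
proof clarsimp
  fix a b
  assume *: "a \<in> graded (n - Suc 0)" "b \<in> graded (n - 2)"
  have "cst c * (raise1 a + raise2 b) = raise1 (cst c * a) + raise2 (cst c * b)"
    by (simp add: raise_cst distrib_left)
  with * show "\<exists>a' b'. cst c * (raise1 a + raise2 b) = raise1 a' + raise2 b'
      \<and> a' \<in> graded (n - Suc 0) \<and> b' \<in> graded (n - 2)"
    using graded_cst_mult by blast
qed
lemma images_0 [simp]: "0 \<in> images n"
  using images_raise1[of 0 n] by simp
lemma images_diff: "x \<in> images n \<Longrightarrow> y \<in> images n \<Longrightarrow> x - y \<in> images n"
  using images_add[of x n "cst (-1) * y"] images_cst[of y n "-1"] by (simp add: single_uminus)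
lemma images_graded: "2 \<le> n \<Longrightarrow> images n \<subseteq> graded n"
proof
  fix x assume n: "2 \<le> n" and "x \<in> images n"
  then obtain a b where "x = raise1 a + raise2 b" "a \<in> graded (n - 1)" "b \<in> graded (n - 2)"
    by (auto simp: images_def)
  moreover obtain m where "n = m + 2" using n by (metis add.commute le_Suc_ex)
  ultimately show "x \<in> graded n"
    using graded_raise1[of a "n - 1"] graded_raise2[of b "n - 2"] by (auto intro!: graded_add)
qed

text \<open>
  Iterated commutators of \<open>raise1\<close> and \<open>raise2\<close> raise the weight by any \<open>k\<close>; up to
  terms of higher polynomial degree they act on the variables like the density module
  \<open>u\<^sub>i \<mapsto> (i + 2k) u\<^sub>i\<^sub>+\<^sub>k\<close> of the Witt algebra.
\<close>

lemma witt_operators: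
  assumes "1 \<le> k"
  shows "\<exists>A m c. c \<noteq> 0
    \<and> (\<forall>n f. 2 \<le> n \<longrightarrow> k \<le> n \<longrightarrow> f \<in> graded (n - k) \<longrightarrow> der A f + m * f \<in> images n)
    \<and> (\<forall>n f. f \<in> graded n \<longrightarrow> der A f + m * f \<in> graded (n + k))
    \<and> (\<forall>i\<ge>1. A i - cst c * of_nat (i + 2 * k) * U (i + k) \<in> deg_ge 2) \<and> m \<in> deg_ge 1"
proof (cases "k = 1")
  case True
  let ?A = "\<lambda>k. of_nat (k + 2) * U (k + 1) - 2 * U 1 * U k"
  have eq: "der ?A f + 2 * U 1 * f = raise1 f" for f
    by (simp only: raise1_def raise1_der_def)
  have "?A i - cst 1 * of_nat (i + 2 * k) * U (i + k) \<in> deg_ge 2" if "1 \<le> i" for i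
  proof -
    have "?A i - cst 1 * of_nat (i + 2 * k) * U (i + k) = - (2 * U 1 * U i)"
      using True by simp
    then show ?thesis
      using deg_ge_uminus[OF deg_ge_UU[OF order_refl that, of 2]] by simp
  qed
  then show ?thesis
    using True by (intro exI[of _ ?A] exI[of _ "2 * U 1"] exI[of _ 1])
      (simp only: eq, auto intro: images_raise1 graded_raise1[simplified] deg_ge_mult_left deg_ge_U[of 1, simplified])
next
  case False
  then have "2 \<le> k" using assms by simp
  then show ?thesis
  proof (induction k rule: dec_induct)
    case base
    let ?A = "\<lambda>k. of_nat (k + 3) * U (k + 2) - pinv U (k + 2) - (4 * U 2 - U 1 ^ 2) * U k"
    let ?m = "17 * U 2 - 14 * U 1 ^ 2"
    have eq: "der ?A f + ?m * f = raise2 f" for f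
      by (simp only: raise2_def raise2_der_def)
    have q: "a * U 2 - b * U 1 ^ 2 \<in> deg_ge 1" for a b
      unfolding power2_eq_square by (intro deg_ge_diff deg_ge_mult_left deg_ge_U) auto
    have "?A i - cst 1 * of_nat (i + 2 * 2) * U (i + 2) \<in> deg_ge 2" if "1 \<le> i" for i
    proof -
      \<comment> \<open>The linear part of \<open>- pinv U (i + 2)\<close> adds one more u_(i+2) to
        the coefficient i + 3, which yields the density-module factor i + 4.\<close>
      have eqn: "?A i - cst 1 * of_nat (i + 2 * 2) * U (i + 2)
          = - (pinv U (i + 2) + U (i + 2)) - (4 * U 2 - 1 * U 1 ^ 2) * U i"
        by (simp add: algebra_simps)
      show ?thesis
        unfolding eqn using deg_ge_diff[OF deg_ge_uminus[OF conjunct2[OF deg_ge_pinv[of "i + 2"]]]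
            deg_ge_mult[OF q[of 4 1] deg_ge_U[OF that], unfolded one_add_one]] by simp
    qed
    moreover have "?m \<in> deg_ge 1" by (rule q)
    ultimately show ?case
      by (intro exI[of _ ?A] exI[of _ ?m] exI[of _ 1])
         (simp only: eq, auto intro: images_raise2 graded_raise2[simplified])
  next
    case (step k)
    obtain A m c where c: "c \<noteq> 0"
      and im: "\<And>n f. 2 \<le> n \<Longrightarrow> k \<le> n \<Longrightarrow> f \<in> graded (n - k) \<Longrightarrow> der A f + m * f \<in> images n"
      and gr: "\<And>n f. f \<in> graded n \<Longrightarrow> der A f + m * f \<in> graded (n + k)"
      and A: "\<And>i. 1 \<le> i \<Longrightarrow> A i - cst c * of_nat (i + 2 * k) * U (i + k) \<in> deg_ge 2"
      and m: "m \<in> deg_ge 1" using step.IH by blast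
    \<comment> \<open>The commutator of \<open>raise1\<close> with \<open>der A\<close> plus
      multiplication by m is again of first order: \<open>?B\<close> is the bracket of the two
      fields, \<open>?m\<close> collects the derivatives of the two zeroth-order terms.\<close>
    let ?B = "\<lambda>i. raise1_der (A i) - der A (raise1_der (U i))"
    let ?m = "raise1_der m - der A (2 * U 1)"
    \<comment> \<open>(i + 2k)(i + k + 2) - (i + 2)(i + 1 + 2k) = (k - 1)(i + 2k + 2). The factor k
      - 1 vanishes at k = 1, which is why the recursion has to start from \<open>raise2\<close> at k
      = 2.\<close>
    let ?c = "c * of_nat (k - 1)"
    have comm: "raise1_der (der A f) - der A (raise1_der f) = der ?B f" for f
      by (rule derivation_eqI[where D = "\<lambda>f. raise1_der (der A f) - der A (raise1_der f)"])
         (auto intro: derivation_commutator simp: der_U)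
    have eq: "der ?B f + ?m * f = raise1 (der A f + m * f) - (der A (raise1 f) + m * raise1 f)" for f
      unfolding comm[symmetric] raise1_def
      by (simp add: derivation_simps algebra_simps)
    have A1: "A i \<in> deg_ge 1" if "1 \<le> i" for i
    proof -
      have "cst c * of_nat (i + 2 * k) * U (i + k) \<in> deg_ge 1"
        using that by (intro deg_ge_mult_left deg_ge_U) auto
      from deg_ge_add[OF deg_ge_mono[OF A[OF that], of 1] this] show ?thesis by simp
    qed
    have d1: "1 \<le> i \<Longrightarrow> of_nat (i + 2) * U (i + 1) - 2 * U 1 * U i \<in> deg_ge 1" for i
      by (intro deg_ge_diff deg_ge_mult_left deg_ge_U) auto
    have dj: "raise1_der f \<in> deg_ge (Suc d)" if "f \<in> deg_ge (Suc d)" for f d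
      using deg_ge_der[OF that d1] unfolding raise1_der_def by simp
    have dA: "der A f \<in> deg_ge (Suc d)" if "f \<in> deg_ge (Suc d)" for f d
      using deg_ge_der[OF that A1] by simp
    have B: "?B i - cst ?c * of_nat (i + 2 * Suc k) * U (i + Suc k) \<in> deg_ge 2" if i: "1 \<le> i" for i
    proof -
      let ?r = "\<lambda>i. A i - cst c * of_nat (i + 2 * k) * U (i + k)"
      have "raise1_der (?r i) \<in> deg_ge 2" using dj[of "?r i" 1] A[OF i] by (simp add: numeral_2_eq_2)
      moreover have "of_nat (i + 2) * ?r (i + 1) \<in> deg_ge 2"
        using A[of "i + 1"] by (intro deg_ge_mult_left) simp
      moreover have "der A (2 * U 1 * U i) \<in> deg_ge 2"
      proof -
        have "2 * U 1 * U i \<in> deg_ge (Suc 1)"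
          using deg_ge_UU[OF order_refl i, of 2] by (simp add: numeral_2_eq_2)
        from dA[OF this] show ?thesis by (simp add: numeral_2_eq_2)
      qed
      moreover have "cst c * of_nat (i + 2 * k) * (2 * U 1 * U (i + k)) \<in> deg_ge 2"
        by (rule deg_ge_mult_left, rule deg_ge_UU) (use i in auto)
      ultimately have "raise1_der (?r i) - of_nat (i + 2) * ?r (i + 1) + der A (2 * U 1 * U i)
          - cst c * of_nat (i + 2 * k) * (2 * U 1 * U (i + k)) \<in> deg_ge 2"
        by (intro deg_ge_diff deg_ge_add)
      also have "raise1_der (?r i) - of_nat (i + 2) * ?r (i + 1) + der A (2 * U 1 * U i)
          - cst c * of_nat (i + 2 * k) * (2 * U 1 * U (i + k))
          = ?B i - cst ?c * of_nat (i + 2 * Suc k) * U (i + Suc k)"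
      proof -
        obtain l where k: "k = l + 2" using step.hyps by (metis add.commute le_Suc_ex)
        have cc: "cst (c * x) = cst c * cst x" for x by (simp add: mult_single)
        show ?thesis
          unfolding cc single_of_nat raise1_der_U derivation_diff[OF der_derivation] derivation_mult[OF der_derivation] derivation_diff[OF derivations(4)]
            derivation_mult[OF derivations(4)] derivation_cst[OF derivations(4)]
            derivation_of_nat[OF derivations(4)] derivation_of_nat[OF der_derivation] 
          by (simp add: k der_U derivation_numeral algebra_simps)
      qed
      finally show ?thesis .
    qed
    \<comment> \<open>One product in the commutator has \<open>raise1\<close> outermost, the other
      the operator of weight k, so both lie in the images; the grading clause supplies the weight of
      the inner factor.\<close>
    have im': "der ?B f + ?m * f \<in> images n" if n: "2 \<le> n" "Suc k \<le> n" "f \<in> graded (n - Suc k)" for n f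
    proof -
      have "der A f + m * f \<in> graded (n - 1)" using gr[OF n(3)] n(2) by simp
      moreover have "raise1 f \<in> graded (n - k)" using graded_raise1[OF n(3)] n(2) by (simp add: Suc_diff_Suc)
      ultimately show ?thesis
        unfolding eq using n im by (intro images_diff images_raise1) auto
    qed
    have gr': "der ?B f + ?m * f \<in> graded (n + Suc k)" if "f \<in> graded n" for n f
      unfolding eq using graded_raise1[OF gr[OF that]] gr[OF graded_raise1[OF that]]
      by (auto intro!: graded_diff)
    have m': "?m \<in> deg_ge 1"
      using dj[of m 0] m dA[of "2 * U 1" 0] deg_ge_U[of 1]
      by (auto intro!: deg_ge_diff deg_ge_mult_left)
    have "?c \<noteq> 0" using c step.hyps by simp
    then show ?case using im' gr' B m' by blast
  qed
qed

section \<open>Elimination of all monomials other than the power of u_1\<close>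

definition u1_or_image :: "nat \<Rightarrow> upoly set" where
  "u1_or_image n = {cst c * U 1 ^ n + y | c y. y \<in> images n}"

lemma u1_or_image_add:
  assumes "f \<in> u1_or_image n" "g \<in> u1_or_image n"
  shows "f + g \<in> u1_or_image n"
proof -
  obtain c x d y where *: "f = cst c * U 1 ^ n + x" "g = cst d * U 1 ^ n + y" "x \<in> images n" "y \<in> images n"
    using assms by (auto simp: u1_or_image_def)
  then have "f + g = cst (c + d) * U 1 ^ n + (x + y)" by (simp add: single_add algebra_simps)
  then show ?thesis unfolding u1_or_image_def using images_add[OF *(3,4)] by blast
qed

lemma u1_or_image_cst:
  assumes "f \<in> u1_or_image n"
  shows "cst a * f \<in> u1_or_image n"
proof -
  obtain c x where *: "f = cst c * U 1 ^ n + x" "x \<in> images n"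
    using assms by (auto simp: u1_or_image_def)
  then have "cst a * f = cst (a * c) * U 1 ^ n + cst a * x"
    by (simp only: distrib_left mult.assoc[symmetric] mult_single) simp
  then show ?thesis unfolding u1_or_image_def using images_cst[OF *(2)] by blast
qed

lemma u1_or_image_diff: "f \<in> u1_or_image n \<Longrightarrow> g \<in> u1_or_image n \<Longrightarrow> f - g \<in> u1_or_image n"
  using u1_or_image_add[of f n "cst (-1) * g"] u1_or_image_cst[of g n "-1"] by (simp add: single_uminus)

lemma u1_or_image_0: "0 \<in> u1_or_image n"
  unfolding u1_or_image_def using images_0 by (force intro: exI[of _ 0])

lemma images_u1_or_image: "f \<in> images n \<Longrightarrow> f \<in> u1_or_image n"
  unfolding u1_or_image_def by (force intro: exI[of _ 0])

lemma u1_or_image_monomials: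
  assumes "\<And>p. p \<in> mons f \<Longrightarrow> Poly_Mapping.single p 1 \<in> u1_or_image n"
  shows "f \<in> u1_or_image n"
proof -
  have "(\<Sum>p\<in>X. cst (coef f p) * Poly_Mapping.single p 1) \<in> u1_or_image n" if "finite X" "X \<subseteq> mons f" for X
    using that by (induction X) (auto simp: u1_or_image_0 intro!: u1_or_image_add u1_or_image_cst assms simp del: mult_single)
  from this[OF finite_keys subset_refl] show ?thesis
    by (simp add: mult_single poly_mapping_decomp[symmetric])
qed

lemma U_power: "U 1 ^ a = Poly_Mapping.single (Poly_Mapping.single 0 a) 1"
  by (induction a) (simp_all add: U_Suc mult_single single_add[symmetric])

text \<open>Within total degree d this is a descent on the exponent a of u_1. The monomial u_1^a
  u_(j+1) q arises when the j-th Witt operator acts on u_1^(a+1) q and hits a factor u_1. Hitting q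
  instead leaves a + 1 factors u_1, and the remaining terms have higher degree. The start a = d + 1
  forces the degree above d.\<close>

lemma u1_or_image_step:
  assumes n: "2 \<le> n" and d: "1 \<le> d"
    and IH: "\<And>f. f \<in> graded n \<Longrightarrow> f \<in> deg_ge (Suc d) \<Longrightarrow> f \<in> u1_or_image n"
    and a: "a \<le> Suc d"
  shows "\<forall>p. weight p = n \<longrightarrow> d \<le> tdeg p \<longrightarrow> a \<le> expo p 0 \<longrightarrow> Poly_Mapping.single p 1 \<in> u1_or_image n"
  using a
proof (induction a rule: inc_induct)
  case base
  have *: "expo p 0 \<le> tdeg p" for p :: mono
    unfolding tdeg_def by (cases "expo p 0 = 0") (auto intro!: member_le_sum simp: in_keys_iff)
  show ?case
  proof (intro allI impI)
    fix p assume "weight p = n" "Suc d \<le> expo p 0"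
    then show "Poly_Mapping.single p 1 \<in> u1_or_image n"
      using *[of p] by (intro IH graded_single) (auto simp: deg_ge_def)
  qed
next
  case (step a)
  show ?case
  proof (intro allI impI)
    fix p assume p: "weight p = n" "d \<le> tdeg p" "a \<le> expo p 0"
    show "Poly_Mapping.single p 1 \<in> u1_or_image n"
    proof (cases "tdeg p = d \<and> expo p 0 = a")
      case False
      then consider "Suc d \<le> tdeg p" | "Suc a \<le> expo p 0" using p by linarith
      then show ?thesis
      proof cases
        case 1
        then show ?thesis using p by (intro IH graded_single) (auto simp: deg_ge_def)
      next
        case 2
        then show ?thesis using step.IH p(1,2) by simp
      qed
    next
      case pd: True
      show ?thesis
      proof (cases "\<exists>j\<ge>1. expo p j \<noteq> 0")
        case False
        then have z: "expo p k = 0" if "1 \<le> k" for k using that by blast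
        have p1: "p = Poly_Mapping.single 0 a"
        proof (rule poly_mapping_eqI)
          fix k show "expo p k = expo (Poly_Mapping.single 0 a) k"
            using pd z[of k] by (cases "k = 0") (simp_all add: lookup_single)
        qed
        then have "n = a" using p(1) by simp
        then have "Poly_Mapping.single p 1 = cst 1 * U 1 ^ n + 0"
          by (simp add: p1 U_power[simplified])
        then show ?thesis unfolding u1_or_image_def using images_0 by blast
      next
        case True
        then obtain j where j: "1 \<le> j" "expo p j \<noteq> 0" by blast
        define q where "q = p - uexp j - Poly_Mapping.single 0 a"
        have pq: "p = q + Poly_Mapping.single 0 a + uexp j"
          unfolding q_def using j p(3)
          by (intro poly_mapping_eqI) (auto simp: lookup_add lookup_minus lookup_single when_def)
        define g where "g = Poly_Mapping.single q (1::complex)"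
        have wq: "weight q + a + Suc j = n" "tdeg q + a + 1 = d"
          using p(1) pd unfolding pq by (simp_all add: weight_add tdeg_add)
        have pg: "Poly_Mapping.single p 1 = U (Suc j) * (U 1 ^ a * g)"
          unfolding g_def U_power pq by (simp add: mult_single U_Suc add_ac)
        obtain A m c where c: "c \<noteq> 0"
          and im: "\<And>n f. 2 \<le> n \<Longrightarrow> j \<le> n \<Longrightarrow> f \<in> graded (n - j) \<Longrightarrow> der A f + m * f \<in> images n"
          and gr: "\<And>n f. f \<in> graded n \<Longrightarrow> der A f + m * f \<in> graded (n + j)"
          and A: "\<And>i. 1 \<le> i \<Longrightarrow> A i - cst c * of_nat (i + 2 * j) * U (i + j) \<in> deg_ge 2"
          and m: "m \<in> deg_ge 1"
          using witt_operators[OF j(1)] by blast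
        let ?B = "\<lambda>i. cst c * of_nat (i + 2 * j) * U (i + j)"
        \<comment> \<open>One factor \<open>U (Suc j)\<close> is traded for \<open>U 1\<close>: same
          total degree, weight lower by j.\<close>
        define h where "h = U 1 ^ Suc a * g"
        have hg: "h \<in> graded (n - j)"
          unfolding h_def g_def
          by (rule graded_mult'[OF graded_power[OF graded_U] graded_single[OF refl]]) (use wq in simp)
        have hd: "h \<in> deg_ge (Suc (d - 1))"
          unfolding h_def g_def U_power using wq by (simp add: mult_single deg_ge_def tdeg_add del: power_Suc)
        have E: "der A h + m * h \<in> images n" using im[OF n _ hg] wq by simp
        have r: "der (\<lambda>i. A i - ?B i) h + m * h \<in> deg_ge (Suc d)"
          using deg_ge_der[OF hd, of "\<lambda>i. A i - ?B i" 2] A deg_ge_mult[OF m hd] d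
          by (intro deg_ge_add) (auto simp: numeral_2_eq_2)
        define v where "v = U 1 ^ Suc a * der ?B g"
        have dB: "der ?B h = of_nat (Suc a) * (cst c * of_nat (Suc (2 * j))) * (U (Suc j) * (U 1 ^ a * g)) + v"
          unfolding h_def v_def derivation_mult[OF der_derivation] derivation_power[OF der_derivation]
          by (simp add: der_U algebra_simps)
        \<comment> \<open>The density-module coefficient i + 2j at i = 1, times \<open>c\<close> and
          the a + 1 factors u_1 that can be hit; it never vanishes.\<close>
        let ?e = "of_nat (Suc a) * c * of_nat (Suc (2 * j))"
        have e: "cst ?e * Poly_Mapping.single p 1 = (der A h + m * h) - (der (\<lambda>i. A i - ?B i) h + m * h) - v"
        proof -
          have "cst ?e = of_nat (Suc a) * (cst c * of_nat (Suc (2 * j)))"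
            by (simp only: single_of_nat[symmetric] mult_single mult.assoc) simp
          then show ?thesis
            unfolding der_diff_coeff pg dB by (simp add: algebra_simps)
        qed
        have gB: "der ?B g \<in> graded (weight q + j)" unfolding g_def
        proof (rule graded_der[of _ "weight q"])
          fix i assume "1 \<le> i" "i \<le> weight q"
          moreover have "?B i \<in> graded (i + j)"
            using graded_mult[OF graded_cst_mult[OF graded_of_nat] graded_U, of c "i + 2 * j" "i + j"]
            by (simp only: add_0)
          ultimately show "?B i = 0 \<or> (\<exists>d. ?B i \<in> graded d \<and> d + (weight q - i) = weight q + j)"
            by (intro disjI2 exI[of _ "i + j"]) auto
        qed (simp add: graded_single)
        have vg: "v \<in> graded n"
          unfolding v_def using graded_mult[OF graded_power[OF graded_U[of 1], of "Suc a"] gB] wq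
          by (simp add: add_ac)
        \<comment> \<open>Differentiation costs one degree and multiplication by \<open>?B\<close>
          restores it, which presupposes a variable in q; for q = 1 the derivative vanishes.\<close>
        have vd: "v \<in> deg_ge d"
        proof (cases "tdeg q")
          case 0
          then have "der ?B g = 0"
            using derivation_1[OF der_derivation] by (simp add: g_def tdeg_eq_0_iff)
          then show ?thesis by (simp add: v_def)
        next
          case (Suc l)
          have "g \<in> deg_ge (Suc l)" using Suc by (simp add: g_def deg_ge_def)
          then have "der ?B g \<in> deg_ge (1 + l)"
            using j by (intro deg_ge_der deg_ge_mult_left deg_ge_U) auto
          moreover have "U 1 ^ Suc a \<in> deg_ge (Suc a)" unfolding U_power by (simp add: deg_ge_def)
          ultimately show ?thesis
            unfolding v_def using wq Suc by (intro deg_ge_mult'[of _ "Suc a" _ "1 + l"]) auto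
        qed
        have "v \<in> u1_or_image n"
        proof (rule u1_or_image_monomials)
          fix r assume r: "r \<in> mons v"
          have "Suc a \<le> expo r 0"
            using r keys_mult[of "U 1 ^ Suc a" "der ?B g"] unfolding v_def U_power
            by (auto simp: lookup_add simp del: power_Suc)
          then show "Poly_Mapping.single r 1 \<in> u1_or_image n"
            using step.IH r vg vd by (auto simp: graded_def deg_ge_def)
        qed
        moreover have "der (\<lambda>i. A i - ?B i) h + m * h \<in> u1_or_image n"
        proof (rule IH[OF _ r])
          have eqn: "der (\<lambda>i. A i - ?B i) h + m * h = (der A h + m * h) - cst ?e * Poly_Mapping.single p 1 - v"
            unfolding e by simp
          have "cst ?e * Poly_Mapping.single p 1 \<in> graded n"
            using p(1) by (intro graded_cst_mult graded_single)
          then show "der (\<lambda>i. A i - ?B i) h + m * h \<in> graded n"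
            unfolding eqn using E images_graded[OF n] vg by (intro graded_diff) blast+
        qed
        ultimately have "(der A h + m * h) - (der (\<lambda>i. A i - ?B i) h + m * h) - v \<in> u1_or_image n"
          using images_u1_or_image[OF E] by (intro u1_or_image_diff)
        from u1_or_image_cst[OF this[folded e], of "inverse ?e"]
        have inv: "Poly_Mapping.single p (inverse ?e * ?e) \<in> u1_or_image n" by (simp only: mult_single mult_1_right add_0)
        have e0: "?e \<noteq> 0" using c by (simp del: of_nat_Suc)
        show ?thesis using inv unfolding left_inverse[OF e0] .
      qed
    qed
  qed
qed

text \<open>Descent on the total degree from n + 1, where no monomial of weight n is left.\<close>

lemma graded_u1_or_image:
  assumes n: "2 \<le> n" and f: "f \<in> graded n"
  shows "f \<in> u1_or_image n"
proof -
  have all: "\<forall>f\<in>graded n. f \<in> deg_ge d \<longrightarrow> f \<in> u1_or_image n" if "d \<le> Suc n" "1 \<le> d" for d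
    using that
  proof (induction d rule: inc_induct)
    case base
    show ?case
    proof (intro ballI impI)
      fix f :: upoly assume "f \<in> graded n" "f \<in> deg_ge (Suc n)"
      then have empty: "p \<notin> mons f" for p
        using tdeg_le_weight[of p] by (fastforce simp: graded_def deg_ge_def)
      show "f \<in> u1_or_image n" by (rule u1_or_image_monomials) (simp add: empty)
    qed
  next
    case (step d)
    have IH: "f \<in> u1_or_image n" if "f \<in> graded n" "f \<in> deg_ge (Suc d)" for f
      using step.IH that by simp
    note step' = u1_or_image_step[OF n step.prems IH, of 0, simplified, rule_format]
    show ?case
    proof (intro ballI impI)
      fix f assume f: "f \<in> graded n" "f \<in> deg_ge d"
      show "f \<in> u1_or_image n"
      proof (rule u1_or_image_monomials)
        fix p assume "p \<in> mons f"
        with f have "weight p = n" "d \<le> tdeg p" by (auto simp: graded_def deg_ge_def)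
        then show "Poly_Mapping.single p 1 \<in> u1_or_image n" by (rule step')
      qed
    qed
  qed
  moreover have "f \<in> deg_ge 1"
    using f n by (auto simp: deg_ge_def graded_def Suc_le_eq tdeg_eq_0_iff intro!: Nat.gr0I)
  ultimately show ?thesis using all[of 1] f by simp
qed

section \<open>Hermitian forms and adjoints\<close>

text \<open>The norms \<open>om\<close> of the monomials are a parameter, so that one theory serves
  both \<open>herm\<close> and the Fock form.\<close>

definition hform :: "(mono \<Rightarrow> nat) \<Rightarrow> upoly \<Rightarrow> upoly \<Rightarrow> complex" where
  "hform om f g = (\<Sum>p\<in>mons f \<inter> mons g. of_nat (om p) * coef f p * cnj (coef g p))"

lemma hform_superset:
  assumes "finite A" "mons f \<subseteq> A"
  shows "hform om f g = (\<Sum>p\<in>A. of_nat (om p) * coef f p * cnj (coef g p))"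
  unfolding hform_def using assms by (intro sum.mono_neutral_left) (auto simp: in_keys_iff)

lemma hform_add_left: "hform om (f + h) g = hform om f g + hform om h g"
proof -
  have "mons (f + h) \<subseteq> mons f \<union> mons h" by (rule keys_add)
  then show ?thesis
    by (simp add: hform_superset[of "mons f \<union> mons h"] lookup_add algebra_simps sum.distrib)
qed

lemma hform_sym: "hform om g f = cnj (hform om f g)"
  by (auto simp: hform_def intro!: sum.cong)

lemma hform_add_right: "hform om f (g + h) = hform om f g + hform om f h"
  by (subst (1 2 3) hform_sym) (simp add: hform_add_left)

lemma hform_single_left: "hform om (Poly_Mapping.single p c) g = of_nat (om p) * c * cnj (coef g p)"
  by (subst hform_superset[of "{p}"]) auto

lemma hform_cst_left: "hform om (cst c * f) g = c * hform om f g"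
  by (induction f rule: poly_mapping_single_induct)
     (auto simp: distrib_left hform_add_left mult_single hform_single_left)

lemma hform_cst_right: "hform om f (cst c * g) = cnj c * hform om f g"
  by (subst (1 2) hform_sym) (simp add: hform_cst_left)

lemma hform_0 [simp]: "hform om 0 g = 0" "hform om f 0 = 0"
  by (simp_all add: hform_def)

lemma hform_uminus_left: "hform om (- f) g = - hform om f g"
  using hform_cst_left[of om "-1" f g] by (simp add: single_uminus)

lemma hform_diff_left: "hform om (f - h) g = hform om f g - hform om h g"
  using hform_add_left[of om f "- h" g] by (simp add: hform_uminus_left)

lemma hform_sum_left: "hform om (\<Sum>i\<in>A. h i) g = (\<Sum>i\<in>A. hform om (h i) g)"
  by (induction A rule: infinite_finite_induct) (auto simp: hform_add_left)

lemma hform_sum_right: "hform om g (\<Sum>i\<in>A. h i) = (\<Sum>i\<in>A. hform om g (h i))"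
  by (induction A rule: infinite_finite_induct) (auto simp: hform_add_right)

lemma hform_pos_def:
  assumes "\<And>p. om p > 0" "hform om f f = 0"
  shows "f = 0"
proof -
  have "hform om f f = of_real (\<Sum>p\<in>mons f. real (om p) * (cmod (coef f p))\<^sup>2)"
    unfolding hform_def of_real_sum Int_absorb
    by (rule sum.cong[OF refl]) (simp add: complex_norm_square mult.assoc del: of_real_power)
  then have "(\<Sum>p\<in>mons f. real (om p) * (cmod (coef f p))\<^sup>2) = 0"
    using assms(2) of_real_eq_0_iff by metis
  then have "\<forall>p\<in>mons f. real (om p) * (cmod (coef f p))\<^sup>2 = 0"
    by (subst (asm) sum_nonneg_eq_0_iff) auto
  then have "coef f p = 0" for p
    using assms(1)[of p] by (cases "p \<in> mons f") (auto simp: in_keys_iff)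
  then show ?thesis by (intro poly_mapping_eqI) simp
qed

section \<open>Two free bosons\<close>

text \<open>
  On the Fock space, realized on the same polynomial ring, \<open>U (2n - 1)\<close> and \<open>U (2n)\<close> are the
  \<open>n\<close>-th creation operators of the two bosons. The first boson carries a background charge, which
  gives central charge 25 + 1 and conformal weight 1, with a positive definite invariant form.
\<close>

definition mode :: "nat \<Rightarrow> nat" where "mode k = (k + 1) div 2"

lemma mode_simps [simp]: "mode 0 = 0" "mode (Suc 0) = 1" "mode (Suc (Suc k)) = Suc (mode k)" "mode 2 = 1" "mode 3 = 2"
  "mode 4 = 2"
  by (simp_all add: mode_def)

text \<open>For creation operators with [a_n, a_{-n}] = n the e-th power has squared norm e!
  n^e.\<close>

definition fock_norm :: "mono \<Rightarrow> nat" where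
  "fock_norm p = (\<Prod>i\<in>Poly_Mapping.keys p. fact (expo p i) * mode (Suc i) ^ expo p i)"

lemma fock_norm_pos: "fock_norm p > 0"
  unfolding fock_norm_def by (intro prod_pos) (auto simp: mode_def)

lemma fock_norm_add: "fock_norm (p + uexp i) = fock_norm p * Suc (expo p i) * mode (Suc i)"
proof -
  let ?A = "insert i (Poly_Mapping.keys p)"
  have sup: "fock_norm q = (\<Prod>i\<in>?A. fact (expo q i) * mode (Suc i) ^ expo q i)" if "Poly_Mapping.keys q \<subseteq> ?A" for q
    unfolding fock_norm_def using that by (intro prod.mono_neutral_left) (auto simp: in_keys_iff)
  have 1: "Poly_Mapping.keys (p + uexp i) \<subseteq> ?A" using keys_add[of p "uexp i"] by auto
  have "(\<Prod>j\<in>?A - {i}. fact (expo (p + uexp i) j) * mode (Suc j) ^ expo (p + uexp i) j)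
    = (\<Prod>j\<in>?A - {i}. fact (expo p j) * mode (Suc j) ^ expo p j)"
    by (rule prod.cong) (auto simp: lookup_add lookup_single when_def)
  then show ?thesis
    unfolding sup[OF 1] sup[OF subset_insertI]
    by (subst (1 2) prod.remove[of _ i]) (auto simp: lookup_add algebra_simps)
qed

abbreviation fform :: "upoly \<Rightarrow> upoly \<Rightarrow> complex" where "fform \<equiv> hform fock_norm"

text \<open>Multiplication by a variable is a creation operator; its adjoint is the annihilation
  operator, which is \<open>mode k\<close> times the derivative because of the powers of the mode in
  \<open>fock_norm\<close>.\<close>

lemma fform_U: "1 \<le> k \<Longrightarrow> fform (U k * f) g = fform f (of_nat (mode k) * pd k g)"
proof -
  assume "1 \<le> k"
  then obtain i where k: "k = Suc i" by (cases k) auto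
  show ?thesis
  proof (induction f rule: poly_mapping_single_induct)
    case (single p c)
    have "coef (of_nat (mode k) * pd k g) p = of_nat (mode k) * coef (pd k g) p"
      using lookup_mult[of "of_nat (mode k)" "pd k g" p]
      by (subst single_of_nat[symmetric], subst mult_map_scale_conv_mult[symmetric]) (simp add: map.rep_eq when_def)
    then show ?case
      unfolding k U_mult_single hform_single_left fock_norm_add by (simp add: coef_pd k algebra_simps)
  qed (simp add: distrib_left hform_add_left)
qed

lemma fform_pd: "1 \<le> k \<Longrightarrow> fform (of_nat (mode k) * pd k f) g = fform f (U k * g)"
  using fform_U[of k g f] by (subst (1 2) hform_sym) simp

lemma hform_of_nat: "hform om (of_nat n * f) g = of_nat n * hform om f g"
  "hform om f (of_nat n * g) = of_nat n * hform om f g"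
  using hform_cst_left[of om "of_nat n" f g] hform_cst_right[of om f "of_nat n" g] by simp_all

section \<open>Virasoro operators on the Fock space\<close>

definition shift_up :: "nat \<Rightarrow> upoly \<Rightarrow> upoly" where
  "shift_up s = der (\<lambda>k. of_nat (mode k) * U (k + s))"

definition shift_down :: "nat \<Rightarrow> upoly \<Rightarrow> upoly" where
  "shift_down s = der (\<lambda>k. if k \<le> s then 0 else of_nat (mode k) * U (k - s))"

lemma shift_up_derivation [simp]: "derivation (shift_up s)" "derivation (shift_down s)"
  by (simp_all add: shift_up_def shift_down_def)

lemma shift_up_U: "shift_up s (U k) = of_nat (mode k) * U (k + s)"
  by (simp add: shift_up_def der_U_all)
lemma shift_down_U: "shift_down s (U k) = (if k \<le> s then 0 else of_nat (mode k) * U (k - s))"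
  by (simp add: shift_down_def der_U_all)

text \<open>Each \<open>U (k + s)\<close> and each derivative passes to the other side as its
  adjoint, and reindexing by s gives the downward shift. The cases s = 2 and s = 4 move a mode by 1
  or 2 within the same boson: these are the terms a_{-n-m} a_n of L_{-m}.\<close>

lemma fform_drs: "fform (shift_up s f) g = fform f (shift_down s g)"
proof -
  obtain N where N: "\<forall>M\<ge>N. \<forall>A. der A f = (\<Sum>k=1..M. A k * pd k f) \<and> der A g = (\<Sum>k=1..M. A k * pd k g)"
    using der_finite2 by blast
  have "fform (shift_up s f) g = (\<Sum>k=1..N. fform (U (k + s) * (of_nat (mode k) * pd k f)) g)"
  proof -
    have "shift_up s f = (\<Sum>k=1..N. of_nat (mode k) * U (k + s) * pd k f)"
      unfolding shift_up_def using N by blast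
    then show ?thesis by (simp only: hform_sum_left mult_ac)
  qed
  also have "\<dots> = (\<Sum>k=1..N. fform f (of_nat (mode (k + s)) * U k * pd (k + s) g))"
  proof (rule sum.cong[OF refl])
    fix k assume "k \<in> {1..N}"
    then have "1 \<le> k" "1 \<le> k + s" by auto
    then show "fform (U (k + s) * (of_nat (mode k) * pd k f)) g = fform f (of_nat (mode (k + s)) * U k * pd (k + s) g)"
      by (simp only: fform_U fform_pd) (simp only: mult_ac)
  qed
  also have "\<dots> = fform f (\<Sum>k=1..N. of_nat (mode (k + s)) * U k * pd (k + s) g)"
    by (simp add: hform_sum_right)
  also have "(\<Sum>k=1..N. of_nat (mode (k + s)) * U k * pd (k + s) g)
     = (\<Sum>k\<in>{s+1..N+s}. (if k \<le> s then 0 else of_nat (mode k) * U (k - s)) * pd k g)"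
    by (rule sum.reindex_bij_witness[of _ "\<lambda>k. k - s" "\<lambda>k. k + s"]) auto
  also have "\<dots> = (\<Sum>k=1..N+s. (if k \<le> s then 0 else of_nat (mode k) * U (k - s)) * pd k g)"
    by (rule sum.mono_neutral_left) auto
  also have "\<dots> = shift_down s g"
    unfolding shift_down_def by (rule N[rule_format, OF le_add1, THEN conjunct2, symmetric])
  finally show ?thesis .
qed

text \<open>The linear part of L_n is n \<open>charge\<close> a_n. As the square is - 2, the first
  boson has central charge 1 - 12 \<open>charge\<close>^2 = 25 and vacuum weight -
  \<open>charge\<close>^2 / 2 = 1. As the value is imaginary, the adjoint of the linear part is - n
  \<open>charge\<close> a_{-n}, the linear part of L_{-n}.\<close>

abbreviation charge :: complex where "charge \<equiv> \<i> * complex_of_real (sqrt 2)"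

lemma charge_square: "cst charge * cst charge = - 2"
proof -
  have "charge * charge = - 2"
    by (simp add: algebra_simps) (simp flip: of_real_mult)
  then show ?thesis by (simp add: mult_single single_uminus)
qed

definition fock_lower1 :: "upoly \<Rightarrow> upoly" where
  "fock_lower1 f = cst charge * pd 1 f + shift_down 2 f"
definition fock_raise1 :: "upoly \<Rightarrow> upoly" where
  "fock_raise1 f = - (cst charge * (U 1 * f)) + shift_up 2 f"
text \<open>The 4 is the 2 of 2 \<open>charge\<close> a_2 times that of a_2 = 2 d/du_3; the half
  belongs to the squares of the first modes of the two bosons.\<close>

definition fock_lower2 :: "upoly \<Rightarrow> upoly" where
  "fock_lower2 f = 4 * cst charge * pd 3 f + cst (1/2) * (pd 1 (pd 1 f) + pd 2 (pd 2 f)) + shift_down 4 f"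
definition fock_raise2 :: "upoly \<Rightarrow> upoly" where
  "fock_raise2 f = - (2 * cst charge * (U 3 * f)) + cst (1/2) * (U 1 * (U 1 * f) + U 2 * (U 2 * f)) + shift_up 4 f"
definition fock_euler :: "upoly \<Rightarrow> upoly" where
  "fock_euler = der (\<lambda>k. of_nat (mode k) * U k)"

lemma fock_euler_derivation [simp]: "derivation fock_euler" by (simp add: fock_euler_def)
lemma fock_euler_U: "fock_euler (U k) = of_nat (mode k) * U k"
  by (simp add: fock_euler_def der_U_all)

lemma fform_fr1: "fform (fock_raise1 f) g = fform f (fock_lower1 g)"
  using fform_U[of 1 f g]
  by (simp add: fock_raise1_def fock_lower1_def hform_add_left hform_add_right hform_uminus_left hform_diff_left hform_cst_left
      hform_cst_right fform_drs)

lemma fform_fr2: "fform (fock_raise2 f) g = fform f (fock_lower2 g)"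
proof -
  have 4: "(4::upoly) * cst c = cst (4 * c)" "(2::upoly) * cst c = cst (2 * c)" for c
    using mult_single[of 0 "4::complex" 0 c] mult_single[of 0 "2::complex" 0 c] by simp_all
  have "fform (U 3 * f) g = 2 * fform f (pd 3 g)"
    using fform_U[of 3 f g] hform_of_nat(2)[of fock_norm f 2 "pd 3 g"] by simp
  moreover have "fform (U 1 * (U 1 * f)) g = fform f (pd 1 (pd 1 g))" "fform (U 2 * (U 2 * f)) g = fform f (pd 2 (pd 2 g))"
    using fform_U[of 1] fform_U[of 2] by simp_all
  ultimately show ?thesis
    unfolding fock_raise2_def fock_lower2_def 4
    by (simp add: hform_add_left hform_add_right hform_uminus_left hform_diff_left hform_cst_left
      hform_cst_right fform_drs)
qed

lemma fform_fl1: "fform (fock_lower1 f) g = fform f (fock_raise1 g)"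
  using fform_fr1[of g f] by (subst (1 2) hform_sym) simp
lemma fform_fl2: "fform (fock_lower2 f) g = fform f (fock_raise2 g)"
  using fform_fr2[of g f] by (subst (1 2) hform_sym) simp

text \<open>Up to k = 4 a downward shift by 2 or 4 may run past the first mode; from 5 on the
  formulas are uniform.\<close>

lemma three_step_cases:
  fixes k :: nat
  assumes "1 \<le> k"
  obtains "k = Suc 0" | "k = Suc (Suc 0)" | "k = Suc (Suc (Suc 0))" | "k = Suc (Suc (Suc (Suc 0)))" | j where "k = Suc (Suc (Suc (Suc (Suc j))))"
proof (cases "k \<ge> 5")
  case True
  then show ?thesis using that(5)[of "k - 5"] by simp
next
  case False
  then have "k = 1 \<or> k = 2 \<or> k = 3 \<or> k = 4" using assms by linarith
  then show ?thesis using that by (auto simp: eval_nat_numeral)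
qed

lemma pd_U_pos: "1 \<le> k \<Longrightarrow> pd k (U j) = (if j = k then 1 else 0)"
  using pd_U[of "k - 1" j] by simp

text \<open>In the last relation the fields give n (n + 2) - n (n - 2) = 4 n on mode n, except for n
  = 1, where the second product is absent and 3 is left. The terms \<open>U 1 * pd 1 f\<close> and
  \<open>U 2 * pd 2 f\<close> supply the difference; they arise from the squares of the first
  modes.\<close>

lemma comm_shift_down_up:
  "shift_down 2 (shift_up 2 f) - shift_up 2 (shift_down 2 f) = 2 * fock_euler f"
  "shift_down 4 (shift_up 2 f) - shift_up 2 (shift_down 4 f) = 3 * shift_down 2 f"
  "shift_down 2 (shift_up 4 f) - shift_up 4 (shift_down 2 f) = 3 * shift_up 2 f"
  "shift_down 4 (shift_up 4 f) - shift_up 4 (shift_down 4 f) + U 1 * pd 1 f + U 2 * pd 2 f = 4 * fock_euler f"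
  subgoal
    by (rule derivation_eqI[where D = "\<lambda>f. shift_down 2 (shift_up 2 f) - shift_up 2 (shift_down 2 f)"];
       (intro derivation_commutator derivation_scale shift_up_derivation fock_euler_derivation)?)
       (erule three_step_cases; simp add: shift_down_U shift_up_U fock_euler_U derivation_simps algebra_simps eval_nat_numeral)
  subgoal
    by (rule derivation_eqI[where D = "\<lambda>f. shift_down 4 (shift_up 2 f) - shift_up 2 (shift_down 4 f)"];
       (intro derivation_commutator derivation_scale shift_up_derivation fock_euler_derivation)?)
       (erule three_step_cases; simp add: shift_down_U shift_up_U fock_euler_U derivation_simps algebra_simps eval_nat_numeral)
  subgoal
    by (rule derivation_eqI[where D = "\<lambda>f. shift_down 2 (shift_up 4 f) - shift_up 4 (shift_down 2 f)"];
       (intro derivation_commutator derivation_scale shift_up_derivation fock_euler_derivation)?)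
       (erule three_step_cases; simp add: shift_down_U shift_up_U fock_euler_U derivation_simps algebra_simps eval_nat_numeral)
  subgoal
  proof (rule derivation_eqI[where D = "\<lambda>f. shift_down 4 (shift_up 4 f) - shift_up 4 (shift_down 4 f) + U 1 * pd 1 f + U 2 * pd 2 f"])
    fix k :: nat assume "1 \<le> k"
    then show "shift_down 4 (shift_up 4 (U k)) - shift_up 4 (shift_down 4 (U k)) + U 1 * pd 1 (U k) + U 2 * pd 2 (U k) = 4 * fock_euler (U k)"
      by (rule three_step_cases) (simp_all add: shift_down_U shift_up_U fock_euler_U pd_U_pos derivation_simps algebra_simps eval_nat_numeral)
  qed (auto intro!: derivation_plus derivation_commutator derivation_scale pd_derivation')
  done

lemma comm_pd_shift_up:
  assumes "1 \<le> k"
  shows "pd k (shift_up s f) = shift_up s (pd k f) + (if k \<le> s then 0 else of_nat (mode (k - s)) * pd (k - s) f)"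
proof -
  \<comment> \<open>The added 1 keeps the index of \<open>pd\<close> positive for k at most s, so
    that the right-hand side is a derivation even where its factor is 0.\<close>
  have "pd k (shift_up s f) - shift_up s (pd k f) = (if k \<le> s then 0 else of_nat (mode (k - s))) * pd (k - s + (if k \<le> s then 1 else 0)) f"
  proof (rule derivation_eqI[where D = "\<lambda>f. pd k (shift_up s f) - shift_up s (pd k f)"])
    fix j :: nat assume "1 \<le> j"
    then show "pd k (shift_up s (U j)) - shift_up s (pd k (U j)) =
        (if k \<le> s then 0 else of_nat (mode (k - s))) * pd (k - s + (if k \<le> s then 1 else 0)) (U j)"
      using assms by (auto simp: shift_up_U pd_U_pos derivation_simps pd_derivation')
  qed (use assms in \<open>auto intro!: derivation_commutator derivation_scale pd_derivation' derivation_zero\<close>)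
  then show ?thesis by (auto simp: algebra_simps)
qed

lemma cst_half: "cst (1/2) * (x + x) = x"
proof -
  have "cst (1/2) * (x + x) = cst (1/2) * cst 2 * x" by simp
  also have "cst (1/2) * cst 2 = 1" by (subst mult_single) simp
  finally show ?thesis by simp
qed

lemma comm_fock_lower1_raise1: "fock_lower1 (fock_raise1 f) = fock_raise1 (fock_lower1 f) + 2 * (f + fock_euler f)"
proof -
  have "fock_lower1 (fock_raise1 f) - fock_raise1 (fock_lower1 f) = - (cst charge * cst charge) * f + (shift_down 2 (shift_up 2 f) - shift_up 2 (shift_down 2 f))"
    unfolding fock_lower1_def fock_raise1_def
    by (simp add: derivation_simps pd_derivation' comm_pd_shift_up shift_down_U pd_U_pos) (simp add: algebra_simps)
  then show ?thesis unfolding comm_shift_down_up charge_square by (simp add: algebra_simps)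
qed

lemma comm_fock_lower2_raise1: "fock_lower2 (fock_raise1 f) = fock_raise1 (fock_lower2 f) + 3 * fock_lower1 f"
proof -
  have "fock_lower2 (fock_raise1 f) - fock_raise1 (fock_lower2 f) = 4 * cst charge * pd 1 f - cst charge * (cst (1/2) * (pd 1 f + pd 1 f))
      + (shift_down 4 (shift_up 2 f) - shift_up 2 (shift_down 4 f))"
    unfolding fock_lower2_def fock_raise1_def
    by (simp add: derivation_simps pd_derivation' comm_pd_shift_up shift_down_U pd_U_pos) (simp add: algebra_simps)
  then show ?thesis unfolding comm_shift_down_up cst_half fock_lower1_def by (simp add: algebra_simps)
qed

lemma comm_fock_lower1_raise2: "fock_lower1 (fock_raise2 f) = fock_raise2 (fock_lower1 f) + 3 * fock_raise1 f"
proof -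
  have "fock_lower1 (fock_raise2 f) - fock_raise2 (fock_lower1 f) = cst charge * (cst (1/2) * (U 1 * f + U 1 * f)) - 4 * cst charge * (U 1 * f)
      + (shift_down 2 (shift_up 4 f) - shift_up 4 (shift_down 2 f))"
    unfolding fock_lower1_def fock_raise2_def
    by (simp add: derivation_simps pd_derivation' comm_pd_shift_up shift_down_U pd_U_pos) (simp add: algebra_simps)
  then show ?thesis unfolding comm_shift_down_up cst_half fock_raise1_def by (simp add: algebra_simps)
qed

text \<open>The constant is - 8 \<open>charge\<close>^2 + 1 = 17 = 4 h + c/2: 16 from the background
  charge and 1/2 from the squared first mode of each boson.\<close>

lemma comm_fock_lower2_raise2: "fock_lower2 (fock_raise2 f) = fock_raise2 (fock_lower2 f) + 4 * (f + fock_euler f) + 13 * f"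
proof -
  \<comment> \<open>Terms are grouped as x + x so that \<open>cst_half\<close> can cancel the
    halves, division being available only through \<open>cst\<close>.\<close>
  have "fock_lower2 (fock_raise2 f) - fock_raise2 (fock_lower2 f) = - 8 * (cst charge * cst charge) * f
      + cst (1/2) * (cst (1/2) * ((f + f) + (f + f)))
      + cst (1/2) * (cst (1/2) * ((U 1 * pd 1 f + U 1 * pd 1 f) + (U 1 * pd 1 f + U 1 * pd 1 f)))
      + cst (1/2) * (cst (1/2) * ((U 2 * pd 2 f + U 2 * pd 2 f) + (U 2 * pd 2 f + U 2 * pd 2 f)))
      + (shift_down 4 (shift_up 4 f) - shift_up 4 (shift_down 4 f))"
    unfolding fock_lower2_def fock_raise2_def
    by (simp add: derivation_simps pd_derivation' comm_pd_shift_up shift_down_U pd_U_pos) (simp add: algebra_simps)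
  also have "\<dots> = 16 * f + f + (shift_down 4 (shift_up 4 f) - shift_up 4 (shift_down 4 f) + U 1 * pd 1 f + U 2 * pd 2 f)"
    unfolding cst_half charge_square by (simp add: algebra_simps)
  finally show ?thesis unfolding comm_shift_down_up by (simp add: algebra_simps)
qed

lemma comm_fock_euler: "fock_euler (fock_raise1 f) = fock_raise1 (fock_euler f) + fock_raise1 f" "fock_euler (fock_raise2 f) = fock_raise2 (fock_euler f) + 2 * fock_raise2 f"
proof -
  have 1: "fock_euler (shift_up 2 f) - shift_up 2 (fock_euler f) = shift_up 2 f"
    by (rule derivation_eqI[where D = "\<lambda>f. fock_euler (shift_up 2 f) - shift_up 2 (fock_euler f)"])
       (auto intro!: derivation_commutator simp: shift_up_U fock_euler_U derivation_simps algebra_simps)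
  have 2: "fock_euler (shift_up 4 f) - shift_up 4 (fock_euler f) = 2 * shift_up 4 f"
    by (rule derivation_eqI[where D = "\<lambda>f. fock_euler (shift_up 4 f) - shift_up 4 (fock_euler f)"])
       (auto intro!: derivation_commutator derivation_scale simp: shift_up_U fock_euler_U derivation_simps algebra_simps eval_nat_numeral)
  have "fock_euler (fock_raise1 f) - fock_raise1 (fock_euler f) = - (cst charge * (U 1 * f)) + (fock_euler (shift_up 2 f) - shift_up 2 (fock_euler f))"
    unfolding fock_raise1_def by (simp add: derivation_simps fock_euler_U) (simp add: algebra_simps)
  then show "fock_euler (fock_raise1 f) = fock_raise1 (fock_euler f) + fock_raise1 f" unfolding 1 fock_raise1_def by (simp add: algebra_simps)
  have "fock_euler (fock_raise2 f) - fock_raise2 (fock_euler f) = - (4 * cst charge * (U 3 * f)) + cst (1/2) * (2 * U 1 * (U 1 * f) + 2 * U 2 * (U 2 * f))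
      + (fock_euler (shift_up 4 f) - shift_up 4 (fock_euler f))"
    unfolding fock_raise2_def by (simp add: derivation_simps fock_euler_U) (simp add: algebra_simps)
  then show "fock_euler (fock_raise2 f) = fock_raise2 (fock_euler f) + 2 * fock_raise2 f" unfolding 2 fock_raise2_def by (simp add: algebra_simps)
qed

section \<open>Comparison of the two modules\<close>

text \<open>Evaluates one linear combination of words in the raising operators on both vacua at
  once. It is a relation and not a map, since it is not clear a priori that linear relations between
  words are the same in the two modules.\<close>

inductive corr :: "nat \<Rightarrow> upoly \<Rightarrow> upoly \<Rightarrow> bool" where
  one: "corr 0 1 1"
| zero: "corr n 0 0"
| add: "corr n a s \<Longrightarrow> corr n b t \<Longrightarrow> corr n (a + b) (s + t)"
| scale: "corr n a s \<Longrightarrow> corr n (cst c * a) (cst c * s)"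
| raise1: "corr n a s \<Longrightarrow> corr (Suc n) (raise1 a) (fock_raise1 s)"
| raise2: "corr n a s \<Longrightarrow> corr (Suc (Suc n)) (raise2 a) (fock_raise2 s)"

lemma fock_ops_linear:
  "fock_raise1 (f + g) = fock_raise1 f + fock_raise1 g" "fock_raise2 (f + g) = fock_raise2 f + fock_raise2 g"
  "fock_lower1 (f + g) = fock_lower1 f + fock_lower1 g" "fock_lower2 (f + g) = fock_lower2 f + fock_lower2 g"
  "fock_raise1 (cst c * f) = cst c * fock_raise1 f" "fock_raise2 (cst c * f) = cst c * fock_raise2 f"
  "fock_lower1 (cst c * f) = cst c * fock_lower1 f" "fock_lower2 (cst c * f) = cst c * fock_lower2 f"
proof -
  note cm = derivation_cst_mult[OF shift_up_derivation(1)] derivation_cst_mult[OF shift_up_derivation(2)]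
    derivation_cst_mult[OF pd_derivation']
  show "fock_raise1 (f + g) = fock_raise1 f + fock_raise1 g" "fock_raise2 (f + g) = fock_raise2 f + fock_raise2 g"
    "fock_lower1 (f + g) = fock_lower1 f + fock_lower1 g" "fock_lower2 (f + g) = fock_lower2 f + fock_lower2 g"
    by (simp_all add: fock_raise1_def fock_raise2_def fock_lower1_def fock_lower2_def derivation_add pd_derivation' algebra_simps)
  show "fock_raise1 (cst c * f) = cst c * fock_raise1 f"
    unfolding fock_raise1_def cm by (simp add: algebra_simps)
  show "fock_raise2 (cst c * f) = cst c * fock_raise2 f"
    unfolding fock_raise2_def cm by (simp add: algebra_simps)
  have p: "pd 1 (cst c * g) = cst c * pd 1 g" "pd 2 (cst c * g) = cst c * pd 2 g" "pd 3 (cst c * g) = cst c * pd 3 g" for g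
    by (simp_all add: cm)
  show "fock_lower1 (cst c * f) = cst c * fock_lower1 f"
    unfolding fock_lower1_def cm(1,2) p by (simp add: algebra_simps)
  show "fock_lower2 (cst c * f) = cst c * fock_lower2 f"
    unfolding fock_lower2_def cm(1,2) p by (simp add: algebra_simps)
qed

lemma fock_ops_0 [simp]: "fock_raise1 0 = 0" "fock_raise2 0 = 0" "fock_lower1 0 = 0" "fock_lower2 0 = 0"
  using fock_ops_linear(5-8)[of 0 0] by simp_all

lemma corr_diff: "corr n a s \<Longrightarrow> corr n b t \<Longrightarrow> corr n (a - b) (s - t)"
  using corr.add[of n a s "cst (-1) * b" "cst (-1) * t"] corr.scale[of n b t "-1"] by (simp add: single_uminus)

lemma corr_of_nat: "corr n a s \<Longrightarrow> corr n (of_nat k * a) (of_nat k * s)"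
  using corr.scale[of n a s "of_nat k"] by simp

lemma corr_numeral: "corr n a s \<Longrightarrow> corr n (numeral k * a) (numeral k * s)"
  using corr.scale[of n a s "numeral k"] by simp

lemma corr_graded: "corr n a s \<Longrightarrow> a \<in> graded n"
proof (induction rule: corr.induct)
  case (raise1 n a s)
  then show ?case using graded_raise1 by simp
next
  case (raise2 n a s)
  then show ?case using graded_raise2[of a n] by simp
qed (auto intro: graded_add graded_cst_mult)

lemma corr_feuler: "corr n a s \<Longrightarrow> fock_euler s = of_nat n * s"
proof (induction rule: corr.induct)
  case (raise1 n a s)
  have "fock_raise1 (of_nat n * s) = of_nat n * fock_raise1 s" using fock_ops_linear(5)[of "of_nat n" s] by simp
  then show ?case unfolding comm_fock_euler raise1.IH by (simp add: algebra_simps)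
next
  case (raise2 n a s)
  have "fock_raise2 (of_nat n * s) = of_nat n * fock_raise2 s" using fock_ops_linear(6)[of "of_nat n" s] by simp
  then show ?case unfolding comm_fock_euler raise2.IH by (simp add: algebra_simps)
qed (simp_all add: derivation_simps algebra_simps)

text \<open>The Virasoro relations for h = 1 and c = 26: L_0 is 1 + \<open>euler\<close> and 13 is
  c/2. They match the four relations on the Fock space one by one.\<close>

lemma comm_lower_raise:
  "lower1 (raise1 f) = raise1 (lower1 f) + 2 * (f + euler f)"
  "lower2 (raise1 f) = raise1 (lower2 f) + 3 * lower1 f"
  "lower1 (raise2 f) = raise2 (lower1 f) + 3 * raise1 f"
  "lower2 (raise2 f) = raise2 (lower2 f) + 4 * (f + euler f) + 13 * f"
proof -
  show "lower1 (raise1 f) = raise1 (lower1 f) + 2 * (f + euler f)"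
    using comm_lower1_raise1_der[of f]
    by (simp add: raise1_def derivation_simps lower1_U; simp add: algebra_simps)
  show "lower2 (raise1 f) = raise1 (lower2 f) + 3 * lower1 f"
    using comm_lower2_raise1_der[of f]
    by (simp add: raise1_def derivation_simps lower2_U; simp add: algebra_simps)
  have "lower1 (raise2 f) - raise2 (lower1 f) = 6 * U 1 * f + (lower1 (raise2_der f) - raise2_der (lower1 f))"
    by (simp add: raise2_def derivation_simps lower1_U; simp add: algebra_simps)
  then show "lower1 (raise2 f) = raise2 (lower1 f) + 3 * raise1 f"
    unfolding comm_lower1_raise2_der by (simp add: raise1_def algebra_simps)
  have "lower2 (raise2 f) - raise2 (lower2 f) = 17 * f + (lower2 (raise2_der f) - raise2_der (lower2 f))"
    by (simp add: raise2_def derivation_simps lower2_U; simp add: algebra_simps)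
  then show "lower2 (raise2 f) = raise2 (lower2 f) + 4 * (f + euler f) + 13 * f"
    unfolding comm_lower2_raise2_der by (simp add: algebra_simps)
qed

lemma corr_L0:
  assumes "corr n a s"
  shows "corr n (a + euler a) (s + fock_euler s)"
  using corr.add[OF assms corr_of_nat[OF assms, of n]] der_euler[OF corr_graded[OF assms]] corr_feuler[OF assms]
  by (simp add: euler_def)

text \<open>The induction uses nothing but the commutation relations, which are the same on both sides.\<close>

lemma corr_lowering:
  "corr n a s \<Longrightarrow> (if n = 0 then lower1 a = 0 \<and> fock_lower1 s = 0 else corr (n - 1) (lower1 a) (fock_lower1 s))
    \<and> (if n < 2 then lower2 a = 0 \<and> fock_lower2 s = 0 else corr (n - 2) (lower2 a) (fock_lower2 s))"
proof (induction rule: corr.induct)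
  case one
  show ?case by (simp add: fock_lower1_def fock_lower2_def derivation_1 pd_derivation' derivation_0)
next
  case (zero n)
  then show ?case by (simp add: derivation_0 corr.zero)
next
  case (add n a s b t)
  then show ?case
    by (auto simp: derivation_add fock_ops_linear intro: corr.add split: if_splits)
next
  case (scale n a s c)
  then show ?case
    unfolding derivation_cst_mult[OF derivations(1)] derivation_cst_mult[OF derivations(2)] fock_ops_linear
    by (auto intro: corr.scale)
next
  case (raise1 n a s)
  have "corr n (lower1 (raise1 a)) (fock_lower1 (fock_raise1 s))"
  proof -
    \<comment> \<open>For n = 0 the lowered vectors are 0 and \<open>n - 1\<close> is truncated, so
      this pair comes from \<open>corr.zero\<close>.\<close>
    have h: "corr n (raise1 (lower1 a)) (fock_raise1 (fock_lower1 s))"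
      using raise1.IH corr.raise1[of "n - 1" "lower1 a" "fock_lower1 s"] by (cases n) (auto simp: corr.zero)
    show ?thesis unfolding comm_lower_raise comm_fock_lower1_raise1
      by (rule corr.add[OF h corr_numeral[OF corr_L0[OF raise1.hyps]]])
  qed
  moreover have "if n = 0 then lower2 (raise1 a) = 0 \<and> fock_lower2 (fock_raise1 s) = 0 else corr (n - 1) (lower2 (raise1 a)) (fock_lower2 (fock_raise1 s))"
  proof (cases "n = 0")
    case True
    then show ?thesis using raise1.IH unfolding comm_lower_raise comm_fock_lower2_raise1 by simp
  next
    case False
    have "corr (n - 1) (raise1 (lower2 a)) (fock_raise1 (fock_lower2 s))"
      using raise1.IH corr.raise1[of "n - 2" "lower2 a" "fock_lower2 s"] False
      by (cases "n < 2") (auto simp: corr.zero numeral_2_eq_2 Suc_diff_Suc)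
    then show ?thesis unfolding comm_lower_raise comm_fock_lower2_raise1 using raise1.IH False
      by (simp add: corr.add corr_numeral)
  qed
  ultimately show ?case by (auto split: if_splits)
next
  case (raise2 n a s)
  have "corr (Suc n) (lower1 (raise2 a)) (fock_lower1 (fock_raise2 s))"
  proof -
    have h: "corr (Suc n) (raise2 (lower1 a)) (fock_raise2 (fock_lower1 s))"
      using raise2.IH corr.raise2[of "n - 1" "lower1 a" "fock_lower1 s"] by (cases n) (auto simp: corr.zero)
    show ?thesis unfolding comm_lower_raise comm_fock_lower1_raise2
      by (rule corr.add[OF h corr_numeral[OF corr.raise1[OF raise2.hyps]]])
  qed
  moreover have "corr n (lower2 (raise2 a)) (fock_lower2 (fock_raise2 s))"
  proof -
    have h: "corr n (raise2 (lower2 a)) (fock_raise2 (fock_lower2 s))"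
      using raise2.IH corr.raise2[of "n - 2" "lower2 a" "fock_lower2 s"]
      by (cases "n < 2") (auto simp: corr.zero numeral_2_eq_2 Suc_diff_Suc)
    show ?thesis unfolding comm_lower_raise comm_fock_lower2_raise2
      by (rule corr.add[OF corr.add[OF h corr_numeral[OF corr_L0[OF raise2.hyps]]] corr_numeral[OF raise2.hyps]])
  qed
  ultimately show ?case by simp
qed

lemma corr_coef_0:
  assumes "corr 0 a s"
  shows "coef a 0 = coef s 0"
proof -
  have "n = 0 \<longrightarrow> (\<exists>c. a = cst c \<and> s = cst c)" if "corr n a s" for n a s
    using that
  proof (induction rule: corr.induct)
    case one
    show ?case by (intro impI exI[of _ 1]) simp
  next
    case (zero n)
    show ?case by (intro impI exI[of _ 0]) simp
  next
    case (add n a s b t)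
    then show ?case by (metis single_add)
  next
    case (scale n a s c)
    then show ?case by (metis mult_single add_0)
  qed auto
  then show ?thesis using assms by fastforce
qed

text \<open>
  \<open>agree n a s\<close>: all words of weight \<open>n\<close> in the lowering operators have the same vacuum
  coefficient on \<open>a\<close> and on \<open>s\<close>.
\<close>

fun agree :: "nat \<Rightarrow> upoly \<Rightarrow> upoly \<Rightarrow> bool" where
  "agree 0 a s \<longleftrightarrow> coef a 0 = coef s 0"
| "agree (Suc 0) a s \<longleftrightarrow> agree 0 (lower1 a) (fock_lower1 s)"
| "agree (Suc (Suc n)) a s \<longleftrightarrow> agree (Suc n) (lower1 a) (fock_lower1 s) \<and> agree n (lower2 a) (fock_lower2 s)"

lemma corr_agree: "corr n a s \<Longrightarrow> agree n a s"
proof (induction n a s rule: agree.induct)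
  case (1 a s)
  then show ?case by (simp add: corr_coef_0)
next
  case (2 a s)
  then show ?case using corr_lowering[of 1 a s] by simp
next
  case (3 n a s)
  then show ?case using corr_lowering[of "Suc (Suc n)" a s] by simp
qed

section \<open>Transfer of vacuum coefficients by orthogonal projection\<close>

fun fock_words :: "nat \<Rightarrow> upoly set" where
  "fock_words 0 = {1}"
| "fock_words (Suc 0) = fock_raise1 ` fock_words 0"
| "fock_words (Suc (Suc n)) = fock_raise1 ` fock_words (Suc n) \<union> fock_raise2 ` fock_words n"

lemma finite_fwords: "finite (fock_words n)"
  by (induction n rule: fock_words.induct) auto

lemma corr_fwords: "b \<in> fock_words n \<Longrightarrow> \<exists>a. corr n a b"
proof (induction n arbitrary: b rule: fock_words.induct)
  case 1
  then show ?case using corr.one by auto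
next
  case 2
  then show ?case using corr.raise1[OF corr.one] by auto
next
  case (3 n)
  from 3(3) consider c where "b = fock_raise1 c" "c \<in> fock_words (Suc n)" | c where "b = fock_raise2 c" "c \<in> fock_words n" by auto
  then show ?case using 3(1,2) corr.raise1 corr.raise2 by cases blast+
qed

lemma fock_ops_diff: "fock_lower1 (f - g) = fock_lower1 f - fock_lower1 g" "fock_lower2 (f - g) = fock_lower2 f - fock_lower2 g"
  by (simp_all add: fock_lower1_def fock_lower2_def derivation_diff pd_derivation' algebra_simps)

text \<open>By adjointness the vacuum coefficient of a lowering word on x is, up to the norm of 1,
  the pairing of x with a raising word applied to 1. Vectors with equal pairings are therefore
  interchangeable in \<open>agree\<close>.\<close>

lemma agree_orthogonal:
  assumes "agree n a s" "\<And>b. b \<in> fock_words n \<Longrightarrow> fform (s - t) b = 0"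
  shows "agree n a t"
  using assms
proof (induction n a s arbitrary: t rule: agree.induct)
  case (1 a s)
  have "fform (s - t) 1 = of_nat (fock_norm 0) * coef (s - t) 0"
    by (subst hform_sym, subst single_one[symmetric], subst hform_single_left) simp
  then show ?case using 1 fock_norm_pos[of 0] by (simp add: lookup_minus)
next
  case (2 a s)
  have h: "fform (fock_lower1 s - fock_lower1 t) b = 0" if "b \<in> fock_words 0" for b
    using 2(3)[of "fock_raise1 b"] that by (simp add: fock_ops_diff[symmetric] fform_fl1)
  have "agree 0 (lower1 a) (fock_lower1 s)" using 2(2) by (simp only: agree.simps)
  from 2(1)[OF this h] show ?case by (simp only: agree.simps)
next
  case (3 n a s)
  have h1: "fform (fock_lower1 s - fock_lower1 t) b = 0" if "b \<in> fock_words (Suc n)" for b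
    using 3(4)[of "fock_raise1 b"] that by (simp add: fock_ops_diff[symmetric] fform_fl1)
  have h2: "fform (fock_lower2 s - fock_lower2 t) b = 0" if "b \<in> fock_words n" for b
    using 3(4)[of "fock_raise2 b"] that by (simp add: fock_ops_diff[symmetric] fform_fl2)
  have a: "agree (Suc n) (lower1 a) (fock_lower1 s)" "agree n (lower2 a) (fock_lower2 s)"
    using 3(3) by (simp_all only: agree.simps)
  show ?case
    using 3(1)[OF a(1) h1] 3(2)[OF a(2) h2] by (simp only: agree.simps)
qed

text \<open>Gram-Schmidt among the vectors that \<open>corr\<close> relates to a polynomial. The
  last clause stands for membership of \<open>s\<close> in the span of \<open>B\<close> and carries
  the induction.\<close>

lemma corr_projection:
  assumes "finite B" "\<And>b. b \<in> B \<Longrightarrow> \<exists>a. corr n a b"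
  shows "\<exists>a s. corr n a s \<and> (\<forall>b\<in>B. fform (f - s) b = 0) \<and> (\<forall>x. (\<forall>b\<in>B. fform x b = 0) \<longrightarrow> fform x s = 0)"
  using assms
proof (induction B arbitrary: f)
  case empty
  then show ?case using corr.zero by fastforce
next
  case (insert b B)
  have IH: "\<exists>a s. corr n a s \<and> (\<forall>b\<in>B. fform (f - s) b = 0) \<and> (\<forall>x. (\<forall>b\<in>B. fform x b = 0) \<longrightarrow> fform x s = 0)" for f
    using insert by simp
  obtain a s where s: "corr n a s" "\<And>c. c \<in> B \<Longrightarrow> fform (f - s) c = 0" 
      "\<And>x. (\<forall>c\<in>B. fform x c = 0) \<Longrightarrow> fform x s = 0"
    using IH[of f] by blast
  obtain a' s' where s': "corr n a' s'" "\<And>c. c \<in> B \<Longrightarrow> fform (b - s') c = 0" 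
      "\<And>x. (\<forall>c\<in>B. fform x c = 0) \<Longrightarrow> fform x s' = 0"
    using IH[of b] by blast
  obtain a0 where a0: "corr n a0 b" using insert by blast
  define b' where "b' = b - s'"
  \<comment> \<open>If b' = 0, division by zero gives t = 0, which is the right value: b then equals
    \<open>s'\<close> and requires no new component.\<close>
  define t where "t = fform (f - s) b' / fform b' b'"
  define S where "S = s + cst t * b'"
  have b: "fform x b = fform x b' + fform x s'" for x
    using hform_add_right[of fock_norm x b' s'] by (simp add: b'_def)
  have "corr n (a + cst t * (a0 - a')) S"
    unfolding S_def b'_def by (intro corr.add corr.scale corr_diff s a0 s')
  moreover have fB: "fform (f - S) c = 0" if "c \<in> B" for c
    using s(2)[OF that] s'(2)[OF that]
    by (simp add: S_def b'_def[symmetric] hform_diff_left hform_add_left hform_cst_left)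
  moreover have "fform (f - S) b = 0"
  proof -
    have "fform (f - S) b' = fform (f - s) b' - t * fform b' b'"
      by (simp add: S_def hform_diff_left hform_add_left hform_cst_left)
    also have "\<dots> = 0"
      using hform_pos_def[of fock_norm b', OF fock_norm_pos] by (cases "b' = 0") (auto simp: t_def)
    finally show ?thesis using b s'(3)[of "f - S"] fB by simp
  qed
  moreover have "fform x S = 0" if "\<forall>c\<in>insert b B. fform x c = 0" for x
    using that s(3)[of x] s'(3)[of x] b[of x] by (simp add: S_def hform_add_right hform_cst_right)
  ultimately show ?case by (intro exI[of _ "a + cst t * (a0 - a')"] exI[of _ S]) blast
qed

text \<open>
  Commutators of the two operators lower the weight by any \<open>k\<close>; for the last variable \<open>u\<^sub>k\<close> that occurs
  in \<open>f\<close>, the \<open>k\<close>-th of them reduces to the derivative in \<open>u\<^sub>k\<close>.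
\<close>

lemma lowering_injective:
  assumes "lower1 f = 0" "lower2 f = 0"
  shows "f = cst (coef f 0)"
proof -
  \<comment> \<open>The field that moves phi by z^(k+1) phi'; for k = 1, 2 these are the two
    lowering operators.\<close>
  define L where "L k = der (\<lambda>i. if i < k then 0 else of_nat (i - k + 1) * U (i - k))" for k
  have LU: "1 \<le> i \<Longrightarrow> L k (U i) = (if i < k then 0 else of_nat (i - k + 1) * U (i - k))" for i k
    by (simp add: L_def der_U)
  have LD: "derivation (L k)" for k by (simp add: L_def)
  have L1: "L 1 f = lower1 f" for f
    by (rule derivation_eqI[OF LD]) (auto simp: LU lower1_U simp flip: of_nat_Suc)
  have L2: "L 2 f = lower2 f" for f
  proof (rule derivation_eqI[OF LD])
    fix k :: nat assume "1 \<le> k"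
    then show "L 2 (U k) = lower2 (U k)"
      by (cases "k < 2") (auto simp: LU lower2_U Suc_diff_Suc numeral_2_eq_2 simp flip: of_nat_Suc)
  qed simp
  \<comment> \<open>[L_(k+1), L_1] = k L_(k+2) is void for k = 0, so L_2 has to be supplied
    separately.\<close>
  have comm: "L (Suc k) (lower1 f) - lower1 (L (Suc k) f) = of_nat k * L (Suc (Suc k)) f" for f k
  proof (rule derivation_eqI[where D = "\<lambda>f. L (Suc k) (lower1 f) - lower1 (L (Suc k) f)"])
    fix i :: nat assume i: "1 \<le> i"
    consider "i < Suc k" | "i = Suc k" | j where "i = j + Suc (Suc k)"
      by (metis add.commute le_Suc_ex not_less_eq_eq linorder_not_less le_antisym)
    then show "L (Suc k) (lower1 (U i)) - lower1 (L (Suc k) (U i)) = of_nat k * L (Suc (Suc k)) (U i)"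
    proof cases
      case 1
      then show ?thesis using i LU[of "i - 1" "Suc k"]
        by (cases "i = 1") (auto simp: LU lower1_U derivation_simps LD)
    next
      case 2
      then show ?thesis using i LU[of k "Suc k"]
        by (cases "k = 0") (auto simp: LU lower1_U derivation_simps LD)
    next
      case 3
      then show ?thesis by (simp add: LU lower1_U derivation_simps LD; simp add: algebra_simps)
    qed
  qed (intro derivation_commutator derivation_scale LD derivations)+
  have Lk: "L (Suc (Suc k)) f = 0" for k
  proof (induction k)
    case 0
    then show ?case using L2[of f] assms by (simp add: numeral_2_eq_2)
  next
    case (Suc k)
    have "of_nat (Suc k) * L (Suc (Suc (Suc k))) f = 0"
      using comm[of "Suc k" f] Suc assms(1) by (simp add: derivation_0 LD)
    then have "cst (inverse (of_nat (Suc k))) * (cst (of_nat (Suc k)) * L (Suc (Suc (Suc k))) f) = 0"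
      by (simp only: single_of_nat mult_zero_right)
    then have "(cst (inverse (of_nat (Suc k))) * cst (of_nat (Suc k))) * L (Suc (Suc (Suc k))) f = 0"
      by (simp only: mult.assoc)
    moreover have "cst (inverse (of_nat (Suc k))) * cst (of_nat (Suc k)) = 1"
      by (subst mult_single) (simp del: of_nat_Suc)
    ultimately show ?case by (simp only: mult_1_left)
  qed
  have L: "L k f = 0" if "1 \<le> k" for k
  proof (cases "k = 1")
    case False
    then have "k = Suc (Suc (k - 2))" using that by linarith
    then show ?thesis using Lk[of "k - 2"] by simp
  qed (use L1[of f] assms in simp)
  have pd0: "pd k f = 0" if "1 \<le> k" for k
  proof (rule ccontr)
    assume nz: "pd k f \<noteq> 0"
    obtain N where N: "\<forall>k\<ge>N. 1 \<le> k \<longrightarrow> pd k f = 0" using pd_eventually_0 by blast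
    let ?K = "{k. 1 \<le> k \<and> pd k f \<noteq> 0}"
    have "?K \<subseteq> {..N}" using N by (auto intro: ccontr)
    then have fin: "finite ?K" by (rule finite_subset) simp
    \<comment> \<open>For the last variable that occurs, only the term k = m of \<open>L m\<close>
      survives, and its coefficient is \<open>U 0 = 1\<close>.\<close>
    define m where "m = Max ?K"
    have m: "m \<in> ?K" unfolding m_def using nz that by (intro Max_in fin) auto
    have "L m f = (\<Sum>k\<in>?K. (if k < m then 0 else of_nat (k - m + 1) * U (k - m)) * pd k f)"
      by (simp add: L_def der_def)
    also have "\<dots> = (\<Sum>k\<in>{m}. (if k < m then 0 else of_nat (k - m + 1) * U (k - m)) * pd k f)"
    proof (rule sum.mono_neutral_right[OF fin])
      show "\<forall>k\<in>?K - {m}. (if k < m then 0 else of_nat (k - m + 1) * U (k - m)) * pd k f = 0"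
      proof
        fix k assume k: "k \<in> ?K - {m}"
        then have "k \<le> m" unfolding m_def using Max_ge[OF fin] by blast
        with k show "(if k < m then 0 else of_nat (k - m + 1) * U (k - m)) * pd k f = 0" by simp
      qed
    qed (use m in auto)
    finally have "L m f = pd m f" by simp
    then show False using L[of m] m by simp
  qed
  show ?thesis
  proof (rule poly_mapping_eqI)
    fix p show "coef f p = coef (cst (coef f 0)) p"
    proof (cases "p = 0")
      case False
      then obtain i where i: "expo p i \<noteq> 0" by (metis lookup_zero poly_mapping_eqI)
      have "of_nat (Suc (expo (p - uexp i) i)) * coef f (p - uexp i + uexp i) = 0"
        using coef_pd[of i f "p - uexp i"] pd0[of "Suc i"] by simp
      then have "coef f p = 0" using mono_split[OF i] by (simp del: of_nat_Suc)
      then show ?thesis using False by (simp add: lookup_single)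
    qed simp
  qed
qed

text \<open>In weight 1 \<open>agree\<close> says nothing about \<open>lower2\<close>; this closes
  the gap when injectivity is applied there.\<close>

lemma lower2_graded_1:
  assumes "f \<in> graded (Suc 0)"
  shows "lower2 f = 0"
  unfolding lower2_def der_def
proof (rule sum.neutral, safe)
  fix k :: nat assume k: "1 \<le> k" "pd k f \<noteq> 0"
  then have "k = 1" using graded_pd[OF assms k(2,1)] by simp
  then show "of_nat (k - 1) * U (k - 2) * pd k f = 0" by simp
qed

text \<open>By induction the lowered polynomials coincide, so the difference is killed by both
  lowering operators, hence constant, hence 0 in positive weight.\<close>

lemma agree_unique:
  "a \<in> graded n \<Longrightarrow> b \<in> graded n \<Longrightarrow> agree n a s \<Longrightarrow> agree n b s \<Longrightarrow> a = b"
proof (induction n a s arbitrary: b rule: agree.induct)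
  case (1 a s)
  then show ?case using graded_0_cst[of a] graded_0_cst[of b] by simp
next
  case (2 a s)
  have "lower1 a = lower1 b" using 2 graded_lower1[of _ "Suc 0"] by simp
  then have "a - b = cst (coef (a - b) 0)"
    using lower2_graded_1[of a] lower2_graded_1[of b] 2
    by (intro lowering_injective) (simp_all add: derivation_diff)
  moreover have "coef (a - b) 0 = 0" using graded_coef_0[OF graded_diff[OF 2(2,3)]] by simp
  ultimately show ?case by simp
next
  case (3 n a s)
  have "lower1 a = lower1 b" using 3 graded_lower1[of _ "Suc (Suc n)"] by simp
  moreover have "lower2 a = lower2 b" using 3 graded_lower2[of _ "Suc (Suc n)"] by simp
  ultimately have "a - b = cst (coef (a - b) 0)"
    by (intro lowering_injective) (simp_all add: derivation_diff)
  moreover have "coef (a - b) 0 = 0" using graded_coef_0[OF graded_diff[OF 3(3,4)]] by simp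
  ultimately show ?case by simp
qed

text \<open>
  The isotropic vector \<open>U 1 + i U 2\<close> makes \<open>fock_lower2\<close> vanish on its powers, so that these
  correspond to the powers of \<open>U 1\<close>.
\<close>

lemma fock_lower_isotropic:
  defines "z \<equiv> U 1 + cst \<i> * U 2"
  shows "fock_lower1 (z ^ n) = cst (charge * of_nat n) * z ^ (n - 1)" "fock_lower2 (z ^ n) = 0"
proof -
  have pd: "pd 1 z = 1" "pd 2 z = cst \<i>" "pd 3 z = 0" "shift_down 2 z = 0" "shift_down 4 z = 0"
    by (simp_all add: z_def derivation_simps pd_derivation' pd_U_pos shift_down_U)
  have cst: "cst (charge * of_nat n) = cst charge * of_nat n"
    by (simp only: mult_single single_of_nat[symmetric] add_0)
  show "fock_lower1 (z ^ n) = cst (charge * of_nat n) * z ^ (n - 1)"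
    unfolding fock_lower1_def cst by (simp add: derivation_power pd_derivation' pd[simplified])
  have ii: "cst \<i> * cst \<i> = - 1" by (simp add: mult_single single_uminus)
  have "pd 1 (pd 1 (z ^ n)) = of_nat n * of_nat (n - 1) * z ^ (n - 2)"
    by (simp add: derivation_simps pd_derivation' pd[simplified] numeral_2_eq_2)
  moreover have "pd 2 (pd 2 (z ^ n)) = (cst \<i> * cst \<i>) * (of_nat n * of_nat (n - 1) * z ^ (n - 2))"
    by (simp add: derivation_simps pd_derivation' pd pd(2)[unfolded numeral_2_eq_2] numeral_2_eq_2; simp add: mult_ac)
  ultimately show "fock_lower2 (z ^ n) = 0"
    unfolding fock_lower2_def ii by (simp add: derivation_power pd_derivation' pd)
qed

lemma agree_0: "agree n 0 0"
  by (induction n "0::upoly" "0::upoly" rule: agree.induct) (simp_all add: derivation_0)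

text \<open>Each \<open>fock_lower1\<close> produces a factor \<open>charge\<close>, which the
  polynomial side has to match; the free constant c absorbs the factors during the
  induction.\<close>

lemma agree_isotropic:
  "agree n (cst (c * charge ^ n) * U 1 ^ n) (cst c * (U 1 + cst \<i> * U 2) ^ n)"
proof (induction n arbitrary: c)
  case (Suc n)
  let ?z = "U 1 + cst \<i> * U 2"
  have "lower1 (cst (c * charge ^ Suc n) * U 1 ^ Suc n) = cst (c * charge ^ Suc n) * of_nat (Suc n) * U 1 ^ n"
    unfolding derivation_cst_mult[OF derivations(1)]
    by (simp only: derivation_power[OF derivations(1)] lower1_U) (simp add: mult_ac)
  also have "cst (c * charge ^ Suc n) * of_nat (Suc n) = cst ((c * charge * of_nat (Suc n)) * charge ^ n)"
    by (subst single_of_nat[symmetric], subst mult_single; simp add: mult_ac)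
  finally have 1: "lower1 (cst (c * charge ^ Suc n) * U 1 ^ Suc n) = cst ((c * charge * of_nat (Suc n)) * charge ^ n) * U 1 ^ n" .
  have 2: "fock_lower1 (cst c * ?z ^ Suc n) = cst (c * charge * of_nat (Suc n)) * ?z ^ n"
    unfolding fock_ops_linear fock_lower_isotropic mult.assoc[symmetric] mult_single by (simp add: mult_ac)
  have 3: "lower2 (cst (c * charge ^ Suc n) * U 1 ^ Suc n) = 0"
    unfolding derivation_cst_mult[OF derivations(2)] by (simp only: derivation_power[OF derivations(2)] lower2_U) simp
  have 4: "fock_lower2 (cst c * ?z ^ Suc n) = 0"
    unfolding fock_ops_linear fock_lower_isotropic by simp
  have key: "agree (Suc n) a s \<longleftrightarrow> agree n (lower1 a) (fock_lower1 s) \<and> (n = 0 \<or> agree (n - 1) (lower2 a) (fock_lower2 s))" for a s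
    by (cases n) auto
  show ?case unfolding key 1 2 3 4 by (intro conjI disjI2 Suc agree_0)
qed simp

lemma corr_images: "corr n a s \<Longrightarrow> 2 \<le> n \<Longrightarrow> a \<in> images n"
proof (induction rule: corr.induct)
  case (raise1 n a s)
  then show ?case using images_raise1[of a "Suc n"] corr_graded by simp
next
  case (raise2 n a s)
  then show ?case using images_raise2[of a "Suc (Suc n)"] corr_graded by simp
qed (auto intro: images_add images_cst)

theorem graded_eq_images:
  assumes n: "2 \<le> n"
  shows "graded n = images n"
proof -
  let ?f = "(U 1 + cst \<i> * U 2) ^ n"
  \<comment> \<open>The isotropic power need not be a combination of words, but its projection s is.
    Both have the same vacuum coefficients, which forces the polynomial counterpart a to be
    \<open>charge\<close>^n u_1^n.\<close>
  obtain a s where as: "corr n a s" "\<forall>b\<in>fock_words n. fform (?f - s) b = 0"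
    using corr_projection[OF finite_fwords corr_fwords, of n n ?f] by blast
  have "fform (s - ?f) b = 0" if "b \<in> fock_words n" for b
    using as(2) that hform_uminus_left[of fock_norm "?f - s" b] by simp
  then have "agree n a ?f"
    using agree_orthogonal[OF corr_agree[OF as(1)]] by blast
  moreover have "agree n (cst (charge ^ n) * U 1 ^ n) ?f"
    using agree_isotropic[of n 1] by simp
  moreover have "cst (charge ^ n) * U 1 ^ n \<in> graded n"
    using graded_cst_mult[OF graded_power[OF graded_U[of 1], of n]] by simp
  ultimately have "a = cst (charge ^ n) * U 1 ^ n"
    using agree_unique corr_graded[OF as(1)] by blast
  then have "cst (inverse (charge ^ n)) * (cst (charge ^ n) * U 1 ^ n) \<in> images n"
    using images_cst corr_images[OF as(1) n] by blast
  then have "(cst (inverse (charge ^ n)) * cst (charge ^ n)) * U 1 ^ n \<in> images n"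
    by (simp only: mult.assoc)
  moreover have chg0: "charge ^ n \<noteq> 0" by simp
  have "cst (inverse (charge ^ n)) * cst (charge ^ n) = 1"
    unfolding mult_single left_inverse[OF chg0] by simp
  ultimately have u: "U 1 ^ n \<in> images n" by simp
  have "f \<in> images n" if "f \<in> graded n" for f
    using graded_u1_or_image[OF n that] u unfolding u1_or_image_def
    by (auto intro: images_add images_cst)
  then show ?thesis using images_graded[OF n] by blast
qed

text \<open>The two pairs of operators differ by a triangular change: for b of weight n - 2 the
  correction 3 R1 (u_1 b) already lies in the image of \<open>R1\<close>.\<close>

theorem graded_R1_R2:
  assumes n: "2 \<le> n"
  shows "{a + b | a b. a \<in> R1 ` graded (n - 1) \<and> b \<in> R2 ` graded (n - 2)} = graded n"
proof (intro equalityI subsetI)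
  obtain m where m: "n = m + 2" using n by (metis add.commute le_Suc_ex)
  have R2: "R2 b = - raise2 b + 3 * raise1 (U 1 * b)" for b
    using raise2_R2[of b] by (simp add: R1_raise1 algebra_simps)
  have neg: "raise1 (- f) = - raise1 f" "raise2 (- f) = - raise2 f" for f
    using raise_cst[of "-1" f] by (simp_all add: single_uminus)
  have three: "raise1 (3 * f) = 3 * raise1 f" for f
    using raise_cst(1)[of 3 f] by simp
  {
    fix x assume "x \<in> {a + b | a b. a \<in> R1 ` graded (n - 1) \<and> b \<in> R2 ` graded (n - 2)}"
    then obtain a b where x: "x = R1 a + R2 b" and ab: "a \<in> graded (n - 1)" "b \<in> graded (n - 2)" by auto
    have "U 1 * b \<in> graded (n - 1)" using graded_mult[OF graded_U[of 1] ab(2)] m by simp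
    then have "x = raise1 (3 * (U 1 * b) - a) + raise2 (- b)" "3 * (U 1 * b) - a \<in> graded (n - 1)"
      using ab graded_mult[OF graded_numeral, of "U 1 * b" "n - 1"]
      unfolding x R2 using raise_add(1)[of "3 * (U 1 * b)" "- a"] by (auto simp: R1_raise1 neg three intro!: graded_diff)
    then show "x \<in> graded n"
      unfolding graded_eq_images[OF n] images_def using ab(2) graded_uminus by blast
  next
    fix x assume "x \<in> graded n"
    then obtain a b where x: "x = raise1 a + raise2 b" and ab: "a \<in> graded (n - 1)" "b \<in> graded (n - 2)"
      unfolding graded_eq_images[OF n] images_def by blast
    have U: "U 1 * b \<in> graded (n - 1)" using graded_mult[OF graded_U[of 1] ab(2)] m by simp
    have "R1 (- a - 3 * (U 1 * b)) + R2 (- b) = x"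
    proof -
      have "raise1 (- a - 3 * (U 1 * b)) = - raise1 a - 3 * raise1 (U 1 * b)"
        using raise_add(1)[of "- a" "- (3 * (U 1 * b))"] by (simp add: neg three)
      then show ?thesis using neg(1)[of "U 1 * b"] by (simp add: x R2 R1_raise1 neg)
    qed
    moreover have "- a - 3 * (U 1 * b) \<in> graded (n - 1)"
      using ab U graded_mult[OF graded_numeral U] by (intro graded_diff graded_uminus) auto
    ultimately show "x \<in> {a + b | a b. a \<in> R1 ` graded (n - 1) \<and> b \<in> R2 ` graded (n - 2)}"
      using graded_uminus[OF ab(2)] by blast
  }
qed

section \<open>Kernels of the adjoints\<close>

lemma finite_weight: "finite {p. weight p = n}"
proof (induction n rule: less_induct)
  case (less n)
  have "{p. weight p = n} \<subseteq> insert 0 (\<Union>i<n. (\<lambda>q. q + uexp i) ` {q. weight q = n - Suc i})"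
  proof
    fix p assume p: "p \<in> {p. weight p = n}"
    show "p \<in> insert 0 (\<Union>i<n. (\<lambda>q. q + uexp i) ` {q. weight q = n - Suc i})"
    proof (cases "p = 0")
      case False
      then obtain i where i: "expo p i \<noteq> 0" by (metis lookup_zero poly_mapping_eqI)
      have "weight (p - uexp i) = n - Suc i" "i < n"
        using p weight_add[of "p - uexp i" "uexp i"] mono_split[OF i] by auto
      then show ?thesis using mono_split[OF i] by blast
    qed simp
  qed
  moreover have "finite (insert 0 (\<Union>i<n. (\<lambda>q. q + uexp i) ` {q. weight q = n - Suc i}))"
    using less by auto
  ultimately show ?case by (rule finite_subset)
qed

lemma herm_hform: "herm = hform mono_fact"
  by (intro ext) (simp add: herm_def hform_def)

lemma mono_fact_pos: "mono_fact p > 0"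
  by (auto simp: mono_fact_def intro: prod_pos)

lemma herm_self_eq_0: "herm f f = 0 \<Longrightarrow> f = 0"
  unfolding herm_hform by (rule hform_pos_def[OF mono_fact_pos])

text \<open>\<open>graded_adjoint\<close> is a definite description, so its value is known only
  after existence and uniqueness. The Riesz vector h exists because there are finitely many
  monomials of each weight; positivity of \<open>herm\<close> makes it unique.\<close>

lemma adjoint_kernel_iff:
  assumes add: "\<And>f g. R (f + g) = R f + R g" and cst: "\<And>c f. R (cst c * f) = cst c * R f"
  shows "g \<in> adjoint_kernel R m n \<longleftrightarrow> g \<in> graded n \<and> (\<forall>f\<in>graded (n - m). herm (R f) g = 0)"
proof -
  let ?W = "{p. weight p = n - m}"
  let ?P = "\<lambda>h. h \<in> graded (n - m) \<and> (\<forall>f\<in>graded (n - m). herm (R f) g = herm f h)"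
  define h where "h = (\<Sum>p\<in>?W. Poly_Mapping.single p (cnj (herm (R (Poly_Mapping.single p 1)) g) / of_nat (mono_fact p)))"
  have R0: "R 0 = 0" using cst[of 0 0] by simp
  have h: "h \<in> graded (n - m)" unfolding h_def by (intro graded_sum graded_single) auto
  have coef_h: "coef h p = cnj (herm (R (Poly_Mapping.single p 1)) g) / of_nat (mono_fact p)" if "weight p = n - m" for p
    unfolding h_def lookup_sum lookup_single using that finite_weight[of "n - m"]
    by (simp add: when_def sum.delta)
  have single: "herm (R (Poly_Mapping.single p c)) g = herm (Poly_Mapping.single p c) h" if "weight p = n - m" for p c
  proof -
    have "R (Poly_Mapping.single p c) = cst c * R (Poly_Mapping.single p 1)"
      using cst[of c "Poly_Mapping.single p 1"] by (simp add: mult_single)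
    then show ?thesis
      using mono_fact_pos[of p] that by (simp add: herm_hform hform_cst_left hform_single_left coef_h)
  qed
  have "herm (R f) g = herm f h" if f: "f \<in> graded (n - m)" for f
  proof -
    have "herm (R (\<Sum>p\<in>A. Poly_Mapping.single p (coef f p))) g = herm (\<Sum>p\<in>A. Poly_Mapping.single p (coef f p)) h"
      if "finite A" "A \<subseteq> mons f" for A
      using that
    proof (induction A)
      case (insert p A)
      then have "weight p = n - m" using f by (auto simp: graded_def)
      then show ?case using insert single by (simp add: add herm_hform hform_add_left)
    qed (simp add: R0 herm_hform)
    from this[OF finite_keys subset_refl] show ?thesis by (simp add: poly_mapping_decomp[symmetric])
  qed
  with h have Ph: "?P h" by blast
  have uniq: "h' = h" if "?P h'" for h'
  proof -
    have d: "h' - h \<in> graded (n - m)" using that h by (auto intro: graded_diff)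
    then have "herm (h' - h) h' = herm (h' - h) h" using that Ph by metis
    then have "herm (h' - h) (h' - h) = 0"
      unfolding herm_hform using hform_add_right[of mono_fact "h' - h" "h' - h" h] by simp
    then show ?thesis using herm_self_eq_0 by fastforce
  qed
  have "graded_adjoint R m n g = h"
    unfolding graded_adjoint_def using Ph uniq by (rule the_equality)
  moreover have "h = 0 \<longleftrightarrow> (\<forall>f\<in>graded (n - m). herm (R f) g = 0)"
    using Ph uniq[of 0] by (auto simp: herm_hform)
  ultimately show ?thesis by (simp add: adjoint_kernel_def)
qed

lemma R_linear:
  "R1 (f + g) = R1 f + R1 g" "R2 (f + g) = R2 f + R2 g"
  "R1 (cst c * f) = cst c * R1 f" "R2 (cst c * f) = cst c * R2 f"
proof -
  have R2: "R2 b = - raise2 b + 3 * raise1 (U 1 * b)" for b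
    using raise2_R2[of b] by (simp add: R1_raise1 algebra_simps)
  show "R1 (f + g) = R1 f + R1 g" "R2 (f + g) = R2 f + R2 g"
    by (simp_all add: R1_raise1 R2 raise_add distrib_left)
  show "R1 (cst c * f) = cst c * R1 f" by (simp add: R1_raise1 raise_cst)
  have "U 1 * (cst c * f) = cst c * (U 1 * f)" by (simp add: mult_ac)
  then show "R2 (cst c * f) = cst c * R2 f"
    unfolding R2 by (simp only: raise_cst) (simp add: algebra_simps)
qed

text \<open>An element of both kernels is orthogonal to both images, hence to everything of weight
  n, hence to itself.\<close>

theorem adjoint_kernels_trivial:
  assumes n: "2 \<le> n"
  shows "adjoint_kernel R1 1 n \<inter> adjoint_kernel R2 2 n = {0}"
proof -
  have 1: "g \<in> adjoint_kernel R1 1 n \<longleftrightarrow> g \<in> graded n \<and> (\<forall>f\<in>graded (n - 1). herm (R1 f) g = 0)" for g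
    by (rule adjoint_kernel_iff) (rule R_linear)+
  have 2: "g \<in> adjoint_kernel R2 2 n \<longleftrightarrow> g \<in> graded n \<and> (\<forall>f\<in>graded (n - 2). herm (R2 f) g = 0)" for g
    by (rule adjoint_kernel_iff) (rule R_linear)+
  have "g = 0" if g: "g \<in> adjoint_kernel R1 1 n" "g \<in> adjoint_kernel R2 2 n" for g
  proof -
    have "g \<in> graded n" using g(1) unfolding 1 by simp
    then obtain a b where "g = R1 a + R2 b" "a \<in> graded (n - 1)" "b \<in> graded (n - 2)"
      unfolding graded_R1_R2[OF n, symmetric] by auto
    moreover have "herm (R1 a + R2 b) g = herm (R1 a) g + herm (R2 b) g"
      by (simp add: herm_hform hform_add_left)
    ultimately have "herm g g = 0" using g unfolding 1 2 by simp
    then show ?thesis by (rule herm_self_eq_0)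
  qed
  moreover have "0 \<in> adjoint_kernel R1 1 n \<inter> adjoint_kernel R2 2 n"
    unfolding Int_iff 1 2 by (simp add: herm_hform)
  ultimately show ?thesis by blast
qed

section \<open>Linear functionals and bihomogeneous polynomials\<close>

definition linext :: "('a \<Rightarrow> complex) \<Rightarrow> ('a \<Rightarrow>\<^sub>0 complex) \<Rightarrow> complex" where
  "linext \<phi> f = (\<Sum>x\<in>Poly_Mapping.keys f. Poly_Mapping.lookup f x * \<phi> x)"

lemma linext_superset:
  "finite A \<Longrightarrow> Poly_Mapping.keys f \<subseteq> A \<Longrightarrow> linext \<phi> f = (\<Sum>x\<in>A. Poly_Mapping.lookup f x * \<phi> x)"
  unfolding linext_def by (intro sum.mono_neutral_left) (auto simp: in_keys_iff)

lemma linext_add: "linext \<phi> (f + g) = linext \<phi> f + linext \<phi> g"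
proof -
  have "Poly_Mapping.keys (f + g) \<subseteq> Poly_Mapping.keys f \<union> Poly_Mapping.keys g" by (rule keys_add)
  then show ?thesis
    by (simp add: linext_superset[of "Poly_Mapping.keys f \<union> Poly_Mapping.keys g"] lookup_add algebra_simps sum.distrib)
qed

lemma linext_single: "linext \<phi> (Poly_Mapping.single x c) = c * \<phi> x"
  by (subst linext_superset[of "{x}"]) auto

lemma linext_0 [simp]: "linext \<phi> 0 = 0" by (simp add: linext_def)

lemma linext_sum: "linext \<phi> (\<Sum>i\<in>A. h i) = (\<Sum>i\<in>A. linext \<phi> (h i))"
  by (induction A rule: infinite_finite_induct) (auto simp: linext_add)

lemma linext_uminus: "linext \<phi> (- f) = - linext \<phi> f"
  using linext_add[of \<phi> f "- f"] by (simp add: eq_neg_iff_add_eq_0 add.commute)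

lemma linext_diff: "linext \<phi> (f - g) = linext \<phi> f - linext \<phi> g"
  using linext_add[of \<phi> f "- g"] by (simp add: linext_uminus)

lemma linext_scale: "linext (\<lambda>x. c * \<phi> x) f = c * linext \<phi> f" "linext (\<lambda>x. \<phi> x * c) f = linext \<phi> f * c"
  by (simp_all add: linext_def sum_distrib_left mult_ac)

lemma expect_lin: "expect M = linext (\<lambda>(P, Q). M P Q)"
  by (intro ext) (simp add: expect_def linext_def case_prod_unfold)

lemma bieval_lin: "bieval f s = linext (\<lambda>(P, Q). mono_val P s * cnj (mono_val Q s)) f"
  by (simp add: bieval_def linext_def case_prod_unfold)

text \<open>Stands for f(u) g(conj u): the second factor is evaluated at conjugated arguments, while
  its own coefficients are not conjugated.\<close>

definition tensor :: "upoly \<Rightarrow> upoly \<Rightarrow> bipoly" where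
  "tensor f g = (\<Sum>p\<in>mons f. \<Sum>q\<in>mons g. Poly_Mapping.single (p, q) (coef f p * coef g q))"

lemma linext_tens: "linext \<phi> (tensor f g) = linext (\<lambda>p. linext (\<lambda>q. \<phi> (p, q)) g) f"
  unfolding tensor_def linext_sum linext_single
  by (simp add: linext_def[of _ f] linext_def[of _ g] sum_distrib_left mult.assoc)

lemma tensor_bigraded:
  assumes "f \<in> graded n" "g \<in> graded m"
  shows "tensor f g \<in> bigraded n m"
proof -
  have "Poly_Mapping.keys (tensor f g) \<subseteq> mons f \<times> mons g"
    unfolding tensor_def
    by (rule order_trans[OF keys_sum] UN_least)+ auto
  then show ?thesis using assms by (fastforce simp: bigraded_def graded_def)
qed

definition peval :: "(nat \<Rightarrow> complex) \<Rightarrow> upoly \<Rightarrow> complex" where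
  "peval s = linext (\<lambda>p. mono_val p s)"

lemma mono_val_add: "mono_val (p + q) s = mono_val p s * mono_val q s"
proof -
  let ?A = "Poly_Mapping.keys p \<union> Poly_Mapping.keys q"
  have sup: "mono_val r s = (\<Prod>i\<in>?A. s (Suc i) ^ expo r i)" if "Poly_Mapping.keys r \<subseteq> ?A" for r
    unfolding mono_val_def using that by (intro prod.mono_neutral_left) (auto simp: in_keys_iff)
  have "Poly_Mapping.keys (p + q) \<subseteq> ?A" by (rule keys_add)
  then show ?thesis by (simp add: sup lookup_add power_add prod.distrib)
qed

lemma peval_add: "peval s (f + g) = peval s f + peval s g"
  and peval_diff: "peval s (f - g) = peval s f - peval s g"
  and peval_uminus: "peval s (- f) = - peval s f"
  and peval_sum: "peval s (\<Sum>i\<in>A. h i) = (\<Sum>i\<in>A. peval s (h i))"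
  by (simp_all add: peval_def linext_add linext_diff linext_uminus linext_sum)

lemma peval_cst: "peval s (cst c) = c"
  by (simp add: peval_def linext_single mono_val_def)

lemma peval_mult: "peval s (f * g) = peval s f * peval s g"
proof (induction f rule: poly_mapping_single_induct)
  case (single p c)
  show ?case
    by (induction g rule: poly_mapping_single_induct)
       (simp_all add: peval_def linext_add linext_single mult_single mono_val_add algebra_simps)
qed (simp add: peval_add distrib_right)

lemma peval_U:
  assumes "s 0 = 1"
  shows "peval s (U k) = s k"
proof (cases k)
  case 0
  then show ?thesis using assms peval_cst[of s 1] by simp
next
  case (Suc i)
  then show ?thesis by (simp add: peval_def U_Suc linext_single mono_val_def)
qed

lemma peval_of_nat: "peval s (of_nat n) = of_nat n"
  using peval_cst[of s "of_nat n"] by simp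
lemma peval_numeral: "peval s (numeral n) = numeral n"
  using peval_cst[of s "numeral n"] by simp
lemma peval_power: "peval s (f ^ n) = peval s f ^ n"
  by (induction n) (simp_all add: peval_mult peval_cst[of s 1, simplified])

lemma peval_pinv:
  assumes "s 0 = 1"
  shows "peval s (pinv U k) = pinv s k"
proof (induction k rule: less_induct)
  case (less k)
  show ?case
  proof (cases "k = 0")
    case True
    then show ?thesis using assms peval_cst[of s 1] by (simp add: pinv_0_gen)
  next
    case False
    then show ?thesis
      using less assms by (simp add: pinv_rec pinv_rec_gen peval_uminus peval_sum peval_mult peval_U)
  qed
qed

lemmas peval_simps = peval_add peval_diff peval_uminus peval_cst peval_mult peval_U peval_of_nat peval_numeral peval_power peval_pinv

lemma cnj_pinv:
  assumes "s 0 = 1"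
  shows "cnj (pinv s k) = pinv (\<lambda>i. cnj (s i)) k"
proof (induction k rule: less_induct)
  case (less k)
  show ?case
    using less assms by (cases "k = 0") (simp_all add: pinv_0_gen pinv_rec_gen)
qed

lemma cnj_mono_val: "cnj (mono_val p s) = mono_val p (\<lambda>i. cnj (s i))"
  by (simp add: mono_val_def)

lemma bieval_tens: "bieval (tensor f g) s = peval s f * peval (\<lambda>i. cnj (s i)) g"
  unfolding bieval_lin linext_tens by (simp add: cnj_mono_val peval_def linext_scale)

lemma bieval_add: "bieval (f + g) s = bieval f s + bieval g s"
  and bieval_diff: "bieval (f - g) s = bieval f s - bieval g s"
  by (simp_all add: bieval_lin linext_add linext_diff)

section \<open>Uniqueness of the moments\<close>

lemma graded_1_eq:
  assumes "f \<in> graded (Suc 0)"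
  shows "f = cst (coef f (uexp 0)) * U 1"
proof (rule poly_mapping_eqI)
  fix p
  show "coef f p = coef (cst (coef f (uexp 0)) * U 1) p"
  proof (cases "p \<in> mons f")
    case True
    then have w: "weight p = Suc 0" using assms by (auto simp: graded_def)
    then have "p \<noteq> 0" by auto
    then obtain i where i: "expo p i \<noteq> 0" by (metis lookup_zero poly_mapping_eqI)
    have "i = 0" using expo_le_weight[OF i] w by simp
    have "weight (p - uexp i) = 0"
      using w weight_add[of "p - uexp i" "uexp i"] mono_split[OF i] \<open>i = 0\<close> by simp
    then have "p = uexp 0" using mono_split[OF i] \<open>i = 0\<close> by (simp add: weight_eq_0_iff)
    then show ?thesis by (simp add: U_Suc mult_single)
  next
    case False
    then show ?thesis by (auto simp: U_Suc mult_single lookup_single when_def in_keys_iff)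
  qed
qed

text \<open>The identities express the value at \<open>f (x) R_m h\<close> through pairs of smaller
  weight, and surjectivity lets \<open>R_m h\<close> produce every second factor. Taking
  \<open>g1\<close> and \<open>g2\<close> as hypotheses separates this algebra from the variation of
  loops.\<close>

lemma moments_unique:
  assumes g1: "\<And>n f g. 1 \<le> n \<Longrightarrow> f \<in> graded n \<Longrightarrow> g \<in> graded (n - 1) \<Longrightarrow>
      tensor (lower1 f) g + tensor f (R1 g) \<in> L_images"
    and g2: "\<And>n f g. 2 \<le> n \<Longrightarrow> f \<in> graded n \<Longrightarrow> g \<in> graded (n - 2) \<Longrightarrow>
      tensor (lower2 f) g - tensor (lower1 f) (3 * U 1 * g) + tensor f (R2 g) \<in> L_images"
    and M: "satisfies_L_identities M" "M 0 0 = 1" and M': "satisfies_L_identities M'" "M' 0 0 = 1"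
    and PQ: "weight P = weight Q"
  shows "M P Q = M' P Q"
proof -
  have add: "expect N (tensor f (g + h)) = expect N (tensor f g) + expect N (tensor f h)" for N f g h
    unfolding expect_lin linext_tens linext_add by (simp add: linext_def sum.distrib algebra_simps)
  have "expect M (tensor f g) = expect M' (tensor f g)" if "f \<in> graded n" "g \<in> graded n" for n f g
    using that
  proof (induction n arbitrary: f g rule: less_induct)
    case (less n)
    have R1: "expect M (tensor f (R1 h)) = expect M' (tensor f (R1 h))" if "1 \<le> n" "h \<in> graded (n - 1)" for h
    proof -
      have "expect N (tensor f (R1 h)) = - expect N (tensor (lower1 f) h)" if "satisfies_L_identities N" for N
      proof -
        have "expect N (tensor (lower1 f) h + tensor f (R1 h)) = 0"
          using that g1[OF \<open>1 \<le> n\<close> less.prems(1) \<open>h \<in> graded (n - 1)\<close>] by (simp add: satisfies_L_identities_def)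
        then show ?thesis by (simp add: expect_lin linext_add eq_neg_iff_add_eq_0 add.commute)
      qed
      then show ?thesis using M M' less.IH[of "n - 1" "lower1 f" h] that graded_lower1[OF less.prems(1)] by simp
    qed
    have R2: "expect M (tensor f (R2 h)) = expect M' (tensor f (R2 h))" if n: "2 \<le> n" "h \<in> graded (n - 2)" for h
    proof -
      have "expect N (tensor f (R2 h)) = expect N (tensor (lower1 f) (3 * U 1 * h)) - expect N (tensor (lower2 f) h)"
        if "satisfies_L_identities N" for N
      proof -
        have "expect N (tensor (lower2 f) h - tensor (lower1 f) (3 * U 1 * h) + tensor f (R2 h)) = 0"
          using that g2[OF n(1) less.prems(1) n(2)] by (simp add: satisfies_L_identities_def)
        then show ?thesis by (simp add: expect_lin linext_add linext_diff algebra_simps add_eq_0_iff2)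
      qed
      moreover have "3 * U 1 * h \<in> graded (n - 1)"
        using graded_mult[OF graded_mult[OF graded_numeral graded_U[of 1]] n(2)] n(1)
        by (simp add: Suc_diff_Suc numeral_2_eq_2)
      ultimately show ?thesis
        using M M' less.IH[of "n - 1" "lower1 f" "3 * U 1 * h"] less.IH[of "n - 2" "lower2 f" h] n
          graded_lower1[OF less.prems(1)] graded_lower2[OF less.prems(1)] by simp
    qed
    consider "n = 0" | "n = 1" | "2 \<le> n" by linarith
    then show ?case
    proof cases
      case 1
      then obtain a b where "f = cst a" "g = cst b"
        using graded_0_cst less.prems by metis
      then show ?thesis using M(2) M'(2) by (simp add: expect_lin linext_tens linext_single)
    next
      case 2
      \<comment> \<open>Surjectivity starts at weight 2; in weight 1 the constant a is mapped by
        \<open>R1\<close> to - 2 a u_1.\<close>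
      let ?c = "coef g (uexp 0)"
      have "R1 (cst (- ?c / 2)) = - (cst (- ?c / 2) * (2 * U 1))"
        by (simp add: R1_raise1 raise1_def derivation_cst mult_ac)
      also have "\<dots> = (cst (?c / 2) * cst 2) * U 1" by (simp add: single_uminus mult_ac)
      also have "\<dots> = g" using graded_1_eq[of g] less.prems 2 by (subst mult_single) simp
      finally show ?thesis using R1[of "cst (- ?c / 2)"] 2 by simp
    next
      case 3
      then obtain a b where "g = R1 a + R2 b" "a \<in> graded (n - 1)" "b \<in> graded (n - 2)"
        using less.prems(2) unfolding graded_R1_R2[OF 3, symmetric] by auto
      then show ?thesis using R1[of a] R2[of b] 3 by (simp add: add)
    qed
  qed
  from this[of "Poly_Mapping.single P 1" "weight P" "Poly_Mapping.single Q 1"] PQ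
  show ?thesis by (simp add: graded_single expect_lin linext_tens linext_single)
qed

section \<open>Normalized conformal maps and rotations\<close>

lemma loops_plane:
  "\<gamma> \<in> loops plane \<longleftrightarrow> (\<exists>g. continuous_on (sphere (0::complex) 1) g \<and> inj_on g (sphere 0 1) \<and> \<gamma> = g ` sphere 0 1)"
  by (simp add: loops_def plane_def)

lemma loops_simple_path:
  assumes "\<gamma> \<in> loops plane"
  obtains p where "simple_path p" "pathfinish p = pathstart p" "path_image p = \<gamma>"
proof -
  obtain g where g: "continuous_on (sphere (0::complex) 1) g" "inj_on g (sphere 0 1)" "\<gamma> = g ` sphere 0 1"
    using assms unfolding loops_plane by blast
  let ?c = "circlepath (0::complex) 1"
  have im: "path_image ?c = sphere 0 1" by simp
  show ?thesis
  proof (rule that[of "g \<circ> ?c"])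
    show "simple_path (g \<circ> ?c)"
      using g im by (intro simple_path_continuous_image) (auto simp: simple_path_circlepath)
    show "pathfinish (g \<circ> ?c) = pathstart (g \<circ> ?c)"
      by (simp add: pathfinish_compose pathstart_compose)
    show "path_image (g \<circ> ?c) = \<gamma>"
      using g im by (simp add: path_image_compose)
  qed
qed

lemma holomorphic_on_scale:
  assumes "f holomorphic_on S" "\<And>z. z \<in> T \<Longrightarrow> c * z \<in> S"
  shows "(\<lambda>z. f (c * z)) holomorphic_on T"
proof -
  have "(\<lambda>z. c * z) holomorphic_on T" by (intro holomorphic_intros)
  moreover have "(\<lambda>z. c * z) ` T \<subseteq> S" using assms(2) by blast
  ultimately show ?thesis
    using holomorphic_on_compose_gen[of "\<lambda>z. c * z" T f S] assms(1) by (simp add: o_def)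
qed

text \<open>\<open>phi_plus\<close> is a choice, so its properties are available only once a
  normalized map exists: a Riemann map of the inside, composed with a disk automorphism that sends 0
  to the preimage of 0, and with a rotation.\<close>

lemma interior_map_exists:
  assumes "\<gamma> \<in> loops0"
  shows "\<exists>\<phi>. interior_map \<gamma> \<phi>"
proof -
  let ?S = "inside \<gamma>"
  have 0: "0 \<in> ?S" and "\<gamma> \<in> loops plane" using assms by (auto simp: loops0_def)
  then obtain p where p: "simple_path p" "pathfinish p = pathstart p" "path_image p = \<gamma>"
    using loops_simple_path by blast
  have S: "open ?S" "bounded ?S" using Jordan_inside_outside[OF p(1,2)] p(3) by auto
  have "simply_connected ?S" using simply_connected_inside_simple_path[OF p(1)] p(3) by simp
  moreover have "?S \<noteq> UNIV" using S(2) not_bounded_UNIV by metis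
  ultimately obtain f g where fg: "f holomorphic_on ?S" "g holomorphic_on ball 0 1"
    "\<forall>z\<in>?S. f z \<in> ball 0 1 \<and> g (f z) = z" "\<forall>z\<in>ball 0 1. g z \<in> ?S \<and> f (g z) = z"
    using Riemann_mapping_theorem[of ?S] S(1) 0 by blast
  obtain f1 g1 where f1: "f1 (f 0) = 0" "f1 holomorphic_on ball 0 1" "f1 ` ball 0 1 \<subseteq> ball 0 1"
    "g1 holomorphic_on ball 0 1" "g1 ` ball 0 1 \<subseteq> ball 0 1"
    "\<And>z. z \<in> ball 0 1 \<Longrightarrow> f1 (g1 z) = z" "\<And>z. z \<in> ball 0 1 \<Longrightarrow> g1 (f1 z) = z"
    using ball_biholomorphism_exists[of "f 0"] fg(3) 0 by metis
  define h where "h = g \<circ> g1"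
  have hol: "h holomorphic_on ball 0 1"
    unfolding h_def using f1 fg by (intro holomorphic_on_compose_gen) auto
  have inj: "inj_on h (ball 0 1)"
  proof (rule inj_onI)
    fix x y assume xy: "x \<in> ball (0::complex) 1" "y \<in> ball 0 1" "h x = h y"
    then have "g1 x = g1 y" using fg(4) f1(5) by (metis comp_apply h_def image_subset_iff)
    then show "x = y" using f1(6) xy by metis
  qed
  have img: "h ` ball 0 1 = ?S"
  proof
    show "h ` ball 0 1 \<subseteq> ?S" using fg(4) f1(5) by (auto simp: h_def)
    show "?S \<subseteq> h ` ball 0 1"
    proof
      fix z assume z: "z \<in> ?S"
      then have fz: "f z \<in> ball 0 1" "g (f z) = z" using fg(3) by blast+
      then have "z = h (f1 (f z))" using f1(7)[OF fz(1)] by (simp add: h_def)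
      moreover have "f1 (f z) \<in> ball 0 1" using f1(3) fz(1) by blast
      ultimately show "z \<in> h ` ball 0 1" by blast
    qed
  qed
  have h0: "h 0 = 0" using f1(1) f1(7)[of "f 0"] fg(3) 0 by (simp add: h_def) 
  have d: "deriv h 0 \<noteq> 0" using holomorphic_injective_imp_regular[OF hol _ inj] by simp
  \<comment> \<open>The unimodular factor with e h'(0) = |h'(0)|.\<close>
  define e where "e = cnj (deriv h 0) / norm (deriv h 0)"
  have e: "norm e = 1" using d by (simp add: e_def norm_divide)
  have ball: "e * z \<in> ball 0 1 \<longleftrightarrow> z \<in> ball 0 1" for z using e by (simp add: norm_mult)
  have surj: "(*) e ` ball 0 1 = ball 0 1"
  proof
    show "ball 0 1 \<subseteq> (*) e ` ball 0 1"
    proof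
      fix z assume "z \<in> ball (0::complex) 1"
      moreover have "z = e * (z / e)" using e by auto
      ultimately show "z \<in> (*) e ` ball 0 1" using ball by (metis image_eqI)
    qed
  qed (use ball in blast)
  have dh: "h field_differentiable at (e * 0)"
    using hol by (simp add: holomorphic_on_imp_differentiable_at)
  have "interior_map \<gamma> (\<lambda>z. h (e * z))"
    unfolding interior_map_def
  proof (intro conjI)
    show "(\<lambda>z. h (e * z)) holomorphic_on ball 0 1"
      using ball by (intro holomorphic_on_scale[OF hol]) blast
    show "inj_on (\<lambda>z. h (e * z)) (ball 0 1)"
    proof (rule inj_onI)
      fix x y assume xy: "x \<in> ball (0::complex) 1" "y \<in> ball 0 1" "h (e * x) = h (e * y)"
      then have "e * x = e * y" using inj ball by (meson inj_onD)
      then show "x = y" using e by auto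
    qed
    have "(\<lambda>z. h (e * z)) ` ball 0 1 = h ` ((*) e ` ball 0 1)" by (simp add: image_image)
    then show "(\<lambda>z. h (e * z)) ` ball 0 1 = ?S" using img surj by simp
    show "h (e * 0) = 0" using h0 by simp
    have "deriv (\<lambda>z. h (e * z)) 0 = e * deriv h (e * 0)"
      by (rule deriv_compose_linear[OF dh])
    also have "\<dots> = of_real (norm (deriv h 0))"
      using d complex_norm_square[of "deriv h 0"] by (simp add: e_def power2_eq_square field_simps)
    finally show "\<exists>\<rho>>0. deriv (\<lambda>z. h (e * z)) 0 = complex_of_real \<rho>"
      using d by (intro exI[of _ "norm (deriv h 0)"]) simp
  qed
  then show ?thesis by blast
qed

text \<open>The map f is the inverse of psi after phi, a self-map of the disk that fixes 0; the
  Schwarz lemma will be applied to it and, with the roles exchanged, to its inverse.\<close>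

lemma interior_map_compare:
  assumes \<phi>: "interior_map \<gamma> \<phi>" and \<psi>: "interior_map \<gamma> \<psi>"
  shows "\<exists>f. f holomorphic_on ball 0 1 \<and> f 0 = 0 \<and> deriv f 0 = deriv \<phi> 0 / deriv \<psi> 0
    \<and> (\<forall>z. norm z < 1 \<longrightarrow> norm (f z) < 1 \<and> \<psi> (f z) = \<phi> z)"
proof -
  have hol: "\<psi> holomorphic_on ball 0 1" and inj: "inj_on \<psi> (ball 0 1)"
    and img: "\<psi> ` ball 0 1 = inside \<gamma>" "\<phi> ` ball 0 1 = inside \<gamma>"
    and hol\<phi>: "\<phi> holomorphic_on ball 0 1" and z: "\<phi> 0 = 0" "\<psi> 0 = 0"
    using \<phi> \<psi> by (auto simp: interior_map_def)
  obtain g where g: "g holomorphic_on (\<psi> ` ball 0 1)"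
    "\<And>z. z \<in> ball 0 1 \<Longrightarrow> deriv \<psi> z * deriv g (\<psi> z) = 1" "\<And>z. z \<in> ball 0 1 \<Longrightarrow> g (\<psi> z) = z"
    using holomorphic_has_inverse[OF hol open_ball inj] by metis
  have op: "open (\<psi> ` ball 0 1)"
    using open_mapping_thm3[OF hol open_ball inj] by simp
  have "deriv (g \<circ> \<phi>) 0 = deriv g (\<phi> 0) * deriv \<phi> 0"
  proof (rule deriv_chain)
    show "\<phi> field_differentiable at 0"
      using hol\<phi> by (simp add: holomorphic_on_imp_differentiable_at)
    show "g field_differentiable at (\<phi> 0)"
      using g(1) op z by (intro holomorphic_on_imp_differentiable_at[of _ "\<psi> ` ball 0 1"]) (auto intro!: image_eqI[of _ _ 0])
  qed
  moreover have "deriv g 0 = 1 / deriv \<psi> 0"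
  proof -
    have one: "deriv \<psi> 0 * deriv g 0 = 1" using g(2)[of 0] z by simp
    then have "deriv \<psi> 0 \<noteq> 0" by auto
    then show ?thesis using one by (simp add: eq_divide_eq mult.commute)
  qed
  ultimately have "deriv (g \<circ> \<phi>) 0 = deriv \<phi> 0 / deriv \<psi> 0" using z by simp
  moreover have "g \<circ> \<phi> holomorphic_on ball 0 1"
    using hol\<phi> g(1) img by (intro holomorphic_on_compose_gen) auto
  moreover have "(g \<circ> \<phi>) 0 = 0" using g(3)[of 0] z by simp
  moreover have "norm ((g \<circ> \<phi>) x) < 1 \<and> \<psi> ((g \<circ> \<phi>) x) = \<phi> x" if "norm x < 1" for x
  proof -
    have "\<phi> x \<in> \<psi> ` ball 0 1" using that img by auto
    then obtain y where "y \<in> ball 0 1" "\<phi> x = \<psi> y" by blast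
    then show ?thesis using g(3)[of y] by simp
  qed
  ultimately show ?thesis by blast
qed

text \<open>Schwarz in both directions equates the two derivatives at 0; the equality case makes f a
  rotation, and derivative 1 makes it the identity. Hence \<open>ucoeff\<close> and
  \<open>rho0\<close> do not depend on the choice in \<open>phi_plus\<close>.\<close>

lemma interior_map_unique:
  assumes \<phi>: "interior_map \<gamma> \<phi>" and \<psi>: "interior_map \<gamma> \<psi>" and z: "z \<in> ball 0 1"
  shows "\<phi> z = \<psi> z"
proof -
  obtain f where f: "f holomorphic_on ball 0 1" "f 0 = 0" "deriv f 0 = deriv \<phi> 0 / deriv \<psi> 0"
    "\<forall>z. norm z < 1 \<longrightarrow> norm (f z) < 1 \<and> \<psi> (f z) = \<phi> z"
    using interior_map_compare[OF \<phi> \<psi>] by blast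
  obtain g where g: "g holomorphic_on ball 0 1" "g 0 = 0" "deriv g 0 = deriv \<psi> 0 / deriv \<phi> 0"
    "\<forall>z. norm z < 1 \<longrightarrow> norm (g z) < 1"
    using interior_map_compare[OF \<psi> \<phi>] by blast
  obtain r s where r: "r > 0" "deriv \<phi> 0 = of_real r" and s: "s > 0" "deriv \<psi> 0 = of_real s"
    using \<phi> \<psi> by (auto simp: interior_map_def)
  have "norm (deriv f 0) \<le> 1" using Schwarz_Lemma(2)[OF f(1,2), of 0] f(4) by simp
  moreover have "norm (deriv g 0) \<le> 1" using Schwarz_Lemma(2)[OF g(1,2), of 0] g(4) by simp
  ultimately have "r = s" using r s f(3) g(3) by (simp add: norm_divide)
  then have df: "deriv f 0 = 1" using f(3) r s by simp
  then obtain \<alpha> where \<alpha>: "\<forall>z. norm z < 1 \<longrightarrow> f z = \<alpha> * z"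
    using Schwarz_Lemma(3)[OF f(1,2), of 0] f(4) by auto
  have "deriv f 0 = deriv ((*) \<alpha>) 0"
    using \<alpha> by (intro complex_derivative_transform_within_open[of _ "ball 0 1"] f(1)) (auto intro: holomorphic_intros)
  also have "\<dots> = \<alpha>" by simp
  finally have "f z = z" using \<alpha> z df by simp
  then show ?thesis using f(4) z by (metis mem_ball_0)
qed

lemma interior_map_phi_plus: "\<gamma> \<in> loops0 \<Longrightarrow> interior_map \<gamma> (phi_plus \<gamma>)"
  unfolding phi_plus_def using interior_map_exists by (rule someI_ex)

lemma rho0_pos:
  assumes "\<gamma> \<in> loops0"
  shows "rho0 \<gamma> > 0" "deriv (phi_plus \<gamma>) 0 = of_real (rho0 \<gamma>)"
  using interior_map_phi_plus[OF assms] by (auto simp: interior_map_def rho0_def)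

lemma ucoeff_0:
  assumes "\<gamma> \<in> loops0"
  shows "ucoeff \<gamma> 0 = 1"
  using rho0_pos[OF assms] by (simp add: ucoeff_def)

section \<open>Rotations of loops and their effect on the coordinates\<close>

context
  fixes w :: complex
  assumes w: "norm w = 1"
begin

private lemma w_cnj: "w * cnj w = 1" "cnj w * w = 1"
  using w complex_norm_square[of w] by (simp_all add: mult.commute)

private lemma w_nz: "w \<noteq> 0" using w by auto

lemma rotate_homeomorphism: "homeomorphism S ((*) w ` S) ((*) w) ((*) (cnj w))"
proof (rule homeomorphismI)
  show "(*) (cnj w) ` (*) w ` S \<subseteq> S" using w_cnj by (auto simp flip: mult.assoc)
qed (use w_cnj in \<open>auto intro!: continuous_intros simp flip: mult.assoc\<close>)

lemma rotate_Compl: "- ((*) w ` S) = (*) w ` (- S)"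
proof -
  have "bij ((*) w)" using w_nz by (intro bij_betw_byWitness[where f' = "\<lambda>z. z / w"]) auto
  then show ?thesis by (rule bij_image_Compl_eq[symmetric])
qed

lemma rotate_bounded: "bounded ((*) w ` S) \<longleftrightarrow> bounded S"
  using w by (simp add: bounded_iff norm_mult)

lemma rotate_inside_iff: "w * x \<in> inside ((*) w ` S) \<longleftrightarrow> x \<in> inside S"
proof (cases "x \<in> S")
  case False
  then have "x \<in> - S" by simp
  then have "connected_component_set (- ((*) w ` S)) (w * x) = (*) w ` connected_component_set (- S) x"
    unfolding rotate_Compl by (rule connected_component_set_homeomorphism[OF rotate_homeomorphism])
  moreover have "w * x \<notin> (*) w ` S" using False w_nz by auto
  ultimately show ?thesis using False rotate_bounded by (simp add: inside_def)
qed (auto simp: inside_def)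

lemma rotate_inside: "inside ((*) w ` S) = (*) w ` inside S"
proof (intro equalityI subsetI)
  fix z assume "z \<in> inside ((*) w ` S)"
  then have "cnj w * z \<in> inside S" using rotate_inside_iff[of "cnj w * z" S] w_cnj by (simp flip: mult.assoc)
  moreover have "z = w * (cnj w * z)" using w_cnj by (simp flip: mult.assoc)
  ultimately show "z \<in> (*) w ` inside S" by blast
qed (use rotate_inside_iff in blast)

lemma rotate_outside: "outside ((*) w ` S) = (*) w ` outside S"
  by (simp only: outside_inside rotate_inside image_Un[symmetric] rotate_Compl)

lemma rotate_loops:
  assumes "\<gamma> \<in> loops plane"
  shows "(*) w ` \<gamma> \<in> loops plane"
proof -
  obtain g where g: "continuous_on (sphere (0::complex) 1) g" "inj_on g (sphere 0 1)" "\<gamma> = g ` sphere 0 1"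
    using assms unfolding loops_plane by blast
  have "inj_on (\<lambda>z. w * g z) (sphere 0 1)" using g(2) w_nz by (auto simp: inj_on_def)
  moreover have "continuous_on (sphere 0 1) (\<lambda>z. w * g z)" using g(1) by (intro continuous_intros)
  moreover have "(*) w ` \<gamma> = (\<lambda>z. w * g z) ` sphere 0 1" using g(3) by (simp add: image_image)
  ultimately show ?thesis unfolding loops_plane by blast
qed

lemma rotate_loops0:
  assumes "\<gamma> \<in> loops0"
  shows "(*) w ` \<gamma> \<in> loops0"
  using assms rotate_loops rotate_inside_iff[of 0] by (simp add: loops0_def)

text \<open>Rotating the image by w and the disk by \<open>cnj w\<close> leaves the derivative at 0
  unchanged, so the normalization survives.\<close>

lemma rotate_interior_map:
  assumes "interior_map \<gamma> \<phi>"
  shows "interior_map ((*) w ` \<gamma>) (\<lambda>z. w * \<phi> (cnj w * z))"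
    "deriv (\<lambda>z. w * \<phi> (cnj w * z)) 0 = deriv \<phi> 0"
proof -
  have ball: "cnj w * z \<in> ball 0 1 \<longleftrightarrow> z \<in> ball 0 1" for z using w by (simp add: norm_mult)
  have im: "(*) (cnj w) ` ball 0 1 = ball 0 1"
  proof (intro equalityI subsetI)
    fix z assume "z \<in> ball (0::complex) 1"
    then have "w * z \<in> ball 0 1" "z = cnj w * (w * z)" using w w_cnj by (simp_all add: norm_mult flip: mult.assoc)
    then show "z \<in> (*) (cnj w) ` ball 0 1" by (intro image_eqI[of z _ "w * z"])
  qed (use ball in blast)
  have \<phi>: "\<phi> holomorphic_on ball 0 1" "inj_on \<phi> (ball 0 1)" "\<phi> ` ball 0 1 = inside \<gamma>" "\<phi> 0 = 0"
    using assms by (auto simp: interior_map_def)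
  have hol: "(\<lambda>z. \<phi> (cnj w * z)) holomorphic_on ball 0 1"
    using ball by (intro holomorphic_on_scale[OF \<phi>(1)]) blast
  have fd: "\<phi> field_differentiable at (cnj w * 0)"
    using \<phi>(1) by (simp add: holomorphic_on_imp_differentiable_at)
  have "deriv (\<lambda>z. w * \<phi> (cnj w * z)) 0 = w * deriv (\<lambda>z. \<phi> (cnj w * z)) 0"
    using hol by (intro deriv_cmult) (simp add: holomorphic_on_imp_differentiable_at)
  also have "\<dots> = deriv \<phi> 0"
    using deriv_compose_linear[OF fd] w_cnj by (simp flip: mult.assoc)
  finally show d: "deriv (\<lambda>z. w * \<phi> (cnj w * z)) 0 = deriv \<phi> 0" .
  have "inj_on (\<lambda>z. w * \<phi> (cnj w * z)) (ball 0 1)"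
  proof (rule inj_onI)
    fix x y assume xy: "x \<in> ball (0::complex) 1" "y \<in> ball 0 1" "w * \<phi> (cnj w * x) = w * \<phi> (cnj w * y)"
    then have "\<phi> (cnj w * x) = \<phi> (cnj w * y)" using w_nz by simp
    then have "cnj w * x = cnj w * y"
      using inj_onD[OF \<phi>(2)] iffD2[OF ball, OF xy(1)] iffD2[OF ball, OF xy(2)] by blast
    then show "x = y" using w_nz by simp
  qed
  moreover have "(\<lambda>z. w * \<phi> (cnj w * z)) ` ball 0 1 = inside ((*) w ` \<gamma>)"
  proof -
    have "(\<lambda>z. w * \<phi> (cnj w * z)) ` ball 0 1 = (*) w ` \<phi> ` ((*) (cnj w) ` ball 0 1)"
      by (simp add: image_image)
    then show ?thesis by (simp only: im \<phi> rotate_inside)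
  qed
  ultimately show "interior_map ((*) w ` \<gamma>) (\<lambda>z. w * \<phi> (cnj w * z))"
    using hol assms d by (auto simp: interior_map_def intro: holomorphic_intros)
qed

text \<open>Uniqueness identifies the map of the rotated loop; its derivative of order k + 1 at 0
  carries the factor w \<open>cnj w\<close>^(k+1) = \<open>cnj w\<close>^k.\<close>

lemma rotate_ucoeff:
  assumes "\<gamma> \<in> loops0"
  shows "ucoeff ((*) w ` \<gamma>) k = cnj w ^ k * ucoeff \<gamma> k"
proof -
  let ?\<phi> = "phi_plus \<gamma>" and ?\<psi> = "phi_plus ((*) w ` \<gamma>)"
  note \<phi> = interior_map_phi_plus[OF assms]
  note \<psi> = interior_map_phi_plus[OF rotate_loops0[OF assms]]
  note R = rotate_interior_map[OF \<phi>]
  have hol\<phi>: "?\<phi> holomorphic_on ball 0 1" and hol\<psi>: "?\<psi> holomorphic_on ball 0 1"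
    and holR: "(\<lambda>z. w * ?\<phi> (cnj w * z)) holomorphic_on ball 0 1"
    using \<phi> \<psi> R(1) by (auto simp: interior_map_def)
  have holr: "(\<lambda>z. ?\<phi> (cnj w * z)) holomorphic_on ball 0 1"
    using w by (intro holomorphic_on_scale[OF hol\<phi>]) (simp add: norm_mult)
  have d: "(deriv ^^ j) ?\<psi> 0 = w * (cnj w ^ j * (deriv ^^ j) ?\<phi> 0)" for j
  proof -
    have "(deriv ^^ j) ?\<psi> 0 = (deriv ^^ j) (\<lambda>z. w * ?\<phi> (cnj w * z)) 0"
      using interior_map_unique[OF \<psi> R(1)]
      by (intro higher_deriv_transform_within_open[OF hol\<psi> holR open_ball]) auto
    also have "\<dots> = w * (deriv ^^ j) (\<lambda>z. ?\<phi> (cnj w * z)) 0"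
      by (rule higher_deriv_cmult[OF holr]) auto
    also have "(deriv ^^ j) (\<lambda>z. ?\<phi> (cnj w * z)) 0 = cnj w ^ j * (deriv ^^ j) ?\<phi> (cnj w * 0)"
      using w by (intro higher_deriv_compose_linear[OF hol\<phi>, of "ball 0 1"]) (auto simp: norm_mult)
    finally show ?thesis by simp
  qed
  have "rho0 ((*) w ` \<gamma>) = rho0 \<gamma>"
    using d[of 1] w_cnj by (simp add: rho0_def flip: mult.assoc)
  moreover have "w * (cnj w ^ Suc k * x) = cnj w ^ k * x" for x
  proof -
    have "w * (cnj w ^ Suc k * x) = (w * cnj w) * (cnj w ^ k * x)" by (simp add: mult_ac)
    then show ?thesis by (simp only: w_cnj mult_1_left)
  qed
  ultimately show ?thesis unfolding ucoeff_def d by simp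
qed

lemma rotate_exterior_map:
  assumes "\<phi> holomorphic_on {z. 1 < norm z}" "inj_on \<phi> {z. 1 < norm z}"
    "\<phi> ` {z. 1 < norm z} = outside \<gamma>" "((\<lambda>z. \<phi> z / z) \<longlongrightarrow> l) at_infinity"
  shows "\<exists>\<psi>. \<psi> holomorphic_on {z. 1 < norm z} \<and> inj_on \<psi> {z. 1 < norm z} \<and>
    \<psi> ` {z. 1 < norm z} = outside ((*) w ` \<gamma>) \<and> ((\<lambda>z. \<psi> z / z) \<longlongrightarrow> l) at_infinity"
proof (intro exI conjI)
  let ?E = "{z::complex. 1 < norm z}" and ?\<psi> = "\<lambda>z. w * \<phi> (cnj w * z)"
  have E: "cnj w * z \<in> ?E \<longleftrightarrow> z \<in> ?E" for z using w by (simp add: norm_mult)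
  have im: "(*) (cnj w) ` ?E = ?E"
  proof (intro equalityI subsetI)
    fix z assume "z \<in> ?E"
    then have "w * z \<in> ?E" "z = cnj w * (w * z)" using w w_cnj by (simp_all add: norm_mult flip: mult.assoc)
    then show "z \<in> (*) (cnj w) ` ?E" by (intro image_eqI[of z _ "w * z"])
  qed (use E in blast)
  have "(\<lambda>z. \<phi> (cnj w * z)) holomorphic_on ?E"
    using E by (intro holomorphic_on_scale[OF assms(1)]) blast
  then show "?\<psi> holomorphic_on ?E" by (intro holomorphic_intros)
  show "inj_on ?\<psi> ?E"
  proof (rule inj_onI)
    fix x y assume xy: "x \<in> ?E" "y \<in> ?E" "?\<psi> x = ?\<psi> y"
    then have "\<phi> (cnj w * x) = \<phi> (cnj w * y)" using w_nz by simp
    then have "cnj w * x = cnj w * y"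
      using inj_onD[OF assms(2)] iffD2[OF E, OF xy(1)] iffD2[OF E, OF xy(2)] by blast
    then show "x = y" using w_nz by simp
  qed
  have "?\<psi> ` ?E = (*) w ` \<phi> ` ((*) (cnj w) ` ?E)" by (simp add: image_image)
  then show "?\<psi> ` ?E = outside ((*) w ` \<gamma>)" by (simp only: im assms(3) rotate_outside)
  have "filterlim (\<lambda>z. cnj w * z) at_infinity at_infinity"
    using w_nz by (intro tendsto_mult_filterlim_at_infinity[OF tendsto_const] filterlim_ident) auto
  from filterlim_compose[OF assms(4) this]
  have "((\<lambda>z. \<phi> (cnj w * z) / (cnj w * z)) \<longlongrightarrow> l) at_infinity" .
  moreover have "\<phi> (cnj w * z) / (cnj w * z) = ?\<psi> z / z" for z
  proof -
    have "cnj w = 1 / w" using w_cnj(1) w_nz by (simp add: field_simps)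
    then show ?thesis by simp
  qed
  ultimately show "((\<lambda>z. ?\<psi> z / z) \<longlongrightarrow> l) at_infinity" by simp
qed

end

text \<open>The predicate under the definite description is itself invariant: rotation by w gives
  one implication, rotation back by \<open>cnj w\<close> the other.\<close>

lemma rotate_rho_inf:
  assumes w: "norm w = 1"
  shows "rho_inf ((*) w ` \<gamma>) = rho_inf \<gamma>"
proof -
  let ?P = "\<lambda>\<gamma> \<rho>. \<exists>\<phi>. \<phi> holomorphic_on {z. 1 < norm z} \<and> inj_on \<phi> {z. 1 < norm z} \<and>
          \<phi> ` {z. 1 < norm z} = outside \<gamma> \<and> ((\<lambda>z. \<phi> z / z) \<longlongrightarrow> complex_of_real \<rho>) at_infinity"
  have 1: "?P ((*) v ` \<delta>) \<rho>" if "?P \<delta> \<rho>" "norm v = 1" for v \<delta> \<rho>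
    using that rotate_exterior_map[OF that(2)] by blast
  have unrot: "cnj w * (w * z) = z" for z
    using w complex_norm_square[of w] by (simp add: mult.commute flip: mult.assoc)
  have unrotate: "(*) (cnj w) ` (*) w ` \<gamma> = \<gamma>" by (simp only: image_image unrot image_ident)
  have "?P ((*) w ` \<gamma>) \<rho> \<longleftrightarrow> ?P \<gamma> \<rho>" for \<rho>
    using 1[of \<gamma> \<rho> w] 1[of "(*) w ` \<gamma>" \<rho> "cnj w"] w unfolding unrotate by auto
  then show ?thesis unfolding rho_inf_def by simp
qed

section \<open>Rotation invariance of the law\<close>

lemma riemann_surface_plane: "riemann_surface plane"
proof -
  have "second_countable (euclidean :: complex topology)"
  proof -
    obtain B :: "complex set set" where B: "countable B" "\<And>C. C \<in> B \<Longrightarrow> open C"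
      "\<And>S. open S \<Longrightarrow> \<exists>U. U \<subseteq> B \<and> S = \<Union>U"
      using univ_second_countable by blast
    have "\<exists>V\<in>B. x \<in> V \<and> V \<subseteq> S" if "open S" "x \<in> S" for S x
      using B(3)[OF that(1)] that(2) by blast
    then show ?thesis unfolding second_countable_def using B(1,2) by (intro exI[of _ B]) auto
  qed
  moreover have "connected_space (euclidean :: complex topology)"
    using connected_UNIV[where 'a = complex] by (metis connectedin_topspace connectedin_iff_connected topspace_euclidean)
  moreover have "(\<lambda>z. inv_into UNIV id z) holomorphic_on (UNIV :: complex set)"
    by (simp add: inv_id holomorphic_on_id)
  ultimately show ?thesis
    unfolding riemann_surface_def plane_def by (auto simp: Hausdorff_space_euclidean inv_id)
qed

lemma conformal_embedding_rotation:
  assumes "w \<noteq> 0"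
  shows "conformal_embedding plane plane ((*) w)"
proof -
  have "(\<lambda>z. w * z) holomorphic_on UNIV" by (intro holomorphic_intros)
  moreover have "continuous_on UNIV (\<lambda>z. w * z)" by (intro continuous_intros)
  ultimately show ?thesis
    using assms by (auto simp: conformal_embedding_def plane_def inj_on_def inv_id)
qed

lemma topspace_loop_topology: "topspace (loop_topology plane) = loops plane"
proof -
  have all: "loops plane \<in> {{\<gamma> \<in> loops plane. \<gamma> \<subseteq> V} | V. openin (surf_top plane) V}"
    by (auto simp: plane_def intro!: exI[of _ UNIV])
  show ?thesis
    unfolding loop_topology_def topology_generated_by_topspace
    by (intro antisym Union_least Union_upper UnI1 all) auto
qed

lemma loop_borel_sets: "sets (loop_borel plane) = sigma_sets (loops plane) {W. openin (loop_topology plane) W}"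
  and loop_borel_space: "space (loop_borel plane) = loops plane"
  and loop_open_Pow: "{W. openin (loop_topology plane) W} \<subseteq> Pow (loops plane)"
proof -
  show "{W. openin (loop_topology plane) W} \<subseteq> Pow (loops plane)"
    using openin_subset[of "loop_topology plane"] topspace_loop_topology by blast
  then show "sets (loop_borel plane) = sigma_sets (loops plane) {W. openin (loop_topology plane) W}"
    "space (loop_borel plane) = loops plane"
    unfolding loop_borel_def by (auto simp: sets_measure_of space_measure_of)
qed

definition rotate_loop :: "complex \<Rightarrow> complex set \<Rightarrow> complex set" where
  "rotate_loop w \<gamma> = (*) w ` \<gamma>"

lemma rotate_loops_plane: "norm w = 1 \<Longrightarrow> \<gamma> \<in> loops plane \<Longrightarrow> rotate_loop w \<gamma> \<in> loops plane"
  unfolding rotate_loop_def by (rule rotate_loops)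

lemma rotate_cnj:
  assumes "norm w = 1"
  shows "rotate_loop (cnj w) (rotate_loop w \<gamma>) = \<gamma>" "rotate_loop w (rotate_loop (cnj w) \<gamma>) = \<gamma>"
proof -
  have 1: "cnj w * (w * z) = z" "w * (cnj w * z) = z" for z
    using assms complex_norm_square[of w] by (simp_all add: mult.commute flip: mult.assoc)
  show "rotate_loop (cnj w) (rotate_loop w \<gamma>) = \<gamma>" "rotate_loop w (rotate_loop (cnj w) \<gamma>) = \<gamma>"
    by (simp_all only: rotate_loop_def image_image 1 image_ident)
qed

lemma rotate_continuous:
  assumes w: "norm w = 1"
  shows "continuous_map (loop_topology plane) (loop_topology plane) (rotate_loop w)"
  unfolding loop_topology_def[of plane]
proof (rule continuous_on_generated_topo, fold loop_topology_def)
  let ?A = "{{\<gamma> \<in> loops plane. \<gamma> \<subseteq> V} | V. openin (surf_top plane) V}"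
  let ?B = "{{\<gamma> \<in> loops plane. \<gamma> \<inter> V \<noteq> {}} | V. openin (surf_top plane) V}"
  have op: "openin (surf_top plane) ((*) w -` V)" if "openin (surf_top plane) V" for V
  proof -
    have "open ((*) w -` V)" 
      using that by (intro open_vimage continuous_intros) (simp add: plane_def)
    then show ?thesis by (simp add: plane_def)
  qed
  fix W assume "W \<in> ?A \<union> ?B"
  then consider V where "openin (surf_top plane) V" "W = {\<gamma> \<in> loops plane. \<gamma> \<subseteq> V}"
    | V where "openin (surf_top plane) V" "W = {\<gamma> \<in> loops plane. \<gamma> \<inter> V \<noteq> {}}" by blast
  then show "openin (loop_topology plane) (rotate_loop w -` W \<inter> topspace (loop_topology plane))"
  proof cases
    case 1
    have "rotate_loop w -` W \<inter> topspace (loop_topology plane) = {\<gamma> \<in> loops plane. \<gamma> \<subseteq> (*) w -` V}"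
      using rotate_loops_plane[OF w] by (auto simp: 1 topspace_loop_topology rotate_loop_def)
    then show ?thesis
      unfolding loop_topology_def using op[OF 1(1)] by (intro topology_generated_by_Basis) auto
  next
    case 2
    have "rotate_loop w -` W \<inter> topspace (loop_topology plane) = {\<gamma> \<in> loops plane. \<gamma> \<inter> (*) w -` V \<noteq> {}}"
      using rotate_loops_plane[OF w] by (auto simp: 2 topspace_loop_topology rotate_loop_def)
    then show ?thesis
      unfolding loop_topology_def using op[OF 2(1)] by (intro topology_generated_by_Basis) auto
  qed
next
  have "\<Union> ({{\<gamma> \<in> loops plane. \<gamma> \<subseteq> V} | V. openin (surf_top plane) V} \<union>
      {{\<gamma> \<in> loops plane. \<gamma> \<inter> V \<noteq> {}} | V. openin (surf_top plane) V}) = loops plane"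
    using topspace_loop_topology unfolding loop_topology_def topology_generated_by_topspace .
  then show "rotate_loop w ` topspace (loop_topology plane) \<subseteq> \<Union> ({{\<gamma> \<in> loops plane. \<gamma> \<subseteq> V} | V. openin (surf_top plane) V} \<union>
      {{\<gamma> \<in> loops plane. \<gamma> \<inter> V \<noteq> {}} | V. openin (surf_top plane) V})"
    using rotate_loops_plane[OF w] topspace_loop_topology by auto
qed

lemma rotate_measurable:
  assumes w: "norm w = 1"
  shows "rotate_loop w \<in> measurable (loop_borel plane) (loop_borel plane)"
proof (rule measurable_sigma_sets[OF loop_borel_sets loop_open_Pow])
  show "rotate_loop w \<in> space (loop_borel plane) \<rightarrow> loops plane"
    using rotate_loops_plane[OF w] by (auto simp: loop_borel_space)
  fix W assume "W \<in> {W. openin (loop_topology plane) W}"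
  then have "openin (loop_topology plane) (rotate_loop w -` W \<inter> loops plane)"
    using openin_continuous_map_preimage[OF rotate_continuous[OF w], of W]
    by (simp add: topspace_loop_topology vimage_def Int_def conj_commute)
  then show "rotate_loop w -` W \<inter> space (loop_borel plane) \<in> sets (loop_borel plane)"
    unfolding loop_borel_sets loop_borel_space by (intro sigma_sets.Basic) simp
qed

context
  fixes \<mu> :: "surface \<Rightarrow> complex set measure" and w :: complex
  assumes W: "werner_family \<mu>" and w: "norm w = 1"
begin

private lemma sets_mu: "sets (\<mu> plane) = sets (loop_borel plane)"
  using W riemann_surface_plane by (auto simp: werner_family_def)

private lemma space_mu: "space (\<mu> plane) = loops plane"
  using sets_eq_imp_space_eq[OF sets_mu] loop_borel_space by simp

text \<open>An equivalence, so that nonmeasurable sets correspond to each other as well; the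
  converse uses the inverse rotation.\<close>

lemma rotate_preimage_sets:
  "rotate_loop w -` A \<inter> loops plane \<in> sets (\<mu> plane) \<longleftrightarrow> A \<in> sets (\<mu> plane)" if "A \<subseteq> loops plane"
proof
  assume "A \<in> sets (\<mu> plane)"
  then show "rotate_loop w -` A \<inter> loops plane \<in> sets (\<mu> plane)"
    using measurable_sets[OF rotate_measurable[OF w], of A] by (simp add: sets_mu loop_borel_space)
next
  assume "rotate_loop w -` A \<inter> loops plane \<in> sets (\<mu> plane)"
  then have "rotate_loop (cnj w) -` (rotate_loop w -` A \<inter> loops plane) \<inter> loops plane \<in> sets (\<mu> plane)"
    using measurable_sets[OF rotate_measurable[of "cnj w"], of "rotate_loop w -` A \<inter> loops plane"] w
    by (simp add: sets_mu loop_borel_space)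
  also have "rotate_loop (cnj w) -` (rotate_loop w -` A \<inter> loops plane) \<inter> loops plane = A"
  proof (intro equalityI subsetI)
    fix \<gamma> assume "\<gamma> \<in> rotate_loop (cnj w) -` (rotate_loop w -` A \<inter> loops plane) \<inter> loops plane"
    then show "\<gamma> \<in> A" by (simp add: rotate_cnj[OF w])
  next
    fix \<gamma> assume \<gamma>: "\<gamma> \<in> A"
    then have "\<gamma> \<in> loops plane" using that by blast
    with \<gamma> show "\<gamma> \<in> rotate_loop (cnj w) -` (rotate_loop w -` A \<inter> loops plane) \<inter> loops plane"
      using rotate_loops_plane[of "cnj w" \<gamma>] w by (simp add: rotate_cnj[OF w])
  qed
  finally show "A \<in> sets (\<mu> plane)" .
qed

text \<open>On measurable sets this is conformal restriction for a bijective embedding of the plane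
  in itself. On all others both sides are 0 by the convention for \<open>emeasure\<close>.\<close>

lemma rotate_emeasure:
  assumes "A \<subseteq> loops plane"
  shows "emeasure (\<mu> plane) (rotate_loop w -` A \<inter> loops plane) = emeasure (\<mu> plane) A"
proof (cases "A \<in> sets (\<mu> plane)")
  case True
  have "w \<noteq> 0" using w by auto
  then have emb: "conformal_embedding plane plane ((*) w)" by (rule conformal_embedding_rotation)
  have "surj ((*) w)" using \<open>w \<noteq> 0\<close> by (intro surjI[of _ "\<lambda>z. z / w"]) simp
  then have sub: "\<gamma> \<subseteq> (*) w ` points plane" for \<gamma> by (simp add: plane_def)
  have CR: "conformal_restriction \<mu>" using W by (simp only: werner_family_def)
  have "A \<in> sets (loop_borel plane)" using True sets_mu by simp
  then have "emeasure (\<mu> plane) A = emeasure (\<mu> plane) {\<gamma> \<in> loops plane. (*) w ` \<gamma> \<in> A}"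
    by (rule CR[unfolded conformal_restriction_def, rule_format, OF conjI[OF riemann_surface_plane conjI[OF riemann_surface_plane emb]]])
       (rule sub)
  also have "{\<gamma> \<in> loops plane. (*) w ` \<gamma> \<in> A} = rotate_loop w -` A \<inter> loops plane"
    by (auto simp: rotate_loop_def)
  finally show ?thesis ..
next
  case False
  then show ?thesis using rotate_preimage_sets[OF assms] by (simp add: emeasure_notin_sets)
qed

lemma space_mu0: "space (mu0 \<mu>) = loops0"
  by (auto simp: mu0_def space_restrict_space space_mu loops0_def)

lemma rotate_loops0_iff:
  assumes "\<gamma> \<in> loops plane"
  shows "rotate_loop w \<gamma> \<in> loops0 \<longleftrightarrow> \<gamma> \<in> loops0"
  using rotate_loops0[OF w, of \<gamma>] rotate_loops0[of "cnj w" "rotate_loop w \<gamma>"] rotate_cnj[OF w] w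
  by (auto simp: rotate_loop_def)

text \<open>
  Whether or not \<open>loops0\<close> is a measurable set is irrelevant here, as \<open>restrict_space\<close> only
  depends on data preserved by rotations.
\<close>

lemma rotate_emeasure_mu0:
  assumes E: "E \<in> sets (mu0 \<mu>)"
  shows "rotate_loop w -` E \<inter> loops0 \<in> sets (mu0 \<mu>)"
    and "emeasure (mu0 \<mu>) (rotate_loop w -` E \<inter> loops0) = emeasure (mu0 \<mu>) E"
proof -
  have L: "loops0 \<subseteq> loops plane" by (auto simp: loops0_def)
  obtain A where A: "A \<in> sets (\<mu> plane)" "E = loops0 \<inter> A"
    using E by (auto simp: mu0_def sets_restrict_space)
  have AL: "A \<subseteq> loops plane" using sets.sets_into_space[OF A(1)] space_mu by simp
  have eq: "rotate_loop w -` E \<inter> loops0 = loops0 \<inter> (rotate_loop w -` A \<inter> loops plane)"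
    using rotate_loops0_iff L unfolding A(2) by blast
  show s: "rotate_loop w -` E \<inter> loops0 \<in> sets (mu0 \<mu>)"
    unfolding eq using rotate_preimage_sets[OF AL] A(1) by (auto simp: mu0_def sets_restrict_space)
  have EL: "E \<subseteq> loops plane" using A L by auto
  have "rotate_loop w -` E \<inter> loops0 = rotate_loop w -` E \<inter> loops plane"
    using rotate_loops0_iff L unfolding A(2) by blast
  then have "emeasure (\<mu> plane) (rotate_loop w -` E \<inter> loops0) = emeasure (\<mu> plane) E"
    using rotate_emeasure[OF EL] by simp
  moreover have "(\<inter>) loops0 ` sets (\<mu> plane) \<subseteq> Pow (loops0 \<inter> space (\<mu> plane))"
    using sets.sets_into_space by blast
  then have "sigma_sets (loops0 \<inter> space (\<mu> plane)) ((\<inter>) loops0 ` sets (\<mu> plane)) = sets (mu0 \<mu>)"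
    unfolding mu0_def restrict_space_def by (rule sets_measure_of[symmetric])
  ultimately show "emeasure (mu0 \<mu>) (rotate_loop w -` E \<inter> loops0) = emeasure (mu0 \<mu>) E"
    using s E unfolding mu0_def restrict_space_def emeasure_measure_of_conv by simp
qed

end

lemma dlog_sigma_finite: "sigma_finite_measure dlog"
  unfolding dlog_def by (subst sigma_finite_measure.sigma_finite_iff_density_finite[OF sigma_finite_lborel]) auto

text \<open>\<open>dlog\<close> has infinite mass; a window of finite positive mass allows the
  radial factor to be cancelled.\<close>

lemma dlog_interval: "0 < emeasure dlog {1..2::real}" "emeasure dlog {1..2::real} < \<infinity>"
proof -
  have eq: "emeasure dlog {1..2::real} = (\<integral>\<^sup>+x. ennreal (indicator {0<..} x / x) * indicator {1..2::real} x \<partial>lborel)"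
    unfolding dlog_def by (rule emeasure_density) auto
  have "(\<integral>\<^sup>+x. ennreal (indicator {0<..} x / x) * indicator {1..2::real} x \<partial>lborel)
      \<le> (\<integral>\<^sup>+x. indicator {1..2::real} x \<partial>lborel)"
    by (rule nn_integral_mono) (auto simp: indicator_def ennreal_le_1)
  also have "\<dots> = 1" by simp
  finally show "emeasure dlog {1..2::real} < \<infinity>" unfolding eq by (simp add: le_less_trans)
  have "ennreal (1/2) = (\<integral>\<^sup>+x. ennreal (1/2) * indicator {1..2::real} x \<partial>lborel)"
    by (subst nn_integral_cmult_indicator) auto
  also have "\<dots> \<le> (\<integral>\<^sup>+x. ennreal (indicator {0<..} x / x) * indicator {1..2::real} x \<partial>lborel)"
  proof (rule nn_integral_mono)
    fix x :: real
    show "ennreal (1/2) * indicator {1..2::real} x \<le> ennreal (indicator {0<..} x / x) * indicator {1..2} x"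
    proof (cases "x \<in> {1..2}")
      case True
      then have "ennreal (1/2) \<le> ennreal (1/x)" by (intro ennreal_leI) (simp add: field_simps)
      then show ?thesis using True by (simp add: indicator_def del: ennreal_half)
    qed simp
  qed
  finally have "ennreal (1/2) \<le> emeasure dlog {1..2::real}" unfolding eq .
  moreover have "0 < ennreal (1/2)" by (subst ennreal_less_zero_iff) simp
  ultimately show "0 < emeasure dlog {1..2::real}" by (rule order.strict_trans2[rotated])
qed

definition rotate_seq :: "complex \<Rightarrow> (nat \<Rightarrow> complex) \<Rightarrow> nat \<Rightarrow> complex" where
  "rotate_seq v s k = v ^ k * s k"

lemma rotate_seq_measurable: "rotate_seq v \<in> measurable seq_borel seq_borel"
proof (rule measurable_PiM_single')
  fix i :: nat
  have "(\<lambda>s. v ^ i * s i) \<in> borel_measurable seq_borel"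
    by (intro borel_measurable_times measurable_const measurable_component_singleton) auto
  then show "(\<lambda>s. rotate_seq v s i) \<in> measurable seq_borel borel" by (simp add: rotate_seq_def)
qed (auto simp: space_PiM)

lemma loop_law_rotation:
  assumes W: "werner_family \<mu>" and L: "loop_law \<mu> \<nu>" and v: "norm v = 1"
  shows "distr \<nu> seq_borel (rotate_seq v) = \<nu>"
proof -
  let ?G = "\<lambda>\<gamma>. (ucoeff \<gamma>, rho_inf \<gamma>)"
  \<comment> \<open>Rotation by w multiplies u_k by \<open>cnj w\<close>^k, so the conjugate of v
    realizes \<open>rotate_seq v\<close>.\<close>
  let ?w = "cnj v"
  have w: "norm ?w = 1" using v by simp
  obtain c :: real where pr: "prob_space \<nu>" and sets: "sets \<nu> = sets seq_borel"
    and G: "?G \<in> mu0 \<mu> \<rightarrow>\<^sub>M seq_borel \<Otimes>\<^sub>M borel" and c: "c > 0"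
    and D: "distr (mu0 \<mu>) (seq_borel \<Otimes>\<^sub>M borel) ?G = scale_measure (ennreal c) (\<nu> \<Otimes>\<^sub>M dlog)"
    using L by (auto simp: loop_law_def)
  have space: "space \<nu> = space seq_borel" by (rule sets_eq_imp_space_eq[OF sets])
  have dlog_sets: "sets dlog = sets borel" by (simp add: dlog_def)
  interpret dl: sigma_finite_measure dlog by (rule dlog_sigma_finite)
  let ?d = "emeasure dlog {1..2::real}"
  have meas: "emeasure (mu0 \<mu>) (?G -` (A \<times> {1..2::real}) \<inter> loops0) = ennreal c * (emeasure \<nu> A * ?d)"
    if A: "A \<in> sets seq_borel" for A
  proof -
    have "emeasure (mu0 \<mu>) (?G -` (A \<times> {1..2::real}) \<inter> loops0)
        = emeasure (distr (mu0 \<mu>) (seq_borel \<Otimes>\<^sub>M borel) ?G) (A \<times> {1..2::real})"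
      using A by (subst emeasure_distr[OF G]) (auto simp: space_mu0[OF W w])
    also have "\<dots> = ennreal c * emeasure (\<nu> \<Otimes>\<^sub>M dlog) (A \<times> {1..2::real})"
      unfolding D by simp
    also have "emeasure (\<nu> \<Otimes>\<^sub>M dlog) (A \<times> {1..2::real}) = emeasure \<nu> A * ?d"
      using A by (intro dl.emeasure_pair_measure_Times) (auto simp: sets dlog_sets)
    finally show ?thesis .
  qed
  show ?thesis
  proof (rule measure_eqI)
    show "sets (distr \<nu> seq_borel (rotate_seq v)) = sets \<nu>" by (simp add: sets)
    fix A assume "A \<in> sets (distr \<nu> seq_borel (rotate_seq v))"
    then have A: "A \<in> sets seq_borel" by simp
    let ?A' = "rotate_seq v -` A \<inter> space seq_borel"
    have A': "?A' \<in> sets seq_borel" using measurable_sets[OF rotate_seq_measurable A] .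
    let ?E = "?G -` (A \<times> {1..2::real}) \<inter> loops0"
    have "A \<times> {1..2::real} \<in> sets (seq_borel \<Otimes>\<^sub>M borel)" using A by simp
    from measurable_sets[OF G this] have E: "?E \<in> sets (mu0 \<mu>)" by (simp add: space_mu0[OF W w])
    have "ucoeff (rotate_loop ?w \<gamma>) = rotate_seq v (ucoeff \<gamma>)" "rho_inf (rotate_loop ?w \<gamma>) = rho_inf \<gamma>"
      if "\<gamma> \<in> loops0" for \<gamma>
      using rotate_ucoeff[OF w that] rotate_rho_inf[OF w]
      by (auto simp: rotate_loop_def rotate_seq_def fun_eq_iff)
    then have "rotate_loop ?w -` ?E \<inter> loops0 = ?G -` (?A' \<times> {1..2::real}) \<inter> loops0"
      using rotate_loops0[OF w] by (auto simp: rotate_loop_def space_PiM)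
    then have "emeasure (mu0 \<mu>) (?G -` (?A' \<times> {1..2::real}) \<inter> loops0) = emeasure (mu0 \<mu>) ?E"
      using rotate_emeasure_mu0(2)[OF W w E] by simp
    then have "ennreal c * (emeasure \<nu> ?A' * ?d) = ennreal c * (emeasure \<nu> A * ?d)"
      using meas[OF A] meas[OF A'] by simp
    then have "emeasure \<nu> ?A' * ?d = emeasure \<nu> A * ?d"
      using c by (simp add: ennreal_mult_cancel_left)
    then have "emeasure \<nu> ?A' = emeasure \<nu> A"
      using dlog_interval by (auto simp: mult.commute[of _ ?d] ennreal_mult_cancel_left)
    then show "emeasure (distr \<nu> seq_borel (rotate_seq v)) A = emeasure \<nu> A"
      using A rotate_seq_measurable[of v] sets space
      by (subst emeasure_distr) (auto simp: measurable_def)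
  qed
qed

lemma mono_val_measurable: "(\<lambda>s. mono_val P s) \<in> borel_measurable seq_borel"
  unfolding mono_val_def
  by (intro borel_measurable_prod borel_measurable_power measurable_component_singleton) auto

lemma mono_val_rotate: "mono_val P (rotate_seq v s) = v ^ weight P * mono_val P s"
  unfolding mono_val_def weight_def rotate_seq_def power_sum prod.distrib[symmetric]
  by (rule prod.cong) (simp_all only: power_mult_distrib power_mult)

text \<open>Invariance multiplies the moment by v^|P| (conj v)^|Q|, where |P| and |Q| are the
  weights, so one rotation with a phase other than 1 suffices.\<close>

theorem moment_unequal_weights:
  assumes W: "werner_family \<mu>" and L: "loop_law \<mu> \<nu>" and PQ: "weight P \<noteq> weight Q"
  shows "moment \<nu> P Q = 0"
proof -
  \<comment> \<open>The phase is cis of this number, and 0 < |x| <= 1 < 2 pi.\<close>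
  let ?x = "(real (weight P) - real (weight Q)) / real (weight P + weight Q)"
  define v where "v = cis (1 / real (weight P + weight Q))"
  let ?F = "\<lambda>s. mono_val P s * cnj (mono_val Q s)"
  have v: "norm v = 1" by (simp add: v_def)
  have sets: "sets \<nu> = sets seq_borel" using L by (simp add: loop_law_def)
  have cnj: "cnj \<in> borel_measurable borel"
    by (intro borel_measurable_continuous_onI continuous_intros)
  have F: "?F \<in> borel_measurable seq_borel"
    by (intro borel_measurable_times mono_val_measurable measurable_compose[OF mono_val_measurable cnj])
  have "moment \<nu> P Q = (\<integral>s. ?F s \<partial>(distr \<nu> seq_borel (rotate_seq v)))"
    unfolding moment_def loop_law_rotation[OF W L v] ..
  also have "\<dots> = (\<integral>s. ?F (rotate_seq v s) \<partial>\<nu>)"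
    using rotate_seq_measurable[of v] sets F
    by (intro integral_distr) (simp_all cong: measurable_cong_sets)
  also have "\<dots> = (\<integral>s. (v ^ weight P * cnj v ^ weight Q) * ?F s \<partial>\<nu>)"
    by (simp add: mono_val_rotate mult_ac)
  also have "\<dots> = (v ^ weight P * cnj v ^ weight Q) * moment \<nu> P Q"
    unfolding moment_def by (rule integral_mult_right_zero)
  finally have "(1 - v ^ weight P * cnj v ^ weight Q) * moment \<nu> P Q = 0"
    by (simp add: algebra_simps)
  moreover have "v ^ weight P * cnj v ^ weight Q \<noteq> 1"
  proof
    have pos: "0 < real (weight P + weight Q)" using PQ by simp
    have "v ^ weight P * cnj v ^ weight Q = cis ?x"
    proof -
      have pow: "v ^ k = cis (real k * (1 / real (weight P + weight Q)))" for k
        unfolding v_def by (rule Complex.DeMoivre)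
      have "v ^ weight P * cnj v ^ weight Q = v ^ weight P * cnj (v ^ weight Q)" by simp
      then show ?thesis unfolding pow by (simp add: cis_cnj cis_mult diff_divide_distrib)
    qed
    moreover assume "v ^ weight P * cnj v ^ weight Q = 1"
    ultimately have "cos ?x = 1" by (metis cis.simps(1) one_complex.simps(1))
    then obtain n :: int where n: "?x = of_int n * 2 * pi" using cos_one_2pi_int by auto
    have x: "\<bar>?x\<bar> \<le> 1" "?x \<noteq> 0" using pos PQ by (auto simp: abs_le_iff divide_simps)
    have small: "\<bar>of_int n * 2 * pi\<bar> \<le> 1" using x(1) unfolding n .
    have "n \<noteq> 0" using x(2) unfolding n by auto
    then have "\<bar>real_of_int n\<bar> \<ge> 1" by linarith
    then have "\<bar>of_int n * 2 * pi\<bar> \<ge> 2 * pi" by (simp add: abs_mult)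
    then show False using small pi_gt3 by linarith
  qed
  ultimately show ?thesis by simp
qed

section \<open>The operators on the coordinates of a loop\<close>

lemma peval_1 [simp]: "peval s 1 = 1"
  using peval_cst[of s 1] by simp

lemma deform_0 [simp]: "deform m 0 \<gamma> = \<gamma>"
  by (simp add: deform_def)

lemma loop_differentiable_const: "loop_differentiable m (\<lambda>\<gamma>. c) \<gamma>"
  by (simp add: loop_differentiable_def)

lemma loop_differentiable_add:
  "loop_differentiable m F \<gamma> \<Longrightarrow> loop_differentiable m G \<gamma> \<Longrightarrow> loop_differentiable m (\<lambda>\<gamma>. F \<gamma> + G \<gamma>) \<gamma>"
  by (simp add: loop_differentiable_def differentiable_add)

lemma loop_differentiable_mult:
  "loop_differentiable m F \<gamma> \<Longrightarrow> loop_differentiable m G \<gamma> \<Longrightarrow> loop_differentiable m (\<lambda>\<gamma>. F \<gamma> * G \<gamma>) \<gamma>"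
  by (simp add: loop_differentiable_def differentiable_mult)

lemma loop_differentiable_cnj:
  assumes "loop_differentiable m F \<gamma>"
  shows "loop_differentiable m (\<lambda>\<gamma>. cnj (F \<gamma>)) \<gamma>"
  using assms bounded_linear.has_derivative[OF bounded_linear_cnj]
  unfolding loop_differentiable_def differentiable_def by blast

lemma Lbar_const: "Lbar m (\<lambda>\<gamma>. c) \<gamma> = 0"
  by (simp add: Lbar_def)

text \<open>Differentiability is assumed here and for products because
  \<open>vector_derivative\<close> is a mere default value at points where no derivative
  exists.\<close>

lemma Lbar_add:
  "loop_differentiable m F \<gamma> \<Longrightarrow> loop_differentiable m G \<gamma> \<Longrightarrow>
    Lbar m (\<lambda>\<gamma>. F \<gamma> + G \<gamma>) \<gamma> = Lbar m F \<gamma> + Lbar m G \<gamma>"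
  by (simp add: Lbar_def loop_differentiable_def algebra_simps add_divide_distrib)

lemma Lbar_mult:
  "loop_differentiable m F \<gamma> \<Longrightarrow> loop_differentiable m G \<gamma> \<Longrightarrow>
    Lbar m (\<lambda>\<gamma>. F \<gamma> * G \<gamma>) \<gamma> = F \<gamma> * Lbar m G \<gamma> + Lbar m F \<gamma> * G \<gamma>"
  by (simp add: Lbar_def loop_differentiable_def algebra_simps add_divide_distrib)

text \<open>Chain rule at a fixed loop, with \<open>h\<close> the coefficient sequence or its
  conjugate. The coefficients of the \<open>A k\<close> may depend on that loop, so 1/rho_0 and conj
  u_1 can be frozen as constants.\<close>

lemma Lbar_pev:
  assumes "\<And>k. 1 \<le> k \<Longrightarrow> loop_differentiable m (\<lambda>\<gamma>. h \<gamma> k) \<gamma>"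
    and "\<And>k. 1 \<le> k \<Longrightarrow> Lbar m (\<lambda>\<gamma>. h \<gamma> k) \<gamma> = peval (h \<gamma>) (A k)"
  shows "loop_differentiable m (\<lambda>\<gamma>. peval (h \<gamma>) f) \<gamma> \<and> Lbar m (\<lambda>\<gamma>. peval (h \<gamma>) f) \<gamma> = peval (h \<gamma>) (der A f)"
proof (induction f rule: upoly_induct)
  case (const c)
  show ?case
    unfolding peval_cst derivation_cst[OF der_derivation]
    using loop_differentiable_const Lbar_const by (simp add: peval_def)
next
  case (add f g)
  then show ?case
    unfolding peval_add derivation_add[OF der_derivation]
    by (simp add: loop_differentiable_add Lbar_add)
next
  case (var i f)
  have U: "peval s (U (Suc i)) = s (Suc i)" for s
    by (simp add: peval_def U_Suc linext_single mono_val_def)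
  show ?case
    unfolding peval_mult U derivation_mult[OF der_derivation] peval_add
    using var assms[of "Suc i"]
    by (simp add: loop_differentiable_mult Lbar_mult der_U)
qed

lemma variational_rules:
  assumes "variational_formulas" "\<gamma> \<in> loops0"
  defines "\<rho> \<equiv> complex_of_real (rho0 \<gamma>)" and "u \<equiv> ucoeff \<gamma>"
  shows "m \<in> {1, 2} \<Longrightarrow> loop_differentiable m (\<lambda>\<gamma>. of_real (rho0 \<gamma>)) \<gamma>"
    and "m \<in> {1, 2} \<Longrightarrow> 1 \<le> k \<Longrightarrow> loop_differentiable m (\<lambda>\<gamma>. ucoeff \<gamma> k) \<gamma>"
    and "Lbar 1 (\<lambda>\<gamma>. of_real (rho0 \<gamma>)) \<gamma> = - cnj (u 1)"
    and "Lbar 2 (\<lambda>\<gamma>. of_real (rho0 \<gamma>)) \<gamma> = cnj (P2 u) / (2 * \<rho>)"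
    and "1 \<le> k \<Longrightarrow> Lbar 1 (\<lambda>\<gamma>. ucoeff \<gamma> k) \<gamma> = of_nat k * (u (k - 1) - cnj (u 1) * u k) / \<rho>"
    and "1 \<le> k \<Longrightarrow> Lbar 1 (\<lambda>\<gamma>. cnj (ucoeff \<gamma> k)) \<gamma>
      = of_nat (k + 2) * (cnj (u 1) * cnj (u k) - cnj (u (k + 1))) / \<rho>"
    and "1 \<le> k \<Longrightarrow> Lbar 2 (\<lambda>\<gamma>. ucoeff \<gamma> k) \<gamma>
      = (of_nat k / 2 * u k * cnj (P2 u) - 3 * of_nat k * u (k - 1) * cnj (u 1)
          + of_nat (k - 1) * u (k - 2)) / \<rho>^2"
    and "1 \<le> k \<Longrightarrow> Lbar 2 (\<lambda>\<gamma>. cnj (ucoeff \<gamma> k)) \<gamma>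
      = cnj (pinv u (k + 2) - of_nat (k + 3) * u (k + 2) + 3 * of_nat (k + 2) * u 1 * u (k + 1)
          - of_nat (k + 2) / 2 * P2 u * u k) / \<rho>^2"
  unfolding \<rho>_def u_def
  using assms(1)[unfolded variational_formulas_def Let_def, rule_format, OF assms(2)] by blast+

text \<open>The multiples of conj u_1 combine: - n from the first factor by Euler's identity, n - 1
  from the second and - 1 from rho_0 give - 2, the zeroth-order term of \<open>R1\<close>. The
  bidegree (n, n - 1) makes the sum independent of n.\<close>

lemma L_images_1:
  assumes V: variational_formulas and n: "1 \<le> n" and a: "a \<in> graded n" and b: "b \<in> graded (n - 1)"
  shows "tensor (lower1 a) b + tensor a (R1 b) \<in> L_images"
proof -
  have "Lbar 1 (\<lambda>\<gamma>. of_real (rho0 \<gamma>) ^ 1 * bieval (tensor a b) (ucoeff \<gamma>)) \<gamma>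
      = bieval (tensor (lower1 a) b + tensor a (R1 b)) (ucoeff \<gamma>)" if \<gamma>: "\<gamma> \<in> loops0" for \<gamma>
  proof -
    define \<rho> where "\<rho> = complex_of_real (rho0 \<gamma>)"
    define u where "u = ucoeff \<gamma>"
    define t where "t = (\<lambda>i. cnj (u i))"
    have \<rho>: "\<rho> \<noteq> 0" using rho0_pos(1)[OF \<gamma>] by (simp add: \<rho>_def)
    have u0: "u 0 = 1" "t 0 = 1" using ucoeff_0[OF \<gamma>] by (simp_all add: u_def t_def)
    note var = variational_rules[OF V \<gamma>, folded \<rho>_def u_def]
    let ?A = "\<lambda>k. cst (1/\<rho>) * (of_nat k * U (k - 1) - cst (t 1) * (of_nat k * U k))"
    \<comment> \<open>The factor k + 2 is split into an Euler part k u_1 u_k and minus the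
      coefficient of \<open>raise1_der\<close>.\<close>
    let ?B = "\<lambda>k. cst (1/\<rho>) * (U 1 * (of_nat k * U k) - (of_nat (k + 2) * U (k + 1) - 2 * U 1 * U k))"
    have A: "loop_differentiable 1 (\<lambda>\<gamma>. peval (ucoeff \<gamma>) a) \<gamma>"
      "Lbar 1 (\<lambda>\<gamma>. peval (ucoeff \<gamma>) a) \<gamma> = peval u (der ?A a)"
    proof -
      have "Lbar 1 (\<lambda>\<gamma>. ucoeff \<gamma> k) \<gamma> = peval (ucoeff \<gamma>) (?A k)" if "1 \<le> k" for k
        using var(5)[OF that] u0 unfolding u_def[symmetric]
        by (simp add: peval_simps t_def algebra_simps diff_divide_distrib)
      from Lbar_pev[OF var(2) this, of a] show "loop_differentiable 1 (\<lambda>\<gamma>. peval (ucoeff \<gamma>) a) \<gamma>"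
        "Lbar 1 (\<lambda>\<gamma>. peval (ucoeff \<gamma>) a) \<gamma> = peval u (der ?A a)" by (simp_all add: u_def)
    qed
    have B: "loop_differentiable 1 (\<lambda>\<gamma>. peval (\<lambda>i. cnj (ucoeff \<gamma> i)) b) \<gamma>"
      "Lbar 1 (\<lambda>\<gamma>. peval (\<lambda>i. cnj (ucoeff \<gamma> i)) b) \<gamma> = peval t (der ?B b)"
    proof -
      have L: "Lbar 1 (\<lambda>\<gamma>. cnj (ucoeff \<gamma> k)) \<gamma> = peval (\<lambda>i. cnj (ucoeff \<gamma> i)) (?B k)" if "1 \<le> k" for k
        using var(6)[OF that] u0 unfolding u_def[symmetric] t_def[symmetric]
        by (simp add: peval_simps t_def algebra_simps diff_divide_distrib add_divide_distrib)
      have d: "loop_differentiable 1 (\<lambda>\<gamma>. cnj (ucoeff \<gamma> k)) \<gamma>" if "1 \<le> k" for k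
        using loop_differentiable_cnj[OF var(2)[of 1 k]] that by simp
      from Lbar_pev[where h = "\<lambda>\<gamma> i. cnj (ucoeff \<gamma> i)", OF d L, of b]
      show "loop_differentiable 1 (\<lambda>\<gamma>. peval (\<lambda>i. cnj (ucoeff \<gamma> i)) b) \<gamma>"
        "Lbar 1 (\<lambda>\<gamma>. peval (\<lambda>i. cnj (ucoeff \<gamma> i)) b) \<gamma> = peval t (der ?B b)" by (simp_all add: u_def t_def)
    qed
    have dA: "der ?A a = cst (1/\<rho>) * (lower1 a - cst (t 1) * (of_nat n * a))"
      unfolding der_scale_coeff der_diff_coeff lower1_def der_euler[OF a] ..
    have dB: "der ?B b = cst (1/\<rho>) * (U 1 * (of_nat (n - 1) * b) - raise1_der b)"
      unfolding der_scale_coeff der_diff_coeff[of "\<lambda>k. U 1 * (of_nat k * U k)"] raise1_der_def der_euler[OF b] ..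
    obtain l where l: "n = Suc l" using n by (cases n) auto
    have "Lbar 1 (\<lambda>\<gamma>. of_real (rho0 \<gamma>) ^ 1 * bieval (tensor a b) (ucoeff \<gamma>)) \<gamma>
      = \<rho> * (peval u a * peval t (der ?B b) + peval u (der ?A a) * peval t b) - t 1 * (peval u a * peval t b)"
      unfolding bieval_tens power_one_right
      by (simp del: One_nat_def add: Lbar_mult loop_differentiable_mult A B var(1,3)) (simp add: \<rho>_def u_def t_def)
    also have "\<dots> = peval u (lower1 a) * peval t b + peval u a * peval t (R1 b)"
      unfolding dA dB R1_raise1 raise1_def using \<rho> u0 by (simp add: peval_simps l field_simps)
    finally show ?thesis by (simp add: bieval_add bieval_tens u_def t_def)
  qed
  then show ?thesis unfolding L_images_def using tensor_bigraded[OF a b] n by blast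
qed

text \<open>The conjugate of P_2 occurs n/2 times from the first factor, - (n - 2)/2 times from the
  second, once from rho_0^2 and - 2 times from rewriting the field through \<open>R2\<close>; these
  cancel. The terms u_(k-1) conj u_1 produce the \<open>lower1\<close> summand.\<close>

lemma L_images_2:
  assumes V: variational_formulas and n: "2 \<le> n" and a: "a \<in> graded n" and b: "b \<in> graded (n - 2)"
  shows "tensor (lower2 a) b - tensor (lower1 a) (3 * U 1 * b) + tensor a (R2 b) \<in> L_images"
proof -
  have "Lbar 2 (\<lambda>\<gamma>. of_real (rho0 \<gamma>) ^ 2 * bieval (tensor a b) (ucoeff \<gamma>)) \<gamma>
      = bieval (tensor (lower2 a) b - tensor (lower1 a) (3 * U 1 * b) + tensor a (R2 b)) (ucoeff \<gamma>)"
    if \<gamma>: "\<gamma> \<in> loops0" for \<gamma>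
  proof -
    define \<rho> where "\<rho> = complex_of_real (rho0 \<gamma>)"
    define u where "u = ucoeff \<gamma>"
    define t where "t = (\<lambda>i. cnj (u i))"
    have \<rho>: "\<rho> \<noteq> 0" using rho0_pos(1)[OF \<gamma>] by (simp add: \<rho>_def)
    have u0: "u 0 = 1" "t 0 = 1" using ucoeff_0[OF \<gamma>] by (simp_all add: u_def t_def)
    note var = variational_rules[OF V \<gamma>, folded \<rho>_def u_def]
    let ?A = "\<lambda>k. cst (1/\<rho>^2) * (cst (P2 t / 2) * (of_nat k * U k) - cst (3 * t 1) * (of_nat k * U (k - 1))
        + of_nat (k - 1) * U (k - 2))"
    let ?C = "\<lambda>k. P2 U * U k - 3 * of_nat (k + 2) * U 1 * U (k + 1) + of_nat (k + 3) * U (k + 2) - pinv U (k + 2)"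
    \<comment> \<open>\<open>?C k\<close> contains P_2 u_k once, so of the factor (k + 2)/2 only k/2
      is left for the Euler part.\<close>
    let ?B = "\<lambda>k. cst (1/\<rho>^2) * ((- 1) * ?C k - cst (1/2) * P2 U * (of_nat k * U k))"
    have P2: "peval t (P2 U) = P2 t" using u0 by (simp add: P2_def peval_simps)
    have cP2: "cnj (P2 u) = P2 t" by (simp add: P2_def t_def)
    have A: "loop_differentiable 2 (\<lambda>\<gamma>. peval (ucoeff \<gamma>) a) \<gamma>"
      "Lbar 2 (\<lambda>\<gamma>. peval (ucoeff \<gamma>) a) \<gamma> = peval u (der ?A a)"
    proof -
      have "Lbar 2 (\<lambda>\<gamma>. ucoeff \<gamma> k) \<gamma> = peval (ucoeff \<gamma>) (?A k)" if "1 \<le> k" for k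
        using var(7)[OF that] u0 unfolding u_def[symmetric] cP2
        by (simp add: peval_simps t_def algebra_simps diff_divide_distrib add_divide_distrib)
      from Lbar_pev[OF var(2) this, of a] show "loop_differentiable 2 (\<lambda>\<gamma>. peval (ucoeff \<gamma>) a) \<gamma>"
        "Lbar 2 (\<lambda>\<gamma>. peval (ucoeff \<gamma>) a) \<gamma> = peval u (der ?A a)" by (simp_all add: u_def)
    qed
    have B: "loop_differentiable 2 (\<lambda>\<gamma>. peval (\<lambda>i. cnj (ucoeff \<gamma> i)) b) \<gamma>"
      "Lbar 2 (\<lambda>\<gamma>. peval (\<lambda>i. cnj (ucoeff \<gamma> i)) b) \<gamma> = peval t (der ?B b)"
    proof -
      have L: "Lbar 2 (\<lambda>\<gamma>. cnj (ucoeff \<gamma> k)) \<gamma> = peval (\<lambda>i. cnj (ucoeff \<gamma> i)) (?B k)" if "1 \<le> k" for k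
      proof -
        have "Lbar 2 (\<lambda>\<gamma>. cnj (ucoeff \<gamma> k)) \<gamma> = (pinv t (k + 2) - of_nat (k + 3) * t (k + 2)
            + 3 * of_nat (k + 2) * t 1 * t (k + 1) - of_nat (k + 2) / 2 * P2 t * t k) / \<rho>^2"
          unfolding var(8)[OF that] complex_cnj_diff complex_cnj_add complex_cnj_mult complex_cnj_divide
            cP2 cnj_pinv[of u, OF u0(1)] by (simp add: t_def)
        also have "\<dots> = peval t (?B k)"
          unfolding peval_mult peval_diff peval_add P2 peval_pinv[of t, OF u0(2)]
          using u0 by (simp add: peval_simps algebra_simps diff_divide_distrib add_divide_distrib)
        finally show ?thesis by (simp add: t_def u_def)
      qed
      have d: "loop_differentiable 2 (\<lambda>\<gamma>. cnj (ucoeff \<gamma> k)) \<gamma>" if "1 \<le> k" for k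
        using loop_differentiable_cnj[OF var(2)[of 2 k]] that by simp
      from Lbar_pev[where h = "\<lambda>\<gamma> i. cnj (ucoeff \<gamma> i)", OF d L, of b]
      show "loop_differentiable 2 (\<lambda>\<gamma>. peval (\<lambda>i. cnj (ucoeff \<gamma> i)) b) \<gamma>"
        "Lbar 2 (\<lambda>\<gamma>. peval (\<lambda>i. cnj (ucoeff \<gamma> i)) b) \<gamma> = peval t (der ?B b)" by (simp_all add: u_def t_def)
    qed
    have dA: "der ?A a = cst (1/\<rho>^2) * (cst (P2 t / 2) * (of_nat n * a) - cst (3 * t 1) * lower1 a + lower2 a)"
      unfolding der_scale_coeff der_add_coeff der_diff_coeff lower1_def lower2_def der_euler[OF a] ..
    have R2: "R2 b = 2 * P2 U * b - der ?C b"
      by (simp only: R2_def der_def)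
    have "der ?B b = cst (1/\<rho>^2) * ((- 1) * der ?C b - cst (1/2) * P2 U * der (\<lambda>k. of_nat k * U k) b)"
      unfolding der_scale_coeff der_diff_coeff[of "\<lambda>k. (- 1) * ?C k"] ..
    then have dB: "der ?B b = cst (1/\<rho>^2) * (R2 b - 2 * P2 U * b - cst (1/2) * P2 U * (of_nat (n - 2) * b))"
      unfolding R2 der_euler[OF b] by simp
    obtain l where l: "n = l + 2" using n by (metis add.commute le_Suc_ex)
    have "Lbar 2 (\<lambda>\<gamma>. of_real (rho0 \<gamma>) ^ 2 * bieval (tensor a b) (ucoeff \<gamma>)) \<gamma>
      = \<rho> * \<rho> * (peval u a * peval t (der ?B b) + peval u (der ?A a) * peval t b)
        + (\<rho> * (P2 t / (2 * \<rho>)) + P2 t / (2 * \<rho>) * \<rho>) * (peval u a * peval t b)"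
      unfolding bieval_tens power2_eq_square[of "complex_of_real (rho0 \<gamma>)" for \<gamma>]
      by (simp del: One_nat_def add: Lbar_mult loop_differentiable_mult A B var(1,4) cP2) (simp add: \<rho>_def u_def t_def)
    also have "\<dots> = peval u (lower2 a) * peval t b - peval u (lower1 a) * (3 * t 1 * peval t b) + peval u a * peval t (R2 b)"
      unfolding dA dB peval_mult peval_diff peval_add P2 using \<rho> u0
      by (simp add: peval_simps l field_simps power2_eq_square)
    finally show ?thesis using u0 by (simp add: bieval_add bieval_diff bieval_tens peval_simps u_def t_def)
  qed
  then show ?thesis unfolding L_images_def using tensor_bigraded[OF a b] n by blast
qed

lemma moment_0:
  assumes "loop_law \<mu> \<nu>"
  shows "moment \<nu> 0 0 = 1"
proof -
  interpret prob_space \<nu> using assms by (simp add: loop_law_def)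
  show ?thesis by (simp add: moment_def mono_val_def prob_space)
qed

text \<open>The identities in use pair equal weights only, so they fix an array there, starting from
  its value at (0, 0); rotation invariance accounts for the other moments.\<close>

theorem proposition6p13:
  shows "(\<forall>n\<ge>2. adjoint_kernel R1 1 n \<inter> adjoint_kernel R2 2 n = {0})
    \<and> (\<forall>n\<ge>2. {a + b | a b. a \<in> R1 ` graded (n - 1) \<and> b \<in> R2 ` graded (n - 2)} = graded n)
    \<and> (\<forall>\<mu> \<nu>. werner_family \<mu> \<and> loop_law \<mu> \<nu> \<and> variational_formulas
              \<and> satisfies_L_identities (moment \<nu>) \<longrightarrow>
          (\<forall>M. M 0 0 = 1 \<and> satisfies_L_identities M \<longrightarrow>
             (\<forall>P Q. weight P = weight Q \<longrightarrow> M P Q = moment \<nu> P Q))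
          \<and> (\<forall>P Q. weight P \<noteq> weight Q \<longrightarrow> moment \<nu> P Q = 0))"
proof (intro conjI allI impI)
  fix n :: nat assume "2 \<le> n"
  then show "adjoint_kernel R1 1 n \<inter> adjoint_kernel R2 2 n = {0}"
    by (rule adjoint_kernels_trivial)
next
  fix n :: nat assume "2 \<le> n"
  then show "{a + b | a b. a \<in> R1 ` graded (n - 1) \<and> b \<in> R2 ` graded (n - 2)} = graded n"
    by (rule graded_R1_R2)
next
  fix \<mu> \<nu> M P Q
  assume *: "werner_family \<mu> \<and> loop_law \<mu> \<nu> \<and> variational_formulas \<and> satisfies_L_identities (moment \<nu>)"
    and M: "M 0 0 = 1 \<and> satisfies_L_identities M" and PQ: "weight P = weight Q"
  from * have V: variational_formulas and L: "loop_law \<mu> \<nu>" and m: "satisfies_L_identities (moment \<nu>)"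
    by simp_all
  show "M P Q = moment \<nu> P Q"
    by (rule moments_unique[OF L_images_1[OF V] L_images_2[OF V] conjunct2[OF M] conjunct1[OF M] m moment_0[OF L] PQ])
next
  fix \<mu> \<nu> P Q
  assume "werner_family \<mu> \<and> loop_law \<mu> \<nu> \<and> variational_formulas \<and> satisfies_L_identities (moment \<nu>)"
    and "weight P \<noteq> weight Q"
  then show "moment \<nu> P Q = 0"
    using moment_unequal_weights[of \<mu> \<nu> P Q] by simp
qed

end
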